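(* Let $\mathcal G$ be a locally compact étale groupoid such that either $\mathcal G$ is Hausdorff or $\mathcal G$ can be covered by countably many open bisections. Let $\mathcal H\subset\mathcal G$ be an open subgroupoid such that the set $X:=\{x\in\mathcal H^{(0)}\mid\mathcal H^x_x=\mathcal G^x_x\}$ is dense in $\mathcal G^{(0)}$. Then $I\subset J_{\mathrm{sing}}$ for any ideal $I\subset C^*_r(\mathcal G)$ such that $C^*_r(\mathcal H)\cap I=0$.
   Context: $\mathcal G$ is a groupoid with unit space $\mathcal G^{(0)}$, range $r(g)=gg^{-1}$ and source $s(g)=g^{-1}g$; $\mathcal G_x=s^{-1}(x)$, $\mathcal G^x=r^{-1}(x)$, and $\mathcal G^x_x=\mathcal G_x\cap\mathcal G^x$ is the isotropy group at $x$. A locally compact étale groupoid is a groupoid with a (not necessarily Hausdorff) topology such that the groupoid operations are continuous, $\mathcal G^{(0)}$ is a locally compact Hausdorff space in the relative topology, and $r$ is a local homeomorphism. A bisection is a subset $W\subset\mathcal G$ such that $r|_W\colon W\to r(W)$ and $s|_W\colon W\to s(W)$ are bijections. $C_c(\mathcal G)$ is the linear span of the functions $f$ on $\mathcal G$ that vanish outside some open Hausdorff subset $W\subset\mathcal G$ and whose restriction to $W$ is continuous and compactly supported; it is a $*$-algebra with $(f_1*f_2)(g)=\sum_{h\in\mathcal G^{r(g)}}f_1(h)f_2(h^{-1}g)$ and $f^*(g)=\overline{f(g^{-1})}$. For $x\in\mathcal G^{(0)}$, $\rho_x\colon C_c(\mathcal G)\to B(\ell^2(\mathcal G_x))$ is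 $\rho_x(f)\delta_g=\sum_{h\in\mathcal G_{r(g)}}f(h)\delta_{hg}$. $C^*_r(\mathcal G)$ is the completion of $C_c(\mathcal G)$ in the reduced norm $\|f\|_r=\sup_{x}\|\rho_x(f)\|$; each $\rho_x$ extends to $C^*_r(\mathcal G)$. For an open subgroupoid $\mathcal H\subset\mathcal G$ (with unit space $\mathcal H^{(0)}\subset\mathcal G^{(0)}$), $C_c(\mathcal H)\subset C_c(\mathcal G)$ via extension of functions by zero, and $C^*_r(\mathcal H)$ is identified with the closure of $C_c(\mathcal H)$ in $C^*_r(\mathcal G)$. Ideals are closed and two-sided. The singular ideal is $J_{\mathrm{sing}}=\{a\in C^*_r(\mathcal G)\mid \text{the set of }x\in\mathcal G^{(0)}\text{ such that }\rho_x(a)\delta_x\ne0\text{ is meager}\}$ (it is $0$ if $\mathcal G$ is Hausdorff). A subset is meager if it is a countable union of nowhere dense sets. *)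

theory Defs
  imports "HOL-Analysis.Analysis"
begin

section \<open>Topological groupoids\<close>

text \<open>The set of arrows is the topspace of \<^term>\<open>gtop G\<close>. The product \<^term>\<open>gmul G g h\<close> is meaningful
  only for composable pairs, i.e. when the source of \<open>g\<close> is the range of \<open>h\<close>.\<close>

record 'a top_groupoid =
  gtop :: "'a topology"
  gmul :: "'a \<Rightarrow> 'a \<Rightarrow> 'a"
  ginv :: "'a \<Rightarrow> 'a"

definition arrows :: "'a top_groupoid \<Rightarrow> 'a set" where
  "arrows G = topspace (gtop G)"

definition rng :: "'a top_groupoid \<Rightarrow> 'a \<Rightarrow> 'a" where
  "rng G g = gmul G g (ginv G g)"

definition src :: "'a top_groupoid \<Rightarrow> 'a \<Rightarrow> 'a" where
  "src G g = gmul G (ginv G g) g"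

definition units :: "'a top_groupoid \<Rightarrow> 'a set" where
  "units G = rng G ` arrows G"

definition src_fiber :: "'a top_groupoid \<Rightarrow> 'a \<Rightarrow> 'a set" where
  "src_fiber G x = {g \<in> arrows G. src G g = x}"

definition rng_fiber :: "'a top_groupoid \<Rightarrow> 'a \<Rightarrow> 'a set" where
  "rng_fiber G x = {g \<in> arrows G. rng G g = x}"

definition isotropy :: "'a top_groupoid \<Rightarrow> 'a \<Rightarrow> 'a set" where
  "isotropy G x = src_fiber G x \<inter> rng_fiber G x"

definition unit_top :: "'a top_groupoid \<Rightarrow> 'a topology" where
  "unit_top G = subtopology (gtop G) (units G)"

definition composable :: "'a top_groupoid \<Rightarrow> ('a \<times> 'a) set" where
  "composable G = {(g, h). g \<in> arrows G \<and> h \<in> arrows G \<and> src G g = rng G h}"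

locale groupoid =
  fixes G :: "'a top_groupoid"
  assumes inv_closed: "g \<in> arrows G \<Longrightarrow> ginv G g \<in> arrows G"
    and inv_inv: "g \<in> arrows G \<Longrightarrow> ginv G (ginv G g) = g"
    and mul_closed: "(g, h) \<in> composable G \<Longrightarrow> gmul G g h \<in> arrows G"
    and rng_mul: "(g, h) \<in> composable G \<Longrightarrow> rng G (gmul G g h) = rng G g"
    and src_mul: "(g, h) \<in> composable G \<Longrightarrow> src G (gmul G g h) = src G h"
    and mul_assoc: "\<lbrakk>(g, h) \<in> composable G; (h, k) \<in> composable G\<rbrakk>
          \<Longrightarrow> gmul G (gmul G g h) k = gmul G g (gmul G h k)"
    and rng_unit: "g \<in> arrows G \<Longrightarrow> gmul G (rng G g) g = g"
    and src_unit: "g \<in> arrows G \<Longrightarrow> gmul G g (src G g) = g"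

definition local_homeomorphism :: "'a topology \<Rightarrow> 'b topology \<Rightarrow> ('a \<Rightarrow> 'b) \<Rightarrow> bool" where
  "local_homeomorphism S T f \<longleftrightarrow>
    (\<forall>x \<in> topspace S. \<exists>U. openin S U \<and> x \<in> U \<and> openin T (f ` U) \<and>
       homeomorphic_map (subtopology S U) (subtopology T (f ` U)) f)"

locale lc_etale_groupoid = groupoid G for G :: "'a top_groupoid" +
  assumes continuous_mul:
      "continuous_map (subtopology (prod_topology (gtop G) (gtop G)) (composable G)) (gtop G)
         (\<lambda>(g, h). gmul G g h)"
    and continuous_inv: "continuous_map (gtop G) (gtop G) (ginv G)"
    and Hausdorff_units: "Hausdorff_space (unit_top G)"
    and locally_compact_units: "locally_compact_space (unit_top G)"
    and etale: "local_homeomorphism (gtop G) (unit_top G) (rng G)"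

definition bisection :: "'a top_groupoid \<Rightarrow> 'a set \<Rightarrow> bool" where
  "bisection G W \<longleftrightarrow>
    W \<subseteq> arrows G \<and> bij_betw (rng G) W (rng G ` W) \<and> bij_betw (src G) W (src G ` W)"

definition open_subgroupoid :: "'a top_groupoid \<Rightarrow> 'a set \<Rightarrow> bool" where
  "open_subgroupoid G H \<longleftrightarrow> openin (gtop G) H \<and> (\<forall>h \<in> H. ginv G h \<in> H) \<and>
     (\<forall>(g, h) \<in> composable G \<inter> H \<times> H. gmul G g h \<in> H)"

definition restrict_groupoid :: "'a top_groupoid \<Rightarrow> 'a set \<Rightarrow> 'a top_groupoid" where
  "restrict_groupoid G H = G\<lparr>gtop := subtopology (gtop G) H\<rparr>"


section \<open>The space \<open>C\<^sub>c\<close>\<close>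

text \<open>All functions vanish outside the space. Hence, for an open subspace \<open>H\<close> of \<open>T\<close>, the functions in
  \<open>Cc (subtopology T H)\<close> are already extended by zero to \<open>T\<close>.\<close>

definition Cc_gen :: "'a topology \<Rightarrow> ('a \<Rightarrow> complex) set" where
  "Cc_gen T = {f. \<exists>W. openin T W \<and> Hausdorff_space (subtopology T W) \<and>
     (\<forall>g. g \<notin> W \<longrightarrow> f g = 0) \<and>
     continuous_map (subtopology T W) euclidean f \<and>
     compactin (subtopology T W) ((subtopology T W) closure_of {g \<in> W. f g \<noteq> 0})}"

definition Cc :: "'a topology \<Rightarrow> ('a \<Rightarrow> complex) set" where
  "Cc T = {(\<lambda>g. \<Sum>\<phi>\<in>F. c \<phi> * \<phi> g) | F c. finite F \<and> F \<subseteq> Cc_gen T}"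


section \<open>Square-summable functions and the representations \<open>\<rho>\<^sub>x\<close>\<close>

definition ell2 :: "'a set \<Rightarrow> ('a \<Rightarrow> complex) set" where
  "ell2 S = {\<xi>. (\<forall>g. g \<notin> S \<longrightarrow> \<xi> g = 0) \<and> (\<lambda>g. (cmod (\<xi> g))\<^sup>2) summable_on S}"

definition ell2_norm :: "'a set \<Rightarrow> ('a \<Rightarrow> complex) \<Rightarrow> real" where
  "ell2_norm S \<xi> = sqrt (\<Sum>\<^sub>\<infinity>g\<in>S. (cmod (\<xi> g))\<^sup>2)"

definition delta :: "'a \<Rightarrow> 'a \<Rightarrow> complex" where
  "delta g = (\<lambda>k. if k = g then 1 else 0)"

type_synonym 'a operator = "('a \<Rightarrow> complex) \<Rightarrow> ('a \<Rightarrow> complex)"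

definition op_norm :: "'a set \<Rightarrow> 'a operator \<Rightarrow> ennreal" where
  "op_norm S A = (SUP \<xi> \<in> {\<xi> \<in> ell2 S. ell2_norm S \<xi> \<le> 1}. ennreal (ell2_norm S (A \<xi>)))"

text \<open>Operators are extended by zero outside \<^term>\<open>ell2 S\<close>, so that equality of operators is equality
  of functions.\<close>

definition bounded_ops :: "'a set \<Rightarrow> 'a operator set" where
  "bounded_ops S = {A.
     (\<forall>\<xi> \<in> ell2 S. A \<xi> \<in> ell2 S) \<and>
     (\<forall>\<xi>. \<xi> \<notin> ell2 S \<longrightarrow> A \<xi> = (\<lambda>_. 0)) \<and>
     (\<forall>\<xi> \<in> ell2 S. \<forall>\<eta> \<in> ell2 S. A (\<lambda>g. \<xi> g + \<eta> g) = (\<lambda>g. A \<xi> g + A \<eta> g)) \<and>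
     (\<forall>c. \<forall>\<xi> \<in> ell2 S. A (\<lambda>g. c * \<xi> g) = (\<lambda>g. c * A \<xi> g)) \<and>
     op_norm S A < \<infinity>}"

text \<open>The vector \<open>\<rho>\<^sub>x(f) \<delta>\<^sub>g\<close> does not depend on \<open>x = s(g)\<close>; for \<open>f\<close> in \<open>C\<^sub>c\<close> the sum is finite
  at every point. The operator \<open>\<rho>\<^sub>x(f)\<close> is its linear extension, computed coordinatewise.\<close>

definition rho_delta :: "'a top_groupoid \<Rightarrow> ('a \<Rightarrow> complex) \<Rightarrow> 'a \<Rightarrow> ('a \<Rightarrow> complex)" where
  "rho_delta G f g = (\<lambda>k. \<Sum>\<^sub>\<infinity>h\<in>src_fiber G (rng G g). f h * delta (gmul G h g) k)"

definition rho :: "'a top_groupoid \<Rightarrow> ('a \<Rightarrow> complex) \<Rightarrow> 'a \<Rightarrow> 'a operator" where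
  "rho G f x \<xi> =
    (if x \<in> units G \<and> \<xi> \<in> ell2 (src_fiber G x)
     then (\<lambda>k. \<Sum>\<^sub>\<infinity>g\<in>src_fiber G x. \<xi> g * rho_delta G f g k) else (\<lambda>_. 0))"

lemma delta_in_ell2: "g \<in> S \<Longrightarrow> delta g \<in> ell2 S"
proof -
  assume g: "g \<in> S"
  have "(\<lambda>k. (cmod (delta g k))\<^sup>2) summable_on S \<longleftrightarrow> (\<lambda>k. (cmod (delta g k))\<^sup>2) summable_on {g}"
    by (rule summable_on_cong_neutral) (use g in \<open>auto simp: delta_def\<close>)
  then show ?thesis using g by (auto simp: ell2_def delta_def)
qed

lemma rho_on_delta:
  assumes "x \<in> units G" "g \<in> src_fiber G x"
  shows "rho G f x (delta g) = (\<lambda>k. \<Sum>\<^sub>\<infinity>h\<in>src_fiber G (rng G g). f h * delta (gmul G h g) k)"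
proof
  fix k
  have "(\<Sum>\<^sub>\<infinity>j\<in>src_fiber G x. delta g j * rho_delta G f j k)
      = (\<Sum>\<^sub>\<infinity>j\<in>{g}. delta g j * rho_delta G f j k)"
    by (rule infsum_cong_neutral) (use assms in \<open>auto simp: delta_def\<close>)
  then show "rho G f x (delta g) k
      = (\<Sum>\<^sub>\<infinity>h\<in>src_fiber G (rng G g). f h * delta (gmul G h g) k)"
    using assms delta_in_ell2[of g "src_fiber G x"]
    by (simp add: rho_def rho_delta_def delta_def)
qed


section \<open>The reduced C*-algebra\<close>

text \<open>The completion of \<open>C\<^sub>c(\<G>)\<close> in the reduced norm is realised as the norm closure of the image of
  \<open>f \<mapsto> (\<rho>\<^sub>x(f))\<^sub>x\<close> in the C*-algebra of bounded families in the product of all \<open>B(\<ell>\<^sup>2(\<G>\<^sub>x))\<close>,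
  where \<open>x\<close> runs over the units. This map is injective and isometric for the reduced norm, and it turns
  convolution into componentwise composition. The extension of \<open>\<rho>\<^sub>x\<close> to the completion is the
  evaluation \<open>a \<mapsto> a x\<close>. Families are extended by zero outside the units.\<close>

type_synonym 'a op_family = "'a \<Rightarrow> 'a operator"

definition red_norm :: "'a top_groupoid \<Rightarrow> 'a op_family \<Rightarrow> ennreal" where
  "red_norm G a = (SUP x \<in> units G. op_norm (src_fiber G x) (a x))"

definition op_families :: "'a top_groupoid \<Rightarrow> 'a op_family set" where
  "op_families G = {a.
     (\<forall>x \<in> units G. a x \<in> bounded_ops (src_fiber G x)) \<and>
     (\<forall>x. x \<notin> units G \<longrightarrow> a x = (\<lambda>_ _. 0)) \<and>
     red_norm G a < \<infinity>}"

definition fam_zero :: "'a op_family" where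
  "fam_zero = (\<lambda>x \<xi> g. 0)"

definition fam_add :: "'a op_family \<Rightarrow> 'a op_family \<Rightarrow> 'a op_family" where
  "fam_add a b = (\<lambda>x \<xi> g. a x \<xi> g + b x \<xi> g)"

definition fam_diff :: "'a op_family \<Rightarrow> 'a op_family \<Rightarrow> 'a op_family" where
  "fam_diff a b = (\<lambda>x \<xi> g. a x \<xi> g - b x \<xi> g)"

definition fam_scale :: "complex \<Rightarrow> 'a op_family \<Rightarrow> 'a op_family" where
  "fam_scale c a = (\<lambda>x \<xi> g. c * a x \<xi> g)"

definition fam_mult :: "'a op_family \<Rightarrow> 'a op_family \<Rightarrow> 'a op_family" where
  "fam_mult a b = (\<lambda>x. a x \<circ> b x)"

definition red_closure :: "'a top_groupoid \<Rightarrow> 'a op_family set \<Rightarrow> 'a op_family set" where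
  "red_closure G D =
    {a \<in> op_families G. \<forall>\<epsilon>>0. \<exists>d \<in> D. red_norm G (fam_diff a d) < ennreal \<epsilon>}"

definition Cstar_r :: "'a top_groupoid \<Rightarrow> 'a op_family set" where
  "Cstar_r G = red_closure G (rho G ` Cc (gtop G))"

text \<open>\<open>C\<^sup>*\<^sub>r(\<H>)\<close> for an open subgroupoid \<open>H\<close>, as the closure of \<open>C\<^sub>c(\<H>)\<close> inside \<open>C\<^sup>*\<^sub>r(\<G>)\<close>.\<close>

definition Cstar_r_sub :: "'a top_groupoid \<Rightarrow> 'a set \<Rightarrow> 'a op_family set" where
  "Cstar_r_sub G H = Cstar_r G \<inter> red_closure G (rho G ` Cc (gtop (restrict_groupoid G H)))"

definition closed_ideal :: "'a top_groupoid \<Rightarrow> 'a op_family set \<Rightarrow> bool" where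
  "closed_ideal G I \<longleftrightarrow>
     I \<subseteq> Cstar_r G \<and> fam_zero \<in> I \<and>
     (\<forall>a \<in> I. \<forall>b \<in> I. fam_add a b \<in> I) \<and>
     (\<forall>c. \<forall>a \<in> I. fam_scale c a \<in> I) \<and>
     (\<forall>a \<in> I. \<forall>b \<in> Cstar_r G. fam_mult a b \<in> I \<and> fam_mult b a \<in> I) \<and>
     Cstar_r G \<inter> red_closure G I \<subseteq> I"


section \<open>The singular ideal\<close>

definition nowhere_dense_in :: "'a topology \<Rightarrow> 'a set \<Rightarrow> bool" where
  "nowhere_dense_in T S \<longleftrightarrow> S \<subseteq> topspace T \<and> T interior_of (T closure_of S) = {}"

definition meager_in :: "'a topology \<Rightarrow> 'a set \<Rightarrow> bool" where
  "meager_in T S \<longleftrightarrow> (\<exists>\<N>. countable \<N> \<and> (\<forall>N \<in> \<N>. nowhere_dense_in T N) \<and> S = \<Union>\<N>)"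

definition J_sing :: "'a top_groupoid \<Rightarrow> 'a op_family set" where
  "J_sing G = {a \<in> Cstar_r G.
     meager_in (unit_top G) {x \<in> units G. a x (delta x) \<noteq> (\<lambda>_. 0)}}"

end

theory Submission
  imports Defs
begin

text \<open>
  Let \<open>a \<in> I\<close> and let \<open>x\<close> be a unit with \<open>G\<^sub>x\<^sup>x \<subseteq> H\<close>. Approximate \<open>a\<close> by some \<open>f \<in> C\<^sub>c(G)\<close> and choose a bump
  function \<open>q\<close> on the units with \<open>q x = 1\<close> and small support. Then \<open>b = q f q\<close> lies in \<open>C\<^sub>c(H)\<close>, because the isotropy at
  \<open>x\<close> is contained in \<open>H\<close>, and \<open>b\<close> is close to \<open>q a q \<in> I\<close>. So \<open>T = b\<^sup>* b\<close> is at distance \<open>< \<epsilon>\<close> from \<open>I\<close> for a small \<open>\<epsilon>\<close>.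
  A multiple \<open>T (T - \<epsilon>)\<^sub>+\<close> of the positive part of \<open>T - \<epsilon>\<close> then belongs both to \<open>I\<close> and to the closure of \<open>C\<^sub>c(H)\<close>,
  so it vanishes, \<open>T \<le> \<epsilon>\<close>, and \<open>b\<close> is small. Hence \<open>a \<delta>\<^sub>x\<close> has coefficient \<open>0\<close> at \<open>x\<close>, and as \<open>I\<close> is an ideal, \<open>a \<delta>\<^sub>x = 0\<close>.

  The function \<open>g \<mapsto> (a \<delta>\<^bsub>s(g)\<^esub>)(g)\<close> thus vanishes on a dense set. It is a uniform limit of functions in \<open>C\<^sub>c(G)\<close>, each
  of which is continuous off a closed nowhere dense set (which is empty in the Hausdorff case). So it vanishes off a
  countable union of such sets, whose intersections with bisections have nowhere dense images in the unit space.
\<close>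

section \<open>The Hilbert space of square-summable functions\<close>

text \<open>The bound on \<open>b\<close> is an explicit form of the fact that the injective map
  from C*_r(H) to C*_r(G)/I is isometric. Quotients and spectral theory are avoided: with
  \<open>S = T - \<delta>\<close>, a polynomial iteration produces \<open>|S|\<close>, and
  \<open>P = |S| + S\<close> satisfies \<open>P T = P (\<delta> + |S|)\<close>. Hence multiplying
  \<open>P\<close> by \<open>1 - |S| + T\<close> is the same as scaling it by
  \<open>1 + \<delta>\<close>, while modulo the ideal \<open>T\<close> can be exchanged for an
  element of norm below \<open>\<delta>\<close>. This gap makes a geometric series converge and puts
  \<open>T P\<close> into the ideal. Two obstacles shape the rest. The Hilbert spaces vary with the
  unit x, so all operators are moved into one Banach algebra and elements of C*_r(G) become bounded
  functions of x; every approximation must be uniform in x. And G need not be Hausdorff: compact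
  sets need not be closed and functions in C_c(G) need not be continuous on G. Hence the work with
  functions living on a single open bisection, which is Hausdorff.\<close>

lemma cmod_add_sq_le: "(cmod (a + b))\<^sup>2 \<le> 2 * (cmod a)\<^sup>2 + 2 * (cmod b)\<^sup>2"
proof -
  have "(cmod (a + b))\<^sup>2 \<le> (cmod a + cmod b)\<^sup>2"
    by (intro power_mono norm_triangle_ineq) auto
  also have "\<dots> \<le> 2 * (cmod a)\<^sup>2 + 2 * (cmod b)\<^sup>2"
    using sum_squares_bound[of "cmod a" "cmod b"] by (simp add: power2_sum)
  finally show ?thesis .
qed

lemma ell2_add:
  assumes "\<xi> \<in> ell2 S" "\<eta> \<in> ell2 S"
  shows "(\<lambda>g. \<xi> g + \<eta> g) \<in> ell2 S"
proof -
  have "(\<lambda>g. 2 * (cmod (\<xi> g))\<^sup>2 + 2 * (cmod (\<eta> g))\<^sup>2) summable_on S"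
    using assms by (intro summable_on_add summable_on_cmult_right) (auto simp: ell2_def)
  then have "(\<lambda>g. (cmod (\<xi> g + \<eta> g))\<^sup>2) summable_on S"
    by (rule summable_on_comparison_test) (auto intro: cmod_add_sq_le)
  then show ?thesis using assms by (auto simp: ell2_def)
qed

lemma ell2_scale: "\<xi> \<in> ell2 S \<Longrightarrow> (\<lambda>g. c * \<xi> g) \<in> ell2 S"
  by (auto simp: ell2_def norm_mult power_mult_distrib intro!: summable_on_cmult_right)

lemma ell2_zero [simp]: "(\<lambda>_. 0) \<in> ell2 S"
  by (auto simp: ell2_def)

lemma ell2_mono: "\<xi> \<in> ell2 S \<Longrightarrow> S \<subseteq> S' \<Longrightarrow> \<xi> \<in> ell2 S'"
  unfolding ell2_def
  by (auto intro: summable_on_cong_neutral[THEN iffD1, rotated -1])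

lemma ell2_restrict: "\<xi> \<in> ell2 S' \<Longrightarrow> S \<subseteq> S' \<Longrightarrow> (\<lambda>g. if g \<in> S then \<xi> g else 0) \<in> ell2 S"
  unfolding ell2_def
  by (auto intro: summable_on_subset_banach cong: summable_on_cong)

text \<open>All source fibres sit in this one Hilbert space through extension by zero, so that
  operators on different fibres become elements of one type.\<close>

typedef 'a l2 = "ell2 (UNIV :: 'a set)" morphisms coord Abs_l2
  by (rule exI[of _ "\<lambda>_. 0"]) simp

setup_lifting type_definition_l2

lemma l2_summable: "(\<lambda>g. (cmod (coord \<xi> g))\<^sup>2) summable_on UNIV"
  using coord[of \<xi>] by (auto simp: ell2_def)

instantiation l2 :: (type) real_vector
begin
lift_definition zero_l2 :: "'a l2" is "\<lambda>_. 0" by simp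
lift_definition plus_l2 :: "'a l2 \<Rightarrow> 'a l2 \<Rightarrow> 'a l2" is "\<lambda>\<xi> \<eta> g. \<xi> g + \<eta> g" by (rule ell2_add)
lift_definition uminus_l2 :: "'a l2 \<Rightarrow> 'a l2" is "\<lambda>\<xi> g. - \<xi> g" by (auto simp: ell2_def)
lift_definition minus_l2 :: "'a l2 \<Rightarrow> 'a l2 \<Rightarrow> 'a l2" is "\<lambda>\<xi> \<eta> g. \<xi> g - \<eta> g"
proof -
  fix \<xi> \<eta> :: "'a \<Rightarrow> complex" assume "\<xi> \<in> ell2 UNIV" "\<eta> \<in> ell2 UNIV"
  then show "(\<lambda>g. \<xi> g - \<eta> g) \<in> ell2 UNIV"
    using ell2_add[of \<xi> UNIV "\<lambda>g. (-1) * \<eta> g"] ell2_scale[of \<eta> UNIV "-1"] by simp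
qed
lift_definition scaleR_l2 :: "real \<Rightarrow> 'a l2 \<Rightarrow> 'a l2" is "\<lambda>r \<xi> g. r *\<^sub>R \<xi> g"
  by (simp add: scaleR_conv_of_real ell2_scale)
instance
  by standard (transfer; simp add: fun_eq_iff algebra_simps)+
end

lemma coord_simps [simp]:
  "coord 0 g = 0" "coord (\<xi> + \<eta>) g = coord \<xi> g + coord \<eta> g" "coord (\<xi> - \<eta>) g = coord \<xi> g - coord \<eta> g"
  "coord (- \<xi>) g = - coord \<xi> g" "coord (r *\<^sub>R \<xi>) g = r *\<^sub>R coord \<xi> g"
  by (transfer; simp)+

lemma l2_eqI: "(\<And>g. coord \<xi> g = coord \<eta> g) \<Longrightarrow> \<xi> = \<eta>"
  by (metis coord_inject ext)

lemma l2_inner_summable: "(\<lambda>g. inner (coord \<xi> g) (coord \<eta> g)) summable_on UNIV"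
proof -
  have "(\<lambda>g. (cmod (coord \<xi> g))\<^sup>2 + (cmod (coord \<eta> g))\<^sup>2) summable_on UNIV"
    by (intro summable_on_add l2_summable)
  then have "(\<lambda>g. norm (inner (coord \<xi> g) (coord \<eta> g))) summable_on UNIV"
  proof (rule summable_on_comparison_test)
    fix g
    have "\<bar>inner (coord \<xi> g) (coord \<eta> g)\<bar> \<le> cmod (coord \<xi> g) * cmod (coord \<eta> g)"
      by (rule Cauchy_Schwarz_ineq2)
    also have "\<dots> \<le> (cmod (coord \<xi> g))\<^sup>2 + (cmod (coord \<eta> g))\<^sup>2"
      using sum_squares_bound[of "cmod (coord \<xi> g)" "cmod (coord \<eta> g)"]
        mult_nonneg_nonneg[OF norm_ge_zero[of "coord \<xi> g"] norm_ge_zero[of "coord \<eta> g"]] by linarith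
    finally show "norm (inner (coord \<xi> g) (coord \<eta> g)) \<le> (cmod (coord \<xi> g))\<^sup>2 + (cmod (coord \<eta> g))\<^sup>2"
      by simp
  qed auto
  then show ?thesis by (rule abs_summable_summable)
qed

text \<open>The form is the real part of the usual complex inner product. It induces the same norm,
  and adjoints and positivity are used below only through real-valued forms.\<close>

instantiation l2 :: (type) real_inner
begin
definition inner_l2 :: "'a l2 \<Rightarrow> 'a l2 \<Rightarrow> real" where
  "inner_l2 \<xi> \<eta> = (\<Sum>\<^sub>\<infinity>g. inner (coord \<xi> g) (coord \<eta> g))"
definition norm_l2 :: "'a l2 \<Rightarrow> real" where "norm_l2 \<xi> = sqrt (inner \<xi> \<xi>)"
definition sgn_l2 :: "'a l2 \<Rightarrow> 'a l2" where "sgn_l2 \<xi> = \<xi> /\<^sub>R norm \<xi>"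
definition dist_l2 :: "'a l2 \<Rightarrow> 'a l2 \<Rightarrow> real" where "dist_l2 \<xi> \<eta> = norm (\<xi> - \<eta>)"
definition uniformity_l2 :: "('a l2 \<times> 'a l2) filter" where
  "uniformity_l2 = (INF e\<in>{0<..}. principal {(x, y). dist x y < e})"
definition open_l2 :: "'a l2 set \<Rightarrow> bool" where
  "open_l2 U = (\<forall>x\<in>U. \<forall>\<^sub>F (x', y) in uniformity. x' = x \<longrightarrow> y \<in> U)"
instance
proof
  fix \<xi> \<eta> \<zeta> :: "'a l2" and r :: real
  show "inner \<xi> \<eta> = inner \<eta> \<xi>" by (simp add: inner_l2_def inner_commute)
  show "inner (\<xi> + \<eta>) \<zeta> = inner \<xi> \<zeta> + inner \<eta> \<zeta>"
    unfolding inner_l2_def by (simp add: inner_add_left infsum_add l2_inner_summable)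
  show "inner (r *\<^sub>R \<xi>) \<eta> = r * inner \<xi> \<eta>"
    unfolding inner_l2_def by (simp add: infsum_cmult_right l2_inner_summable)
  show "0 \<le> inner \<xi> \<xi>" unfolding inner_l2_def by (rule infsum_nonneg) simp
  show "inner \<xi> \<xi> = 0 \<longleftrightarrow> \<xi> = 0"
  proof
    assume "inner \<xi> \<xi> = 0"
    then have "inner (coord \<xi> g) (coord \<xi> g) = 0" for g
      unfolding inner_l2_def
      by (rule nonneg_infsum_le_0D[OF eq_refl]) (auto simp: l2_inner_summable)
    then show "\<xi> = 0" by (intro l2_eqI) simp
  qed (simp add: inner_l2_def)
qed (rule norm_l2_def sgn_l2_def dist_l2_def uniformity_l2_def open_l2_def)+
end

lemma norm_l2_eq: "norm \<xi> = ell2_norm UNIV (coord \<xi>)"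
  by (simp add: norm_l2_def ell2_norm_def inner_l2_def power2_norm_eq_inner)

lemma norm_coord_le: "cmod (coord \<xi> g) \<le> norm \<xi>"
proof -
  have "(\<Sum>h\<in>{g}. (cmod (coord \<xi> h))\<^sup>2) \<le> (\<Sum>\<^sub>\<infinity>h. (cmod (coord \<xi> h))\<^sup>2)"
    by (rule finite_sum_le_infsum) (auto simp: l2_summable)
  then show ?thesis unfolding norm_l2_eq ell2_norm_def by (simp add: real_le_rsqrt)
qed

lemma coord_tendsto: "\<xi> \<longlonglongrightarrow> \<eta> \<Longrightarrow> (\<lambda>n. coord (\<xi> n) g) \<longlonglongrightarrow> coord \<eta> g"
proof -
  assume "\<xi> \<longlonglongrightarrow> \<eta>"
  then have "(\<lambda>n. norm (\<xi> n - \<eta>)) \<longlonglongrightarrow> 0" by (simp add: LIM_zero tendsto_norm_zero)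
  then have "(\<lambda>n. coord (\<xi> n) g - coord \<eta> g) \<longlonglongrightarrow> 0"
    by (rule Lim_null_comparison[rotated])
      (metis (mono_tags, lifting) always_eventually coord_simps(3) norm_coord_le)
  then show ?thesis by (rule LIM_zero_cancel)
qed

instance l2 :: (type) complete_space
proof
  fix X :: "nat \<Rightarrow> 'a l2" assume C: "Cauchy X"
  have "Cauchy (\<lambda>n. coord (X n) g)" for g
  proof (rule CauchyI)
    fix e :: real assume "0 < e"
    then obtain M where "\<And>m n. m \<ge> M \<Longrightarrow> n \<ge> M \<Longrightarrow> norm (X m - X n) < e"
      using CauchyD[OF C] by blast
    then show "\<exists>M. \<forall>m\<ge>M. \<forall>n\<ge>M. norm (coord (X m) g - coord (X n) g) < e"
      by (intro exI[of _ M]) (metis coord_simps(3) norm_coord_le order_le_less_trans)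
  qed
  then have "\<forall>g. \<exists>l. (\<lambda>n. coord (X n) g) \<longlonglongrightarrow> l"
    by (simp add: Cauchy_convergent_iff convergent_def)
  then obtain f where f: "\<And>g. (\<lambda>n. coord (X n) g) \<longlonglongrightarrow> f g" by metis
  \<comment> \<open>Fatou's argument: on a finite set the Cauchy bound survives the limit in
    \<open>m\<close>, and the bound does not depend on the set.\<close>
  have key: "(\<Sum>g\<in>A. (cmod (coord (X n) g - f g))\<^sup>2) \<le> e\<^sup>2"
    if "finite A" and e: "\<And>m. m \<ge> M \<Longrightarrow> norm (X n - X m) \<le> e" "0 \<le> e" for A n M e
  proof (rule LIMSEQ_le_const2)
    show "(\<lambda>m. \<Sum>g\<in>A. (cmod (coord (X n) g - coord (X m) g))\<^sup>2) \<longlonglongrightarrow> (\<Sum>g\<in>A. (cmod (coord (X n) g - f g))\<^sup>2)"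
      by (intro tendsto_intros f)
    have "(\<Sum>g\<in>A. (cmod (coord (X n) g - coord (X m) g))\<^sup>2) \<le> e\<^sup>2" if "m \<ge> M" for m
    proof -
      have "(\<Sum>g\<in>A. (cmod (coord (X n - X m) g))\<^sup>2) \<le> (\<Sum>\<^sub>\<infinity>g. (cmod (coord (X n - X m) g))\<^sup>2)"
        using \<open>finite A\<close> by (intro finite_sum_le_infsum) (auto simp: l2_summable simp del: coord_simps)
      also have "\<dots> = (norm (X n - X m))\<^sup>2"
        by (simp add: norm_l2_eq ell2_norm_def infsum_nonneg)
      also have "\<dots> \<le> e\<^sup>2" using e(1)[OF that] by (simp add: power_mono)
      finally show ?thesis by simp
    qed
    then show "\<exists>N. \<forall>m\<ge>N. (\<Sum>g\<in>A. (cmod (coord (X n) g - coord (X m) g))\<^sup>2) \<le> e\<^sup>2" by blast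
  qed
  have sm: "(\<lambda>g. coord (X n) g - f g) \<in> ell2 UNIV \<and> ell2_norm UNIV (\<lambda>g. coord (X n) g - f g) \<le> e"
    if e: "\<And>m. m \<ge> M \<Longrightarrow> norm (X n - X m) \<le> e" "0 \<le> e" for n M e
  proof -
    have s: "(\<lambda>g. (cmod (coord (X n) g - f g))\<^sup>2) summable_on UNIV"
      by (rule nonneg_bdd_above_summable_on)
        (auto intro!: bdd_aboveI[of _ "e\<^sup>2"] key[OF _ e])
    have "(\<Sum>\<^sub>\<infinity>g. (cmod (coord (X n) g - f g))\<^sup>2) \<le> e\<^sup>2"
      by (rule infsum_le_finite_sums[OF s]) (auto intro!: key[OF _ e])
    then show ?thesis using s \<open>0 \<le> e\<close> by (auto simp: ell2_def ell2_norm_def intro: real_le_lsqrt)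
  qed
  obtain N where N: "\<And>m n. m \<ge> N \<Longrightarrow> n \<ge> N \<Longrightarrow> norm (X m - X n) < 1"
    using CauchyD[OF C, of 1] by auto
  have "(\<lambda>g. coord (X N) g - f g) \<in> ell2 UNIV" using sm[of N N 1] N by (auto intro: less_imp_le)
  then have "(\<lambda>g. coord (X N) g + (-1) * (coord (X N) g - f g)) \<in> ell2 UNIV"
    by (intro ell2_add coord ell2_scale)
  then have f2: "f \<in> ell2 UNIV" by simp
  have "X \<longlonglongrightarrow> Abs_l2 f"
  proof (rule LIMSEQ_I)
    fix r :: real assume "0 < r"
    then obtain M where M: "\<And>m n. m \<ge> M \<Longrightarrow> n \<ge> M \<Longrightarrow> norm (X m - X n) < r / 2"
      using CauchyD[OF C, of "r / 2"] by auto
    have "norm (X n - Abs_l2 f) < r" if "n \<ge> M" for n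
    proof -
      have "coord (X n - Abs_l2 f) = (\<lambda>g. coord (X n) g - f g)"
        by (auto simp: Abs_l2_inverse f2)
      then have "norm (X n - Abs_l2 f) \<le> r / 2"
        using sm[of M n "r / 2"] M that \<open>0 < r\<close> by (auto simp: norm_l2_eq less_imp_le)
      then show ?thesis using \<open>0 < r\<close> by simp
    qed
    then show "\<exists>no. \<forall>n\<ge>no. norm (X n - Abs_l2 f) < r" by blast
  qed
  then show "convergent X" by (auto simp: convergent_def)
qed

instance l2 :: (type) banach ..

text \<open>Serves \<open>norm 1 = 1\<close> in the operator algebra. Every type is inhabited, so
  some \<open>delta h\<close> exists.\<close>

lemma l2_nontrivial: "\<exists>\<xi> :: 'a l2. norm \<xi> = 1"
proof -
  obtain h :: 'a where True by blast
  have "(\<Sum>\<^sub>\<infinity>g. (cmod (delta h g))\<^sup>2) = (\<Sum>\<^sub>\<infinity>g\<in>{h}. (cmod (delta h g))\<^sup>2)"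
    by (rule infsum_cong_neutral) (auto simp: delta_def)
  then have "ell2_norm UNIV (delta h) = 1" by (simp add: ell2_norm_def delta_def)
  then show ?thesis
    by (intro exI[of _ "Abs_l2 (delta h)"]) (simp add: norm_l2_eq Abs_l2_inverse delta_in_ell2)
qed

section \<open>The Banach algebra of bounded operators\<close>

typedef 'a bop = "UNIV :: ('a l2 \<Rightarrow>\<^sub>L 'a l2) set" morphisms blin Bop ..

setup_lifting type_definition_bop

instantiation bop :: (type) real_vector
begin
lift_definition zero_bop :: "'a bop" is 0 .
lift_definition plus_bop :: "'a bop \<Rightarrow> 'a bop \<Rightarrow> 'a bop" is "(+)" .
lift_definition minus_bop :: "'a bop \<Rightarrow> 'a bop \<Rightarrow> 'a bop" is "(-)" .
lift_definition uminus_bop :: "'a bop \<Rightarrow> 'a bop" is "uminus" .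
lift_definition scaleR_bop :: "real \<Rightarrow> 'a bop \<Rightarrow> 'a bop" is "scaleR" .
instance
  by standard (transfer; simp add: scaleR_add_right scaleR_add_left)+
end

text \<open>Composition becomes the multiplication of a unital normed algebra, the setting of the
  square-root iteration. Scalars are real: complex linearity is not part of the type and is
  recovered when operators are moved back to the fibres.\<close>

instantiation bop :: (type) real_normed_algebra_1
begin
lift_definition one_bop :: "'a bop" is id_blinfun .
lift_definition times_bop :: "'a bop \<Rightarrow> 'a bop \<Rightarrow> 'a bop" is "(o\<^sub>L)" .
lift_definition norm_bop :: "'a bop \<Rightarrow> real" is norm .
definition sgn_bop :: "'a bop \<Rightarrow> 'a bop" where "sgn_bop a = a /\<^sub>R norm a"
definition dist_bop :: "'a bop \<Rightarrow> 'a bop \<Rightarrow> real" where "dist_bop a b = norm (a - b)"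
definition uniformity_bop :: "('a bop \<times> 'a bop) filter" where
  "uniformity_bop = (INF e\<in>{0<..}. principal {(x, y). dist x y < e})"
definition open_bop :: "'a bop set \<Rightarrow> bool" where
  "open_bop U = (\<forall>x\<in>U. \<forall>\<^sub>F (x', y) in uniformity. x' = x \<longrightarrow> y \<in> U)"
instance
proof
  fix a b c :: "'a bop" and r :: real
  show "a * b * c = a * (b * c)" "1 * a = a" "a * 1 = a"
    by (transfer; rule blinfun_eqI; simp)+
  show "(a + b) * c = a * c + b * c" "a * (b + c) = a * b + a * c"
    "r *\<^sub>R a * b = r *\<^sub>R (a * b)" "a * r *\<^sub>R b = r *\<^sub>R (a * b)"
    by (transfer; rule blinfun_eqI; simp add: blinfun.add_left blinfun.add_right blinfun.scaleR_left blinfun.scaleR_right)+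
  show "norm (a + b) \<le> norm a + norm b" by transfer (rule norm_triangle_ineq)
  show "norm a = 0 \<longleftrightarrow> a = 0" "norm (r *\<^sub>R a) = \<bar>r\<bar> * norm a" by (transfer; simp)+
  show "norm (a * b) \<le> norm a * norm b" by transfer (rule norm_blinfun_compose)
  show n1: "norm (1 :: 'a bop) = 1"
  proof (rule antisym)
    show "norm (1 :: 'a bop) \<le> 1" by transfer (rule norm_blinfun_id_le)
    obtain \<xi> :: "'a l2" where "norm \<xi> = 1" using l2_nontrivial by blast
    then show "1 \<le> norm (1 :: 'a bop)"
      by transfer (metis id_blinfun.rep_eq mult.right_neutral norm_blinfun id_apply)
  qed
  show "(0::'a bop) \<noteq> 1"
    using n1 by transfer auto
qed (rule sgn_bop_def dist_bop_def uniformity_bop_def open_bop_def)+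
end

instance bop :: (type) banach
proof
  fix X :: "nat \<Rightarrow> 'a bop" assume "Cauchy X"
  have e: "norm (blin a - blin b) = norm (a - b)" for a b :: "'a bop" by transfer simp
  from \<open>Cauchy X\<close> have "Cauchy (\<lambda>n. blin (X n))" by (simp add: Cauchy_def dist_norm e)
  then obtain L where "(\<lambda>n. blin (X n)) \<longlonglongrightarrow> L" by (auto simp: Cauchy_convergent_iff convergent_def)
  then have "X \<longlonglongrightarrow> Bop L"
    by (simp add: LIMSEQ_def dist_norm) (metis Bop_inverse UNIV_I e)
  then show "convergent X" by (auto simp: convergent_def)
qed

definition app :: "'a bop \<Rightarrow> 'a l2 \<Rightarrow> 'a l2" where "app a = blinfun_apply (blin a)"

lemma app_simps [simp]:
  "app (a + b) \<xi> = app a \<xi> + app b \<xi>" "app (a - b) \<xi> = app a \<xi> - app b \<xi>" "app (r *\<^sub>R a) \<xi> = r *\<^sub>R app a \<xi>"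
  "app (a * b) \<xi> = app a (app b \<xi>)" "app 1 \<xi> = \<xi>" "app 0 \<xi> = 0"
  "app a (\<xi> + \<eta>) = app a \<xi> + app a \<eta>" "app a (\<xi> - \<eta>) = app a \<xi> - app a \<eta>" "app a (r *\<^sub>R \<xi>) = r *\<^sub>R app a \<xi>"
  "app a 0 = 0"
  by (simp_all add: app_def plus_bop.rep_eq minus_bop.rep_eq scaleR_bop.rep_eq times_bop.rep_eq one_bop.rep_eq
      zero_bop.rep_eq blinfun.bilinear_simps)

lemma bop_eqI: "(\<And>\<xi>. app a \<xi> = app b \<xi>) \<Longrightarrow> a = b"
  unfolding app_def by (metis blin_inject blinfun_eqI)

lemma norm_app_le: "norm (app a \<xi>) \<le> norm a * norm \<xi>"
  unfolding app_def norm_bop.rep_eq by (rule norm_blinfun)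

lemma norm_bop_le: "0 \<le> C \<Longrightarrow> (\<And>\<xi>. norm (app a \<xi>) \<le> C * norm \<xi>) \<Longrightarrow> norm a \<le> C"
  unfolding app_def norm_bop.rep_eq by (rule norm_blinfun_bound)

lemma app_tendsto: "a \<longlonglongrightarrow> b \<Longrightarrow> (\<lambda>n. app (a n) \<xi>) \<longlonglongrightarrow> app b \<xi>"
proof -
  assume "a \<longlonglongrightarrow> b"
  then have "(\<lambda>n. norm (a n - b) * norm \<xi>) \<longlonglongrightarrow> 0"
    by (intro tendsto_mult_left_zero) (simp add: LIM_zero tendsto_norm_zero)
  then have "(\<lambda>n. app (a n) \<xi> - app b \<xi>) \<longlonglongrightarrow> 0"
    by (rule Lim_null_comparison[rotated])
      (metis (mono_tags, lifting) always_eventually app_simps(2) norm_app_le)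
  then show ?thesis by (rule LIM_zero_cancel)
qed

section \<open>Perturbing positive elements into an ideal\<close>

text \<open>\<open>y = 1 - sqrt (1 - R)\<close> solves \<open>(1 - y)^2 = 1 - R\<close>, that is
  \<open>y = (R + y^2) / 2\<close>; the right-hand side is iterated from 0. The iterates are
  polynomials in \<open>R\<close> with nonnegative coefficients, so the real number 1 in place of
  \<open>R\<close> dominates every contraction.\<close>

primrec sqrt_iter :: "'b::real_normed_algebra_1 \<Rightarrow> nat \<Rightarrow> 'b" where
  "sqrt_iter R 0 = 0"
| "sqrt_iter R (Suc n) = (1 / 2) *\<^sub>R (R + sqrt_iter R n * sqrt_iter R n)"

lemma sqrt_iter_one_bounds: "0 \<le> sqrt_iter (1::real) n \<and> sqrt_iter (1::real) n \<le> 1"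
proof (induction n)
  case (Suc n)
  then have "sqrt_iter (1::real) n * sqrt_iter 1 n \<le> 1 * 1" by (intro mult_mono) auto
  then show ?case using Suc by (simp add: field_simps)
qed simp

lemma norm_sqrt_iter:
  assumes "norm R \<le> 1"
  shows "norm (sqrt_iter R n) \<le> sqrt_iter (1::real) n"
proof (induction n)
  case (Suc n)
  have "norm (R + sqrt_iter R n * sqrt_iter R n) \<le> norm R + norm (sqrt_iter R n) * norm (sqrt_iter R n)"
    by (meson add_left_mono norm_mult_ineq norm_triangle_ineq order_trans)
  also have "\<dots> \<le> 1 + sqrt_iter 1 n * sqrt_iter 1 n"
    using assms Suc sqrt_iter_one_bounds[of n] by (intro add_mono mult_mono) auto
  finally show ?case by simp
qed simp

text \<open>\<open>a a - b b = a (a - b) + (a - b) b\<close> holds without commutativity. The same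
  identity for the scalar iterates \<open>s\<close>, \<open>t\<close> turns the norm estimate into
  exactly the scalar increment, so the bounds telescope.\<close>

lemma norm_sqrt_iter_step:
  assumes "norm R \<le> 1"
  shows "norm (sqrt_iter R (Suc n) - sqrt_iter R n) \<le> sqrt_iter (1::real) (Suc n) - sqrt_iter 1 n"
proof (induction n)
  case (Suc n)
  define a b where "a = sqrt_iter R (Suc n)" and "b = sqrt_iter R n"
  define s t where "s = sqrt_iter (1::real) (Suc n)" and "t = sqrt_iter (1::real) n"
  have ab: "norm (a - b) \<le> s - t" "norm a \<le> s" "norm b \<le> t"
    using Suc norm_sqrt_iter[OF assms] by (auto simp: a_def b_def s_def t_def simp del: sqrt_iter.simps(2))
  have st: "0 \<le> s" "0 \<le> t" using sqrt_iter_one_bounds by (auto simp: s_def t_def simp del: sqrt_iter.simps(2))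
  have "sqrt_iter R (Suc (Suc n)) - sqrt_iter R (Suc n) = (1/2) *\<^sub>R (R + a * a) - (1/2) *\<^sub>R (R + b * b)"
    by (simp add: a_def b_def)
  also have "\<dots> = (1/2) *\<^sub>R (a * (a - b) + (a - b) * b)"
    by (simp add: algebra_simps)
  finally have "norm (sqrt_iter R (Suc (Suc n)) - sqrt_iter R (Suc n)) = (1/2) * norm (a * (a - b) + (a - b) * b)"
    by simp
  also have "norm (a * (a - b) + (a - b) * b) \<le> norm a * norm (a - b) + norm (a - b) * norm b"
    by (meson add_mono norm_mult_ineq norm_triangle_ineq order_trans)
  also have "\<dots> \<le> s * (s - t) + (s - t) * t"
    using ab st order_trans[OF norm_ge_zero ab(1)] by (intro add_mono mult_mono) auto
  finally have "norm (sqrt_iter R (Suc (Suc n)) - sqrt_iter R (Suc n)) \<le> (1/2) * (s * (s - t) + (s - t) * t)"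
    by simp
  also have "\<dots> = (1/2) * (1 + s * s) - (1/2) * (1 + t * t)" by (simp add: algebra_simps)
  also have "\<dots> = sqrt_iter 1 (Suc (Suc n)) - sqrt_iter 1 (Suc n)" by (simp add: s_def t_def)
  finally show ?case .
qed (use assms in simp)

lemma norm_sqrt_iter_diff:
  assumes "norm R \<le> 1" "n \<le> m"
  shows "norm (sqrt_iter R m - sqrt_iter R n) \<le> sqrt_iter (1::real) m - sqrt_iter 1 n"
  using assms(2)
proof (induction m rule: dec_induct)
  case (step m)
  have "norm (sqrt_iter R (Suc m) - sqrt_iter R n)
      \<le> norm (sqrt_iter R (Suc m) - sqrt_iter R m) + norm (sqrt_iter R m - sqrt_iter R n)"
    using norm_triangle_ineq[of "sqrt_iter R (Suc m) - sqrt_iter R m" "sqrt_iter R m - sqrt_iter R n"]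
    by (simp del: sqrt_iter.simps(2))
  also have "\<dots> \<le> sqrt_iter (1::real) (Suc m) - sqrt_iter 1 m + (sqrt_iter 1 m - sqrt_iter 1 n)"
    by (intro add_mono norm_sqrt_iter_step assms step)
  finally show ?case by simp
qed simp

text \<open>The iteration stays in the closed unital algebra generated by \<open>R\<close> and its limit \<open>X\<close> is
  \<open>1 - sqrt (1 - R)\<close>; the rate of convergence is the one of the scalar iteration for \<open>R = 1\<close>.\<close>

lemma sqrt_iter_limit:
  shows "\<exists>r :: nat \<Rightarrow> real. r \<longlonglongrightarrow> 0 \<and>
    (\<forall>R :: 'b::{real_normed_algebra_1,banach}. norm R \<le> 1 \<longrightarrow>
      (\<exists>X. norm X \<le> 1 \<and> (1 - X) * (1 - X) = 1 - R \<and> (\<forall>n. norm (X - sqrt_iter R n) \<le> r n) \<and>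
        sqrt_iter R \<longlonglongrightarrow> X))"
proof -
  let ?s = "sqrt_iter (1::real)"
  have mono: "?s n \<le> ?s m" if "n \<le> m" for m n
  proof -
    have "norm (?s m - ?s n) \<le> ?s m - ?s n" using norm_sqrt_iter_diff[of "1::real" n m] that by simp
    then show ?thesis using norm_ge_zero[of "?s m - ?s n"] by linarith
  qed
  have "norm (?s n) \<le> 1" for n using sqrt_iter_one_bounds[of n] by (simp only: real_norm_def) linarith
  then have "Bseq ?s" by (rule BseqI')
  then have "convergent ?s" by (rule Bseq_mono_convergent) (intro allI impI mono)
  then obtain l where l: "?s \<longlonglongrightarrow> l" by (auto simp: convergent_def)
  have sl: "?s n \<le> l" for n by (rule incseq_le[OF _ l]) (intro incseq_def[THEN iffD2] allI impI mono)
  have l1: "l \<le> 1" by (rule LIMSEQ_le_const2[OF l]) (use sqrt_iter_one_bounds in blast)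
  \<comment> \<open>The rate does not depend on \<open>R\<close>. The iterates of a whole family of
    contractions therefore converge uniformly in the index.\<close>
  define r where "r n = l - ?s n" for n
  have r0: "r \<longlonglongrightarrow> 0" unfolding r_def using tendsto_diff[OF tendsto_const l, of l] by simp
  have "\<exists>X. norm X \<le> 1 \<and> (1 - X) * (1 - X) = 1 - R \<and> (\<forall>n. norm (X - sqrt_iter R n) \<le> r n) \<and> sqrt_iter R \<longlonglongrightarrow> X"
    if R: "norm R \<le> 1" for R :: 'b
  proof -
    let ?X = "sqrt_iter R"
    have d: "norm (?X m - ?X n) \<le> r n" if "n \<le> m" for m n
      using norm_sqrt_iter_diff[OF R that] sl[of m] by (simp add: r_def)
    have "Cauchy ?X"
    proof (rule CauchyI')
      fix e :: real assume "0 < e"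
      then have "\<forall>\<^sub>F n in sequentially. r n < e" by (rule order_tendstoD[OF r0])
      then obtain M where M: "\<And>n. n \<ge> M \<Longrightarrow> r n < e" by (auto simp: eventually_sequentially)
      have "dist (?X m) (?X n) < e" if "m \<ge> M" "n > m" for m n
        using d[of m n] M[of m] that unfolding dist_norm norm_minus_commute[of "?X m"] by linarith
      then show "\<exists>M. \<forall>m\<ge>M. \<forall>n>m. dist (?X m) (?X n) < e" by blast
    qed
    then obtain X where X: "?X \<longlonglongrightarrow> X" by (auto simp: Cauchy_convergent_iff convergent_def)
    have "norm X \<le> 1"
    proof (rule LIMSEQ_le_const2[OF tendsto_norm[OF X]])
      have "norm (?X n) \<le> 1" for n
        using norm_sqrt_iter[OF R, of n] sqrt_iter_one_bounds[of n] by linarith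
      then show "\<exists>N. \<forall>n\<ge>N. norm (?X n) \<le> 1" by blast
    qed
    moreover have "(\<lambda>n. ?X (Suc n)) \<longlonglongrightarrow> X" using X by (rule LIMSEQ_Suc)
    moreover have "(\<lambda>n. ?X (Suc n)) \<longlonglongrightarrow> (1/2) *\<^sub>R (R + X * X)"
      unfolding sqrt_iter.simps by (intro tendsto_intros X)
    ultimately have "norm X \<le> 1" "X = (1/2) *\<^sub>R (R + X * X)" using LIMSEQ_unique by blast+
    then have "X + X = R + X * X"
      by (metis scaleR_2 scaleR_half_double scaleR_add_right)
    then have "(1 - X) * (1 - X) = 1 - R" by (simp add: algebra_simps)
    moreover have "norm (X - ?X n) \<le> r n" for n
      by (rule LIMSEQ_le_const2[OF tendsto_norm[OF tendsto_diff[OF X tendsto_const]]]) (use d in blast)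
    ultimately show ?thesis using \<open>norm X \<le> 1\<close> X by blast
  qed
  then show ?thesis using r0 by blast
qed

text \<open>The index \<open>x\<close> runs over the fibres: \<open>A\<close> and \<open>J\<close> consist of bounded families, with the uniform norm.\<close>

lemma ideal_perturbation:
  fixes T c :: "'i \<Rightarrow> 'b::{real_normed_algebra_1,banach}" and A J :: "('i \<Rightarrow> 'b) set"
  assumes A_add: "\<And>a b. a \<in> A \<Longrightarrow> b \<in> A \<Longrightarrow> (\<lambda>x. a x + b x) \<in> A"
    and A_scale: "\<And>r a. a \<in> A \<Longrightarrow> (\<lambda>x. r *\<^sub>R a x) \<in> A"
    and A_mult: "\<And>a b. a \<in> A \<Longrightarrow> b \<in> A \<Longrightarrow> (\<lambda>x. a x * b x) \<in> A"
    and J_add: "\<And>a b. a \<in> J \<Longrightarrow> b \<in> J \<Longrightarrow> (\<lambda>x. a x + b x) \<in> J"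
    and J_scale: "\<And>r a. a \<in> J \<Longrightarrow> (\<lambda>x. r *\<^sub>R a x) \<in> J"
    and J_left: "\<And>a b. a \<in> A \<Longrightarrow> b \<in> J \<Longrightarrow> (\<lambda>x. a x * b x) \<in> J"
    and J_right: "\<And>a b. a \<in> J \<Longrightarrow> b \<in> A \<Longrightarrow> (\<lambda>x. a x * b x) \<in> J"
    and J_mult: "\<And>a b. a \<in> J \<Longrightarrow> b \<in> J \<Longrightarrow> (\<lambda>x. a x * b x) \<in> J"
    and J_bounded: "\<And>a. a \<in> J \<Longrightarrow> \<exists>M. \<forall>x. norm (a x) \<le> M"
    and J_closed: "\<And>a. (\<And>\<epsilon>. \<epsilon> > 0 \<Longrightarrow> \<exists>d\<in>J. \<forall>x. norm (a x - d x) \<le> \<epsilon>) \<Longrightarrow> a \<in> J"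
    and trivial: "\<And>a x. a \<in> J \<Longrightarrow> (\<And>\<epsilon>. \<epsilon> > 0 \<Longrightarrow> \<exists>d\<in>A. \<forall>x. norm (a x - d x) \<le> \<epsilon>) \<Longrightarrow> a x = 0"
    and T: "T \<in> A" "\<And>x. norm (T x) \<le> M"
    and c: "c \<in> J" "\<And>x. norm (T x - c x) \<le> \<eta>"
    and \<delta>: "0 < \<delta>" "\<eta> < \<delta>"
    and contr: "\<And>x. norm (1 - (T x - of_real \<delta>) * (T x - of_real \<delta>)) \<le> 1"
  shows "\<exists>X. \<forall>x. norm (X x) \<le> 1 \<and> T x = of_real \<delta> - 1 + X x"
proof -
  \<comment> \<open>Expressions such as \<open>1 - X + S\<close> involve a unit, which
    \<open>A\<close> and \<open>J\<close> need not contain. They are handled as right multipliers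
    that preserve both sets, a substitute for adjoining a unit.\<close>
  define mul where "mul m \<longleftrightarrow> (\<forall>a\<in>A. (\<lambda>x. a x * m x) \<in> A) \<and> (\<forall>a\<in>J. (\<lambda>x. a x * m x) \<in> J)" for m
  have mul_one: "mul (\<lambda>_. 1)" by (simp add: mul_def)
  have mul_add: "mul (\<lambda>x. m x + m' x)" if "mul m" "mul m'" for m m'
    unfolding mul_def distrib_left by (intro conjI ballI A_add J_add) (use that in \<open>auto simp: mul_def\<close>)
  have mul_scale: "mul (\<lambda>x. r *\<^sub>R m x)" if "mul m" for r m
    unfolding mul_def mult_scaleR_right by (intro conjI ballI A_scale J_scale) (use that in \<open>auto simp: mul_def\<close>)
  have mul_mult: "mul (\<lambda>x. m x * m' x)" if "mul m" "mul m'" for m m'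
    unfolding mul_def mult.assoc[symmetric]
    by (intro conjI ballI) (use that in \<open>auto simp: mul_def\<close>)
  have mul_diff: "mul (\<lambda>x. m x - m' x)" if "mul m" "mul m'" for m m'
    using mul_add[OF that(1) mul_scale[OF that(2), of "-1"]] by simp
  have mul_of_real: "mul (\<lambda>_. of_real r)" for r
    unfolding of_real_def by (intro mul_scale mul_one)
  have mul_T: "mul T" using T A_mult J_right by (auto simp: mul_def)
  define S where "S x = T x - of_real \<delta>" for x
  have mul_S: "mul S" unfolding S_def by (intro mul_diff mul_T mul_of_real)
  define R where "R x = 1 - S x * S x" for x
  have mul_R: "mul R" unfolding R_def by (intro mul_diff mul_mult mul_S mul_one)
  have mul_iter: "mul (\<lambda>x. sqrt_iter (R x) n)" for n
  proof (induction n)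
    case 0
    show ?case using mul_scale[OF mul_one, of 0] by simp
  next
    case (Suc n)
    show ?case unfolding sqrt_iter.simps by (intro mul_scale mul_add mul_R mul_mult Suc)
  qed
  have R1: "norm (R x) \<le> 1" for x using contr by (simp add: R_def S_def)
  let ?lim = "\<lambda>r R X. norm X \<le> 1 \<and> (1 - X) * (1 - X) = 1 - R \<and> (\<forall>n. norm (X - sqrt_iter R n) \<le> r n) \<and>
    sqrt_iter R \<longlonglongrightarrow> X"
  obtain r :: "nat \<Rightarrow> real" where r: "r \<longlonglongrightarrow> 0" and lim: "\<forall>R::'b. norm R \<le> 1 \<longrightarrow> (\<exists>X. ?lim r R X)"
    using sqrt_iter_limit[where 'b='b] by (elim exE conjE)
  have "\<forall>x. \<exists>X. ?lim r (R x) X" using lim R1 by simp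
  then have "\<exists>X. \<forall>x. ?lim r (R x) (X x)" by (rule choice)
  then obtain X where lim: "\<forall>x. ?lim r (R x) (X x)" ..
  have X: "norm (X x) \<le> 1" "(1 - X x) * (1 - X x) = 1 - R x"
      "norm (X x - sqrt_iter (R x) n) \<le> r n" "sqrt_iter (R x) \<longlonglongrightarrow> X x" for x n
    using lim by blast+
  have S2: "(1 - X x) * (1 - X x) = S x * S x" for x using X(2)[of x] by (simp add: R_def)
  \<comment> \<open>\<open>sqrt_iter (R x) n\<close> is a polynomial in \<open>T x\<close>;
    commutation then passes to the limit \<open>X x\<close>.\<close>
  have comm_iter: "T x * sqrt_iter (R x) n = sqrt_iter (R x) n * T x" for x n
  proof (induction n)
    case (Suc n)
    have "T x * S x = S x * T x" by (simp add: S_def of_real_def right_diff_distrib left_diff_distrib)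
    then have "T x * R x = R x * T x"
      unfolding R_def right_diff_distrib left_diff_distrib by (metis mult.assoc mult_1_left mult_1_right)
    moreover have "T x * (sqrt_iter (R x) n * sqrt_iter (R x) n) = sqrt_iter (R x) n * sqrt_iter (R x) n * T x"
      by (metis Suc mult.assoc)
    ultimately show ?case by (simp add: distrib_left distrib_right)
  qed simp
  have comm: "T x * X x = X x * T x" for x
  proof (rule LIMSEQ_unique)
    show "(\<lambda>n. T x * sqrt_iter (R x) n) \<longlonglongrightarrow> T x * X x" by (intro tendsto_intros X)
    show "(\<lambda>n. T x * sqrt_iter (R x) n) \<longlonglongrightarrow> X x * T x"
      unfolding comm_iter by (intro tendsto_intros X)
  qed
  have small: "\<exists>n. K * r n \<le> \<epsilon>" if "\<epsilon> > 0" for K \<epsilon>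
  proof -
    have "(\<lambda>n. K * r n) \<longlonglongrightarrow> 0" using tendsto_mult_left[OF r, of K] by simp
    then have "\<forall>\<^sub>F n in sequentially. K * r n < \<epsilon>" using that by (rule order_tendstoD)
    then show ?thesis by (metis eventually_happens' sequentially_bot less_imp_le)
  qed
  \<comment> \<open>\<open>J\<close> is closed under uniform limits, so right multiplication by the
    limit \<open>X\<close> itself preserves it. \<open>A\<close> is not assumed closed, and on it
    only the iterates act; hence the approximation in \<open>e_approx\<close>.\<close>
  have JX: "(\<lambda>x. a x * X x) \<in> J" if "a \<in> J" for a
  proof (rule J_closed)
    fix \<epsilon> :: real assume "\<epsilon> > 0"
    obtain K where K: "\<And>x. norm (a x) \<le> K" using J_bounded[OF \<open>a \<in> J\<close>] by blast
    obtain n where n: "K * r n \<le> \<epsilon>" using small[OF \<open>\<epsilon> > 0\<close>] by blast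
    have "norm (a x * X x - a x * sqrt_iter (R x) n) \<le> \<epsilon>" for x
    proof -
      have "norm (a x * (X x - sqrt_iter (R x) n)) \<le> K * r n"
        by (intro order_trans[OF norm_mult_ineq] mult_mono K X(3) norm_ge_zero order_trans[OF norm_ge_zero K])
      then show ?thesis using n by (simp add: algebra_simps)
    qed
    then show "\<exists>d\<in>J. \<forall>x. norm (a x * X x - d x) \<le> \<epsilon>"
      using mul_iter[of n] that
      by (intro bexI[of _ "\<lambda>x. a x * sqrt_iter (R x) n"]) (auto simp: mul_def)
  qed
  txt \<open>\<open>1 - X\<close> is the absolute value of \<open>S = T - \<delta>\<close>, so \<open>P\<close> is twice its positive part.
    The factor \<open>T\<close> in \<open>e\<close> is needed because \<open>A\<close> need not contain a unit.\<close>
  define P where "P x = 1 - X x + S x" for x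
  define e where "e x = T x * P x" for x
  have e_approx: "\<exists>d\<in>A. \<forall>x. norm (e x - d x) \<le> \<epsilon>" if "\<epsilon> > 0" for \<epsilon>
  proof -
    obtain n where n: "M * r n \<le> \<epsilon>" using small[OF \<open>\<epsilon> > 0\<close>] by blast
    define d where "d x = T x * (1 - sqrt_iter (R x) n + S x)" for x
    have "mul (\<lambda>x. 1 - sqrt_iter (R x) n + S x)" by (intro mul_add mul_diff mul_one mul_S mul_iter)
    then have "d \<in> A" using T(1) unfolding mul_def d_def[abs_def] by blast
    moreover have "norm (e x - d x) \<le> \<epsilon>" for x
    proof -
      have "e x - d x = - (T x * (X x - sqrt_iter (R x) n))"
        by (simp add: e_def d_def P_def algebra_simps)
      moreover have "norm (T x * (X x - sqrt_iter (R x) n)) \<le> M * r n"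
        by (intro order_trans[OF norm_mult_ineq] mult_mono T(2) X(3) norm_ge_zero order_trans[OF norm_ge_zero T(2)])
      ultimately show ?thesis using n by simp
    qed
    ultimately show ?thesis by blast
  qed
  \<comment> \<open>\<open>e\<close> is only a uniform limit of elements \<open>d\<close> of
    \<open>A\<close>, so the ideal property is applied to \<open>d c\<close> and closedness of
    \<open>J\<close> does the rest. Dividing by \<open>K + 1\<close> covers the case
    \<open>K = 0\<close>.\<close>
  have AJ_e: "(\<lambda>x. e x * c x) \<in> J"
  proof (rule J_closed)
    fix \<epsilon> :: real assume "\<epsilon> > 0"
    obtain K where K: "\<And>x. norm (c x) \<le> K" using J_bounded[OF c(1)] by blast
    have K0: "0 \<le> K" using K norm_ge_zero order_trans by blast
    obtain d where d: "d \<in> A" "\<And>x. norm (e x - d x) \<le> \<epsilon> / (K + 1)"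
      using e_approx[of "\<epsilon> / (K + 1)"] K0 \<open>\<epsilon> > 0\<close> by auto
    have "norm (e x * c x - d x * c x) \<le> \<epsilon>" for x
    proof -
      have "norm ((e x - d x) * c x) \<le> \<epsilon> / (K + 1) * K"
        using norm_mult_ineq[of "e x - d x" "c x"] mult_mono[OF d(2)[of x] K[of x]] K0 \<open>\<epsilon> > 0\<close> by auto
      also have "\<dots> \<le> \<epsilon>" using K0 \<open>\<epsilon> > 0\<close> by (simp add: field_simps)
      finally show ?thesis by (simp add: algebra_simps)
    qed
    then show "\<exists>d\<in>J. \<forall>x. norm (e x * c x - d x) \<le> \<epsilon>" 
      by (intro bexI[OF _ J_left[OF d(1) c(1)]]) blast
  qed
  have SX: "S x * X x = X x * S x" for x
    using comm[of x] by (simp add: S_def right_diff_distrib left_diff_distrib of_real_def)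
  \<comment> \<open>With \<open>|S| = 1 - X\<close> this is
    \<open>(|S| + S) S = |S| S + |S|^2 = (|S| + S) |S|\<close>, using that \<open>S\<close> and
    \<open>X\<close> commute.\<close>
  have PS: "P x * S x = P x * (1 - X x)" for x
    using S2[of x] SX[of x] by (simp add: P_def algebra_simps)
  have eT: "e x * T x = e x * (of_real \<delta> + 1 - X x)" for x
  proof -
    have "e x * (T x - of_real \<delta>) = e x * (1 - X x)"
      using PS[of x] by (simp add: e_def S_def mult.assoc)
    then show ?thesis by (simp add: algebra_simps)
  qed
  define L where "L = 1 + \<delta>"
  txt \<open>Modulo \<open>J\<close>, \<open>e = e w\<close> with \<open>w\<close> a strict contraction, so \<open>e = lim (e - e w\<^sup>n)\<close> lies in \<open>J\<close>.\<close>
  define w where "w x = (1 / L) *\<^sub>R (X x + (T x - c x))" for x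
  have L: "L > 0" using \<delta> by (simp add: L_def)
  \<comment> \<open>\<open>eT\<close> rearranges to \<open>e (X + T) = (1 + \<delta>) e\<close>.
    Dividing by \<open>L\<close> and exchanging \<open>T\<close> for \<open>T - c\<close> costs only
    \<open>e c / L\<close>, which lies in \<open>J\<close> by \<open>AJ_e\<close>.\<close>
  have ew: "e x * w x = e x - (1 / L) *\<^sub>R (e x * c x)" for x
  proof -
    have "e x * (X x + (T x - c x)) = L *\<^sub>R e x - e x * c x"
      using eT[of x] by (simp add: algebra_simps L_def of_real_def)
    then show ?thesis using L by (simp add: w_def scaleR_diff_right)
  qed
  have Jw: "(\<lambda>x. a x * w x) \<in> J" if "a \<in> J" for a
  proof -
    have "(\<lambda>x. (1 / L) *\<^sub>R ((a x * X x + a x * T x) + (- 1) *\<^sub>R (a x * c x))) \<in> J"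
      by (intro J_scale J_add JX J_right J_mult that T c)
    then show ?thesis by (simp add: w_def algebra_simps)
  qed
  have Jew: "(\<lambda>x. e x - e x * w x) \<in> J" using J_scale[OF AJ_e, of "1 / L"] by (simp add: ew)
  \<comment> \<open>Inductive step:
    \<open>e - e w^(n+1) = (e - e w) + (e - e w^n) w\<close>.\<close>
  have Jpow: "(\<lambda>x. e x - e x * w x ^ n) \<in> J" for n
  proof (induction n)
    case 0
    show ?case using J_scale[OF c(1), of 0] by simp
  next
    case (Suc n)
    from J_add[OF Jew Jw[OF Suc]] show ?case
      by (simp add: algebra_simps power_Suc2 del: power_Suc)
  qed
  have \<eta>: "0 \<le> \<eta>" using c(2) norm_ge_zero order_trans by blast
  have M: "0 \<le> M" using T(2) norm_ge_zero order_trans by blast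
  \<comment> \<open>\<open>T\<close> may have norm far above \<open>\<delta>\<close>, but
    \<open>T - c\<close> has norm at most \<open>\<eta>\<close>. The numerator of \<open>w\<close>
    is thus bounded by \<open>1 + \<eta>\<close>, and \<open>\<eta> < \<delta>\<close> makes
    \<open>w\<close> a strict contraction uniformly in \<open>x\<close>.\<close>
  define q where "q = (1 + \<eta>) / L"
  have q: "0 \<le> q" "q < 1" using \<eta> L \<delta> by (auto simp: q_def L_def)
  have wq: "norm (w x) \<le> q" for x
  proof -
    have "norm (X x + (T x - c x)) \<le> 1 + \<eta>"
      using X(1) c(2) norm_triangle_mono by blast
    then show ?thesis using L by (simp add: w_def q_def divide_right_mono)
  qed
  define K where "K = M * (2 + (M + \<delta>))"
  have eK: "norm (e x) \<le> K" for x
  proof -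
    have "norm (S x) \<le> M + \<delta>"
      using norm_triangle_ineq4[of "T x" "of_real \<delta>"] T(2)[of x] \<delta> by (simp add: S_def)
    moreover have "norm (1 - X x) \<le> 2" using norm_triangle_ineq4[of 1 "X x"] X(1)[of x] by simp
    ultimately have "norm (P x) \<le> 2 + (M + \<delta>)" unfolding P_def by (rule norm_triangle_mono[rotated])
    then show ?thesis
      unfolding e_def K_def by (intro order_trans[OF norm_mult_ineq] mult_mono T M norm_ge_zero)
  qed
  have K: "0 \<le> K" using eK norm_ge_zero order_trans by blast
  have "e \<in> J"
  proof (rule J_closed)
    fix \<epsilon> :: real assume "\<epsilon> > 0"
    have "(\<lambda>n. K * q ^ n) \<longlonglongrightarrow> 0" using q by (intro tendsto_mult_right_zero LIMSEQ_power_zero) auto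
    then have "\<forall>\<^sub>F n in sequentially. K * q ^ n < \<epsilon>" using \<open>\<epsilon> > 0\<close> by (rule order_tendstoD)
    then obtain n where n: "K * q ^ n \<le> \<epsilon>" by (metis eventually_happens' sequentially_bot less_imp_le)
    have "norm (e x - (e x - e x * w x ^ n)) \<le> \<epsilon>" for x
    proof -
      have "norm (e x * w x ^ n) \<le> K * q ^ n"
        by (intro order_trans[OF norm_mult_ineq] mult_mono eK K norm_ge_zero
            order_trans[OF norm_power_ineq] power_mono wq)
      then show ?thesis using n by simp
    qed
    then show "\<exists>d\<in>J. \<forall>x. norm (e x - d x) \<le> \<epsilon>" by (intro bexI[OF _ Jpow[of n]]) blast
  qed
  then have e0: "e x = 0" for x using e_approx trivial by blast
  \<comment> \<open>\<open>T P = 0\<close> and commutation give \<open>P T = 0\<close>, so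
    \<open>PS\<close> becomes \<open>- \<delta> P = P (1 - X)\<close>, that is
    \<open>(1 + \<delta>) P = P X\<close>. As \<open>norm X \<le> 1\<close>, this forces
    \<open>P = 0\<close>.\<close>
  have "P x = 0" for x
  proof -
    have "P x * (T x - of_real \<delta>) = P x * (1 - X x)" using PS[of x] by (simp add: S_def)
    moreover have "P x * T x = 0"
      using e0[of x] comm[of x] by (simp add: e_def P_def S_def algebra_simps of_real_def)
    ultimately have "L *\<^sub>R P x = P x * X x" by (simp add: L_def algebra_simps of_real_def)
    then have "L * norm (P x) = norm (P x * X x)" using L by (metis abs_of_pos norm_scaleR)
    also have "\<dots> \<le> norm (P x) * 1" by (intro order_trans[OF norm_mult_ineq] mult_left_mono X norm_ge_zero)
    finally have "\<delta> * norm (P x) \<le> 0" by (simp add: L_def algebra_simps)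
    then show "P x = 0" using \<delta> by (simp add: mult_le_0_iff)
  qed
  then have "T x = of_real \<delta> - 1 + X x" for x by (simp add: P_def S_def algebra_simps)
  then show ?thesis using X(1) by blast
qed

section \<open>Bounded operator families\<close>

definition restr :: "'a set \<Rightarrow> 'a l2 \<Rightarrow> ('a \<Rightarrow> complex)" where
  "restr S \<xi> = (\<lambda>g. if g \<in> S then coord \<xi> g else 0)"

lemma restr_in [simp]: "restr S \<xi> \<in> ell2 S"
  unfolding restr_def by (rule ell2_restrict[OF coord]) simp

lemma coord_scaleR: "coord (r *\<^sub>R \<xi>) g = of_real r * coord \<xi> g"
  by (simp add: scaleR_conv_of_real)

lemma ell2_norm_nonneg [simp]: "0 \<le> ell2_norm S \<xi>"
  by (simp add: ell2_norm_def infsum_nonneg)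

lemma coord_Abs [simp]: "\<xi> \<in> ell2 S \<Longrightarrow> coord (Abs_l2 \<xi>) = \<xi>"
  by (rule Abs_l2_inverse) (auto intro: ell2_mono)

lemma restr_Abs [simp]: "\<xi> \<in> ell2 S \<Longrightarrow> restr S (Abs_l2 \<xi>) = \<xi>"
  unfolding restr_def coord_Abs by (auto simp: ell2_def)

lemma norm_Abs: "\<xi> \<in> ell2 S \<Longrightarrow> norm (Abs_l2 \<xi>) = ell2_norm S \<xi>"
proof -
  assume \<xi>: "\<xi> \<in> ell2 S"
  have "(\<Sum>\<^sub>\<infinity>g\<in>UNIV. (cmod (\<xi> g))\<^sup>2) = (\<Sum>\<^sub>\<infinity>g\<in>S. (cmod (\<xi> g))\<^sup>2)"
    by (rule infsum_cong_neutral) (use \<xi> in \<open>auto simp: ell2_def\<close>)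
  then show ?thesis by (simp add: norm_l2_eq coord_Abs[OF \<xi>] ell2_norm_def)
qed

lemma ell2_norm_restr_le: "ell2_norm S (restr S \<xi>) \<le> norm \<xi>"
proof -
  have "(\<Sum>\<^sub>\<infinity>g\<in>S. (cmod (restr S \<xi> g))\<^sup>2) \<le> (\<Sum>\<^sub>\<infinity>g. (cmod (coord \<xi> g))\<^sup>2)"
    by (rule infsum_mono_neutral) (use restr_in[of S \<xi>] in \<open>auto simp: ell2_def restr_def l2_summable\<close>)
  then show ?thesis by (simp add: norm_l2_eq ell2_norm_def)
qed

text \<open>The operator is extended by zero to the orthogonal complement of \<open>ell2 S\<close>.
  On bounded operators this embedding is isometric and multiplicative, but in general it does not
  preserve the unit.\<close>

definition bop_of :: "'a set \<Rightarrow> 'a operator \<Rightarrow> 'a bop" where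
  "bop_of S A = Bop (Blinfun (\<lambda>\<xi>. Abs_l2 (A (restr S \<xi>))))"

lemma bounded_opsD:
  assumes "A \<in> bounded_ops S"
  shows "\<xi> \<in> ell2 S \<Longrightarrow> A \<xi> \<in> ell2 S" "\<xi> \<notin> ell2 S \<Longrightarrow> A \<xi> = (\<lambda>_. 0)"
    "\<xi> \<in> ell2 S \<Longrightarrow> \<eta> \<in> ell2 S \<Longrightarrow> A (\<lambda>g. \<xi> g + \<eta> g) = (\<lambda>g. A \<xi> g + A \<eta> g)"
    "\<xi> \<in> ell2 S \<Longrightarrow> A (\<lambda>g. z * \<xi> g) = (\<lambda>g. z * A \<xi> g)" "op_norm S A < \<infinity>"
  using assms unfolding bounded_ops_def by blast+

lemma bounded_ops_ell2: "A \<in> bounded_ops S \<Longrightarrow> A \<xi> \<in> ell2 S"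
  by (cases "\<xi> \<in> ell2 S") (auto simp: bounded_opsD)

lemma op_normI:
  assumes "\<And>\<xi>. \<xi> \<in> ell2 S \<Longrightarrow> ell2_norm S (A \<xi>) \<le> C * ell2_norm S \<xi>" and "0 \<le> C"
  shows "op_norm S A \<le> ennreal C"
  unfolding op_norm_def
proof (rule SUP_least)
  fix \<xi> assume \<xi>: "\<xi> \<in> {\<xi> \<in> ell2 S. ell2_norm S \<xi> \<le> 1}"
  then have "ell2_norm S (A \<xi>) \<le> C * ell2_norm S \<xi>" using assms(1) by blast
  also have "\<dots> \<le> C * 1" using \<xi> assms(2) by (intro mult_left_mono) auto
  finally show "ennreal (ell2_norm S (A \<xi>)) \<le> ennreal C" by (simp add: ennreal_leI)
qed

lemma bounded_opsI:
  assumes "\<And>\<xi>. \<xi> \<in> ell2 S \<Longrightarrow> A \<xi> \<in> ell2 S" "\<And>\<xi>. \<xi> \<notin> ell2 S \<Longrightarrow> A \<xi> = (\<lambda>_. 0)"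
    "\<And>\<xi> \<eta>. \<xi> \<in> ell2 S \<Longrightarrow> \<eta> \<in> ell2 S \<Longrightarrow> A (\<lambda>g. \<xi> g + \<eta> g) = (\<lambda>g. A \<xi> g + A \<eta> g)"
    "\<And>\<xi> z. \<xi> \<in> ell2 S \<Longrightarrow> A (\<lambda>g. z * \<xi> g) = (\<lambda>g. z * A \<xi> g)"
    and norm: "\<And>\<xi>. \<xi> \<in> ell2 S \<Longrightarrow> ell2_norm S (A \<xi>) \<le> C * ell2_norm S \<xi>" "0 \<le> C"
  shows "A \<in> bounded_ops S"
proof -
  have "op_norm S A < \<infinity>"
    using op_normI[OF norm] ennreal_less_top[of C] unfolding infinity_ennreal_def by (rule le_less_trans)
  then show ?thesis unfolding bounded_ops_def using assms(1-4) by (intro CollectI conjI ballI allI impI)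
qed

lemma op_norm_apply:
  assumes A: "A \<in> bounded_ops S" and C: "op_norm S A \<le> ennreal C" "0 \<le> C" and \<xi>: "\<xi> \<in> ell2 S"
  shows "ell2_norm S (A \<xi>) \<le> C * ell2_norm S \<xi>"
proof (cases "\<xi> = (\<lambda>_. 0)")
  case True
  have "A \<xi> = (\<lambda>_. 0)" using bounded_opsD(4)[OF A \<xi>, of 0] True by simp
  then show ?thesis using C by (simp add: ell2_norm_def True)
next
  case False
  define t where "t = ell2_norm S \<xi>"
  have t: "norm (Abs_l2 \<xi>) = t" by (simp add: t_def norm_Abs[OF \<xi>])
  have "Abs_l2 \<xi> \<noteq> 0"
  proof
    assume "Abs_l2 \<xi> = 0"
    then have "coord (Abs_l2 \<xi>) g = 0" for g by simp
    then show False using False by (auto simp: coord_Abs[OF \<xi>])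
  qed
  then have "t > 0" using t by force
  have nrm: "ell2_norm S (\<lambda>g. of_real r * \<eta> g) = r * ell2_norm S \<eta>" if "0 \<le> r" "\<eta> \<in> ell2 S" for r \<eta>
  proof -
    have "Abs_l2 (\<lambda>g. of_real r * \<eta> g) = r *\<^sub>R Abs_l2 \<eta>"
      by (rule l2_eqI) (simp add: coord_Abs[OF ell2_scale[OF that(2)]] coord_Abs[OF that(2)] scaleR_conv_of_real)
    then have "norm (Abs_l2 (\<lambda>g. of_real r * \<eta> g)) = r * norm (Abs_l2 \<eta>)" using that by simp
    then show ?thesis by (simp add: norm_Abs[OF ell2_scale[OF that(2)]] norm_Abs[OF that(2)])
  qed
  let ?\<eta> = "\<lambda>g. of_real (1 / t) * \<xi> g"
  have "ell2_norm S ?\<eta> = (1 / t) * t"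
    unfolding t_def[symmetric] using nrm[OF _ \<xi>, of "1 / t"] \<open>t > 0\<close> by (simp add: t_def)
  then have "ell2_norm S ?\<eta> \<le> 1" using \<open>t > 0\<close> by simp
  moreover have "?\<eta> \<in> ell2 S" by (rule ell2_scale[OF \<xi>])
  ultimately have "?\<eta> \<in> {\<xi> \<in> ell2 S. ell2_norm S \<xi> \<le> 1}" by blast
  then have "ennreal (ell2_norm S (A ?\<eta>)) \<le> op_norm S A"
    unfolding op_norm_def by (rule SUP_upper)
  also note C(1)
  finally have "ell2_norm S (A ?\<eta>) \<le> C" using C(2) by (simp add: ennreal_le_iff)
  moreover have "ell2_norm S (A ?\<eta>) = (1 / t) * ell2_norm S (A \<xi>)"
    unfolding bounded_opsD(4)[OF A \<xi>] using \<open>t > 0\<close> by (intro nrm bounded_ops_ell2 A) simp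
  ultimately show ?thesis using \<open>t > 0\<close> by (simp add: field_simps t_def)
qed

lemma bounded_ops_bound:
  assumes A: "A \<in> bounded_ops S"
  obtains C where "0 \<le> C" "op_norm S A \<le> ennreal C"
  using bounded_opsD(5)[OF A] by (intro that[of "enn2real (op_norm S A)"]) (auto simp: ennreal_enn2real_if)

lemma restr_simps:
  "restr S (\<xi> + \<eta>) = (\<lambda>g. restr S \<xi> g + restr S \<eta> g)" "restr S (r *\<^sub>R \<xi>) = (\<lambda>g. of_real r * restr S \<xi> g)"
  by (auto simp: restr_def scaleR_conv_of_real)

lemma app_bop_of:
  assumes A: "A \<in> bounded_ops S"
  shows "app (bop_of S A) \<xi> = Abs_l2 (A (restr S \<xi>))"
proof -
  obtain C where C: "0 \<le> C" "op_norm S A \<le> ennreal C" using bounded_ops_bound[OF A] .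
  note el = bounded_ops_ell2[OF A]
  have "bounded_linear (\<lambda>\<xi>. Abs_l2 (A (restr S \<xi>)))"
  proof (rule bounded_linear_intro)
    show "Abs_l2 (A (restr S (\<xi> + \<eta>))) = Abs_l2 (A (restr S \<xi>)) + Abs_l2 (A (restr S \<eta>))" for \<xi> \<eta>
      by (rule l2_eqI) (simp add: coord_Abs[OF el] coord_Abs[OF ell2_add[OF el el]] restr_simps bounded_opsD(3)[OF A])
    show "Abs_l2 (A (restr S (r *\<^sub>R \<xi>))) = r *\<^sub>R Abs_l2 (A (restr S \<xi>))" for r \<xi>
      by (rule l2_eqI) (simp add: coord_Abs[OF el] coord_Abs[OF ell2_scale[OF el]] restr_simps bounded_opsD(4)[OF A]
          coord_scaleR del: coord_simps(5))
    show "norm (Abs_l2 (A (restr S \<xi>))) \<le> norm \<xi> * C" for \<xi>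
      using op_norm_apply[OF A C(2,1) restr_in, of \<xi>] mult_left_mono[OF ell2_norm_restr_le[of S \<xi>] C(1)]
      by (simp add: norm_Abs[OF el] mult.commute)
  qed
  then show ?thesis by (simp add: app_def bop_of_def Bop_inverse bounded_linear_Blinfun_apply)
qed

lemma coord_bop_of: "A \<in> bounded_ops S \<Longrightarrow> coord (app (bop_of S A) \<xi>) = A (restr S \<xi>)"
  by (simp add: app_bop_of coord_Abs[OF bounded_ops_ell2])

lemma coord_bop_of_Abs: "A \<in> bounded_ops S \<Longrightarrow> \<xi> \<in> ell2 S \<Longrightarrow> coord (app (bop_of S A) (Abs_l2 \<xi>)) = A \<xi>"
  by (simp add: coord_bop_of)

lemma norm_bop_of_le_iff:
  assumes A: "A \<in> bounded_ops S" and C: "0 \<le> C"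
  shows "norm (bop_of S A) \<le> C \<longleftrightarrow> op_norm S A \<le> ennreal C"
proof
  assume op: "op_norm S A \<le> ennreal C"
  show "norm (bop_of S A) \<le> C"
  proof (rule norm_bop_le[OF C])
    fix \<xi>
    show "norm (app (bop_of S A) \<xi>) \<le> C * norm \<xi>"
      using op_norm_apply[OF A op C restr_in, of \<xi>] mult_left_mono[OF ell2_norm_restr_le[of S \<xi>] C]
      by (simp add: app_bop_of[OF A] norm_Abs[OF bounded_ops_ell2[OF A]])
  qed
next
  assume n: "norm (bop_of S A) \<le> C"
  show "op_norm S A \<le> ennreal C"
  proof (rule op_normI[OF _ C])
    fix \<xi> assume \<xi>: "\<xi> \<in> ell2 S"
    have "norm (app (bop_of S A) (Abs_l2 \<xi>)) \<le> C * norm (Abs_l2 \<xi>)"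
      by (rule order_trans[OF norm_app_le mult_right_mono[OF n norm_ge_zero]])
    then show "ell2_norm S (A \<xi>) \<le> C * ell2_norm S \<xi>"
      by (simp add: app_bop_of[OF A] \<xi> norm_Abs[OF \<xi>] norm_Abs[OF bounded_ops_ell2[OF A]])
  qed
qed

lemma bounded_ops_linear_combination:
  assumes A: "A \<in> bounded_ops S" and B: "B \<in> bounded_ops S"
  shows "(\<lambda>\<xi> g. A \<xi> g + z * B \<xi> g) \<in> bounded_ops S" (is "?D \<in> _")
proof -
  obtain C where C: "0 \<le> C" "op_norm S A \<le> ennreal C" using bounded_ops_bound[OF A] .
  obtain C' where C': "0 \<le> C'" "op_norm S B \<le> ennreal C'" using bounded_ops_bound[OF B] .
  note el = bounded_ops_ell2[OF A] bounded_ops_ell2[OF B]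
  show ?thesis
  proof (rule bounded_opsI[where C = "C + cmod z * C'"])
    fix \<xi> assume \<xi>: "\<xi> \<in> ell2 S"
    show "?D \<xi> \<in> ell2 S" by (intro ell2_add ell2_scale el)
    have zB: "(\<lambda>g. z * B \<xi> g) \<in> ell2 S" by (intro ell2_scale el)
    have zn: "ell2_norm S (\<lambda>g. z * B \<xi> g) = cmod z * ell2_norm S (B \<xi>)"
      by (simp add: ell2_norm_def norm_mult power_mult_distrib infsum_cmult_right' real_sqrt_mult)
    have "Abs_l2 (?D \<xi>) = Abs_l2 (A \<xi>) + Abs_l2 (\<lambda>g. z * B \<xi> g)"
      by (rule l2_eqI) (simp add: coord_Abs[OF zB] coord_Abs[OF el(1)] coord_Abs[OF ell2_add[OF el(1) zB]])
    then have "norm (Abs_l2 (?D \<xi>)) \<le> norm (Abs_l2 (A \<xi>)) + norm (Abs_l2 (\<lambda>g. z * B \<xi> g))"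
      by (simp add: norm_triangle_ineq)
    then have "ell2_norm S (?D \<xi>) \<le> ell2_norm S (A \<xi>) + cmod z * ell2_norm S (B \<xi>)"
      by (simp add: norm_Abs[OF zB] norm_Abs[OF el(1)] norm_Abs[OF ell2_add[OF el(1) zB]] zn)
    also have "\<dots> \<le> C * ell2_norm S \<xi> + cmod z * (C' * ell2_norm S \<xi>)"
      by (intro add_mono mult_left_mono op_norm_apply[OF A C(2,1) \<xi>] op_norm_apply[OF B C'(2,1) \<xi>]) simp
    finally show "ell2_norm S (?D \<xi>) \<le> (C + cmod z * C') * ell2_norm S \<xi>" by (simp add: algebra_simps)
  qed (use C C' in \<open>auto simp: bounded_opsD[OF A] bounded_opsD[OF B] algebra_simps\<close>)
qed

lemma bop_of_linear_combination:
  assumes A: "A \<in> bounded_ops S" and B: "B \<in> bounded_ops S"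
  shows "bop_of S (\<lambda>\<xi> g. A \<xi> g + of_real r * B \<xi> g) = bop_of S A + r *\<^sub>R bop_of S B"
proof (intro bop_eqI l2_eqI)
  fix \<xi> g
  show "coord (app (bop_of S (\<lambda>\<xi> g. A \<xi> g + of_real r * B \<xi> g)) \<xi>) g
      = coord (app (bop_of S A + r *\<^sub>R bop_of S B) \<xi>) g"
    using bounded_ops_linear_combination[OF A B, of "of_real r"]
    by (simp add: coord_bop_of A B coord_scaleR del: coord_simps(5))
qed

lemma zero_bounded_ops: "(\<lambda>_ _. 0) \<in> bounded_ops S"
  by (rule bounded_opsI[where C = 0]) (simp_all add: ell2_norm_def)

lemma bop_of_zero: "bop_of S (\<lambda>_ _. 0) = 0"
  by (intro bop_eqI l2_eqI) (simp add: coord_bop_of zero_bounded_ops)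

lemma bounded_ops_comp:
  assumes A: "A \<in> bounded_ops S" and B: "B \<in> bounded_ops S"
  shows "A \<circ> B \<in> bounded_ops S"
proof -
  obtain C where C: "0 \<le> C" "op_norm S A \<le> ennreal C" using bounded_ops_bound[OF A] .
  obtain C' where C': "0 \<le> C'" "op_norm S B \<le> ennreal C'" using bounded_ops_bound[OF B] .
  have A0: "A (\<lambda>_. 0) = (\<lambda>_. 0)" using bounded_opsD(4)[OF A ell2_zero, of 0] by simp
  show ?thesis
  proof (rule bounded_opsI[where C = "C * C'"])
    fix \<xi> assume \<xi>: "\<xi> \<in> ell2 S"
    have "ell2_norm S (A (B \<xi>)) \<le> C * ell2_norm S (B \<xi>)" by (rule op_norm_apply[OF A C(2,1) bounded_ops_ell2[OF B]])
    also have "\<dots> \<le> C * (C' * ell2_norm S \<xi>)" by (intro mult_left_mono op_norm_apply[OF B C'(2,1) \<xi>] C)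
    finally show "ell2_norm S ((A \<circ> B) \<xi>) \<le> C * C' * ell2_norm S \<xi>" by (simp add: mult.assoc)
  qed (use C C' in \<open>auto simp: bounded_opsD[OF A] bounded_opsD[OF B] bounded_ops_ell2[OF B] A0\<close>)
qed

lemma bop_of_comp:
  assumes A: "A \<in> bounded_ops S" and B: "B \<in> bounded_ops S"
  shows "bop_of S (A \<circ> B) = bop_of S A * bop_of S B"
  by (intro bop_eqI) (simp add: app_bop_of A B bounded_ops_comp bounded_ops_ell2[OF B] restr_Abs[OF bounded_ops_ell2[OF B]])

text \<open>Complex linearity and vanishing off \<open>S\<close> are conditions on single
  coordinates, and coordinates are continuous. So limits formed in the Banach algebra can be brought
  back to operators on the fibre.\<close>

lemma bop_of_closed:
  assumes "\<And>\<epsilon>. \<epsilon> > 0 \<Longrightarrow> \<exists>A \<in> bounded_ops S. norm (F - bop_of S A) \<le> \<epsilon>"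
  shows "\<exists>A \<in> bounded_ops S. bop_of S A = F"
proof -
  have "\<forall>n. \<exists>A. A \<in> bounded_ops S \<and> norm (F - bop_of S A) \<le> inverse (real (Suc n))"
    using assms[of "inverse (real (Suc n))" for n] by force
  then obtain A where A: "\<And>n. A n \<in> bounded_ops S" "\<And>n. norm (F - bop_of S (A n)) \<le> inverse (real (Suc n))"
    by metis
  have "(\<lambda>n. bop_of S (A n) - F) \<longlonglongrightarrow> 0"
    by (rule Lim_null_comparison[OF _ LIMSEQ_inverse_real_of_nat])
      (use A(2) in \<open>auto simp: norm_minus_commute\<close>)
  then have "(\<lambda>n. bop_of S (A n)) \<longlonglongrightarrow> F" by (rule LIM_zero_cancel)
  then have lim: "(\<lambda>n. A n (restr S \<xi>) g) \<longlonglongrightarrow> coord (app F \<xi>) g" for \<xi> g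
    using coord_tendsto[OF app_tendsto, of "\<lambda>n. bop_of S (A n)" F \<xi> g] by (simp add: coord_bop_of A(1))
  have lim': "(\<lambda>n. A n \<xi> g) \<longlonglongrightarrow> coord (app F (Abs_l2 \<xi>)) g" if "\<xi> \<in> ell2 S" for \<xi> g
    using lim[of "Abs_l2 \<xi>" g] by (simp add: that)
  define B where "B \<xi> = (if \<xi> \<in> ell2 S then coord (app F (Abs_l2 \<xi>)) else (\<lambda>_. 0))" for \<xi>
  have limB: "(\<lambda>n. A n \<xi> g) \<longlonglongrightarrow> B \<xi> g" if "\<xi> \<in> ell2 S" for \<xi> g
    using lim'[OF that] that by (simp add: B_def)
  have Bin: "B \<xi> \<in> ell2 S" if "\<xi> \<in> ell2 S" for \<xi>
  proof -
    have "B \<xi> g = 0" if "g \<notin> S" for g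
    proof (rule LIMSEQ_unique[OF limB[OF \<open>\<xi> \<in> ell2 S\<close>]])
      show "(\<lambda>n. A n \<xi> g) \<longlonglongrightarrow> 0"
        using bounded_ops_ell2[OF A(1), of _ \<xi>] that by (simp add: ell2_def)
    qed
    then have "B \<xi> = restr S (app F (Abs_l2 \<xi>))"
      using that by (auto simp: restr_def B_def)
    then show ?thesis by simp
  qed
  have B: "B \<in> bounded_ops S"
  proof (rule bounded_opsI[where C = "norm F"])
    fix \<xi> assume \<xi>: "\<xi> \<in> ell2 S"
    then show "B \<xi> \<in> ell2 S" by (rule Bin)
    have "Abs_l2 (B \<xi>) = app F (Abs_l2 \<xi>)" using \<xi> by (simp add: B_def coord_inverse)
    then show "ell2_norm S (B \<xi>) \<le> norm F * ell2_norm S \<xi>"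
      using norm_app_le[of F "Abs_l2 \<xi>"] by (simp add: norm_Abs[OF Bin[OF \<xi>], symmetric] norm_Abs[OF \<xi>])
    show "B (\<lambda>g. \<xi> g + \<eta> g) = (\<lambda>g. B \<xi> g + B \<eta> g)" if \<eta>: "\<eta> \<in> ell2 S" for \<eta>
    proof
      fix g show "B (\<lambda>g. \<xi> g + \<eta> g) g = B \<xi> g + B \<eta> g"
      proof (rule LIMSEQ_unique[OF limB[OF ell2_add[OF \<xi> \<eta>]]])
        show "(\<lambda>n. A n (\<lambda>g. \<xi> g + \<eta> g) g) \<longlonglongrightarrow> B \<xi> g + B \<eta> g"
          unfolding bounded_opsD(3)[OF A(1) \<xi> \<eta>] by (intro tendsto_add limB \<xi> \<eta>)
      qed
    qed
    show "B (\<lambda>g. z * \<xi> g) = (\<lambda>g. z * B \<xi> g)" for z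
    proof
      fix g show "B (\<lambda>g. z * \<xi> g) g = z * B \<xi> g"
      proof (rule LIMSEQ_unique[OF limB[OF ell2_scale[OF \<xi>]]])
        show "(\<lambda>n. A n (\<lambda>g. z * \<xi> g) g) \<longlonglongrightarrow> z * B \<xi> g"
          unfolding bounded_opsD(4)[OF A(1) \<xi>] by (intro tendsto_mult_left limB \<xi>)
      qed
    qed
  qed (simp_all add: B_def)
  moreover have "bop_of S B = F"
  proof (intro bop_eqI l2_eqI)
    fix \<xi> g
    have "B (restr S \<xi>) g = coord (app F \<xi>) g"
      by (rule LIMSEQ_unique[OF limB[OF restr_in] lim])
    then show "coord (app (bop_of S B) \<xi>) g = coord (app F \<xi>) g" by (simp add: coord_bop_of[OF B])
  qed
  ultimately show ?thesis by blast
qed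

section \<open>Uniformly bounded families and the reduced norm\<close>

definition famop :: "'a top_groupoid \<Rightarrow> 'a op_family \<Rightarrow> 'a \<Rightarrow> 'a bop" where
  "famop G a x = bop_of (src_fiber G x) (a x)"

lemma op_families_bounded: "a \<in> op_families G \<Longrightarrow> a x \<in> bounded_ops (src_fiber G x)"
  by (cases "x \<in> units G") (auto simp: op_families_def zero_bounded_ops)

lemma op_families_outside: "a \<in> op_families G \<Longrightarrow> x \<notin> units G \<Longrightarrow> a x = (\<lambda>_ _. 0)"
  unfolding op_families_def by blast

lemma famop_outside: "a \<in> op_families G \<Longrightarrow> x \<notin> units G \<Longrightarrow> famop G a x = 0"
  by (simp add: op_families_def famop_def bop_of_zero)

text \<open>Off the units the family is zero, so the supremum may run over the whole type and the
  reduced norm becomes a bound uniform in \<open>x\<close>. Finiteness of the norm is not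
  presupposed, since the lemma also serves to prove membership in
  \<open>op_families\<close>.\<close>

lemma red_norm_le_iff:
  assumes a: "\<And>x. a x \<in> bounded_ops (src_fiber G x)" "\<And>x. x \<notin> units G \<Longrightarrow> a x = (\<lambda>_ _. 0)" and C: "0 \<le> C"
  shows "red_norm G a \<le> ennreal C \<longleftrightarrow> (\<forall>x. norm (famop G a x) \<le> C)"
proof -
  have "red_norm G a \<le> ennreal C \<longleftrightarrow> (\<forall>x\<in>units G. norm (famop G a x) \<le> C)"
    unfolding red_norm_def SUP_le_iff famop_def by (simp add: norm_bop_of_le_iff a C)
  also have "\<dots> \<longleftrightarrow> (\<forall>x. norm (famop G a x) \<le> C)"
  proof -
    have "norm (famop G a x) \<le> C" if "x \<notin> units G" for x using C a(2)[OF that] by (simp add: famop_def bop_of_zero)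
    then show ?thesis by blast
  qed
  finally show ?thesis .
qed

lemma op_familiesI:
  assumes a: "\<And>x. a x \<in> bounded_ops (src_fiber G x)" "\<And>x. x \<notin> units G \<Longrightarrow> a x = (\<lambda>_ _. 0)"
    and C: "\<And>x. norm (famop G a x) \<le> C"
  shows "a \<in> op_families G"
proof -
  have "0 \<le> C" using C norm_ge_zero order_trans by blast
  then have "red_norm G a \<le> ennreal C" using red_norm_le_iff[where a=a and G=G] a C by simp
  also have "\<dots> < \<infinity>" by simp
  finally show ?thesis using a by (simp add: op_families_def)
qed

lemma op_families_norm_bound:
  assumes "a \<in> op_families G"
  obtains C where "0 \<le> C" "\<And>x. norm (famop G a x) \<le> C"
proof -
  have "red_norm G a < \<infinity>" using assms by (simp add: op_families_def)
  then have "red_norm G a \<le> ennreal (enn2real (red_norm G a))" by simp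
  then have "\<forall>x. norm (famop G a x) \<le> enn2real (red_norm G a)"
    using red_norm_le_iff[OF op_families_bounded[OF assms] op_families_outside[OF assms] enn2real_nonneg] by simp
  then show ?thesis by (intro that[of "enn2real (red_norm G a)"]) auto
qed

lemma fam_linear_combination:
  assumes a: "a \<in> op_families G" and b: "b \<in> op_families G"
  shows "(\<lambda>x \<xi> g. a x \<xi> g + of_real r * b x \<xi> g) \<in> op_families G" (is "?d \<in> _")
    and "famop G (\<lambda>x \<xi> g. a x \<xi> g + of_real r * b x \<xi> g) x = famop G a x + r *\<^sub>R famop G b x"
proof -
  note ab = op_families_bounded[OF a] op_families_bounded[OF b]
  show eq: "famop G ?d x = famop G a x + r *\<^sub>R famop G b x" for x
    by (simp add: famop_def bop_of_linear_combination ab)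
  obtain C where C: "0 \<le> C" "\<And>x. norm (famop G a x) \<le> C" using op_families_norm_bound[OF a] by blast
  obtain C' where C': "0 \<le> C'" "\<And>x. norm (famop G b x) \<le> C'" using op_families_norm_bound[OF b] by blast
  show "?d \<in> op_families G"
  proof (rule op_familiesI)
    show "norm (famop G ?d x) \<le> C + \<bar>r\<bar> * C'" for x
      unfolding eq by (rule order_trans[OF norm_triangle_ineq]) (auto intro!: add_mono mult_left_mono C C')
  qed (use a b in \<open>auto simp: bounded_ops_linear_combination ab op_families_def\<close>)
qed

lemma fam_zero_op: "fam_zero \<in> op_families G" "famop G fam_zero x = 0"
proof -
  show "famop G fam_zero x = 0" for x by (simp add: famop_def fam_zero_def bop_of_zero)
  then show "fam_zero \<in> op_families G"
    by (intro op_familiesI[of _ _ 0]) (auto simp: fam_zero_def zero_bounded_ops)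
qed

lemma fam_diff_op:
  assumes a: "a \<in> op_families G" and b: "b \<in> op_families G"
  shows "fam_diff a b \<in> op_families G" "famop G (fam_diff a b) x = famop G a x - famop G b x"
  using fam_linear_combination[OF assms, of "-1"] by (simp_all add: fam_diff_def)

lemma fam_add_op:
  assumes a: "a \<in> op_families G" and b: "b \<in> op_families G"
  shows "famop G (fam_add a b) x = famop G a x + famop G b x"
  using fam_linear_combination[OF assms, of "1"] by (simp add: fam_add_def)

lemma fam_scale_op:
  assumes a: "a \<in> op_families G"
  shows "famop G (fam_scale (of_real r) a) x = r *\<^sub>R famop G a x"
  using fam_linear_combination(2)[OF fam_zero_op(1) assms, of "r"]
  by (simp add: fam_scale_def fam_zero_op fam_zero_def[symmetric]) (simp add: fam_zero_def fam_zero_op(2)[unfolded fam_zero_def])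

lemma fam_mult_op:
  assumes a: "a \<in> op_families G" and b: "b \<in> op_families G"
  shows "fam_mult a b \<in> op_families G" "famop G (fam_mult a b) x = famop G a x * famop G b x"
proof -
  note ab = op_families_bounded[OF a] op_families_bounded[OF b]
  show eq: "famop G (fam_mult a b) x = famop G a x * famop G b x" for x
    by (simp add: famop_def fam_mult_def bop_of_comp ab)
  obtain C where C: "0 \<le> C" "\<And>x. norm (famop G a x) \<le> C" using op_families_norm_bound[OF a] by blast
  obtain C' where C': "0 \<le> C'" "\<And>x. norm (famop G b x) \<le> C'" using op_families_norm_bound[OF b] by blast
  show "fam_mult a b \<in> op_families G"
  proof (rule op_familiesI)
    show "norm (famop G (fam_mult a b) x) \<le> C * C'" for x
      unfolding eq by (rule order_trans[OF norm_mult_ineq]) (auto intro!: mult_mono C C')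
  qed (use a b in \<open>auto simp: bounded_ops_comp ab op_families_def fam_mult_def fun_eq_iff\<close>)
qed

lemma famop_closed:
  assumes F: "\<And>\<epsilon>. \<epsilon> > 0 \<Longrightarrow> \<exists>a \<in> op_families G. \<forall>x. norm (F x - famop G a x) \<le> \<epsilon>"
  shows "\<exists>a \<in> op_families G. \<forall>x. famop G a x = F x"
proof -
  have "\<exists>A \<in> bounded_ops (src_fiber G x). bop_of (src_fiber G x) A = F x" for x
  proof (rule bop_of_closed)
    fix \<epsilon> :: real assume "\<epsilon> > 0"
    then obtain a where "a \<in> op_families G" "\<forall>x. norm (F x - famop G a x) \<le> \<epsilon>" using F by blast
    then show "\<exists>A \<in> bounded_ops (src_fiber G x). norm (F x - bop_of (src_fiber G x) A) \<le> \<epsilon>"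
      using op_families_bounded[of a G x] unfolding famop_def by blast
  qed
  then obtain A where A: "\<And>x. A x \<in> bounded_ops (src_fiber G x)" "\<And>x. bop_of (src_fiber G x) (A x) = F x"
    by metis
  define a where "a x = (if x \<in> units G then A x else (\<lambda>_ _. 0))" for x
  \<comment> \<open>Every approximant vanishes off the units, so a nonzero \<open>F x\<close> would
    stay at distance \<open>norm (F x)\<close> from all of them.\<close>
  have F0: "F x = 0" if "x \<notin> units G" for x
  proof (rule ccontr)
    assume "F x \<noteq> 0"
    then obtain b where "b \<in> op_families G" "norm (F x - famop G b x) \<le> norm (F x) / 2"
      using F[of "norm (F x) / 2"] by force
    then show False using \<open>F x \<noteq> 0\<close> by (simp add: famop_outside[OF _ that])
  qed
  have aF: "famop G a x = F x" for x by (simp add: famop_def a_def A F0 bop_of_zero)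
  obtain b where b: "b \<in> op_families G" "\<And>x. norm (F x - famop G b x) \<le> 1" using F[of 1] by auto
  obtain C where C: "0 \<le> C" "\<And>x. norm (famop G b x) \<le> C" using op_families_norm_bound[OF b(1)] by blast
  have "a \<in> op_families G"
  proof (rule op_familiesI)
    show "a x \<in> bounded_ops (src_fiber G x)" for x by (simp add: a_def A zero_bounded_ops)
    show "norm (famop G a x) \<le> 1 + C" for x
      using norm_triangle_ineq[of "F x - famop G b x" "famop G b x"] b(2)[of x] C(2)[of x] by (simp add: aF)
  qed (simp add: a_def)
  then show ?thesis using aF by blast
qed

lemma red_closure_iff:
  assumes D: "D \<subseteq> op_families G" and a: "a \<in> op_families G"
  shows "a \<in> red_closure G D \<longleftrightarrow> (\<forall>\<epsilon>>0. \<exists>d\<in>D. \<forall>x. norm (famop G a x - famop G d x) \<le> \<epsilon>)"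
proof -
  have le: "red_norm G (fam_diff a d) \<le> ennreal \<epsilon> \<longleftrightarrow> (\<forall>x. norm (famop G a x - famop G d x) \<le> \<epsilon>)"
    if "d \<in> D" "\<epsilon> \<ge> 0" for d \<epsilon>
  proof -
    have "fam_diff a d \<in> op_families G" using D a that by (auto intro: fam_diff_op)
    then have "red_norm G (fam_diff a d) \<le> ennreal \<epsilon> \<longleftrightarrow> (\<forall>x. norm (famop G (fam_diff a d) x) \<le> \<epsilon>)"
      using that by (intro red_norm_le_iff op_families_bounded op_families_outside)
    moreover have "famop G (fam_diff a d) x = famop G a x - famop G d x" for x
      using D that by (intro fam_diff_op a) auto
    ultimately show ?thesis by simp
  qed
  show ?thesis
  proof (intro iffI allI impI)
    fix \<epsilon> :: real assume "a \<in> red_closure G D" "\<epsilon> > 0"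
    from \<open>a \<in> red_closure G D\<close> have "\<forall>\<epsilon>>0. \<exists>d\<in>D. red_norm G (fam_diff a d) < ennreal \<epsilon>"
      unfolding red_closure_def mem_Collect_eq by (rule conjunct2)
    with \<open>\<epsilon> > 0\<close> obtain d where "d \<in> D" and d: "red_norm G (fam_diff a d) < ennreal \<epsilon>" by metis
    have "\<forall>x. norm (famop G a x - famop G d x) \<le> \<epsilon>"
      by (rule le[THEN iffD1, OF \<open>d \<in> D\<close> less_imp_le[OF \<open>\<epsilon> > 0\<close>] less_imp_le[OF d]])
    then show "\<exists>d\<in>D. \<forall>x. norm (famop G a x - famop G d x) \<le> \<epsilon>" using \<open>d \<in> D\<close> by (rule bexI)
  next
    assume r: "\<forall>\<epsilon>>0. \<exists>d\<in>D. \<forall>x. norm (famop G a x - famop G d x) \<le> \<epsilon>"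
    have "\<exists>d\<in>D. red_norm G (fam_diff a d) < ennreal \<epsilon>" if "\<epsilon> > 0" for \<epsilon>
    proof -
      \<comment> \<open>Half of \<open>\<epsilon>\<close>, because the closure is defined by a
        strict inequality and the criterion by a weak one.\<close>
      have "\<epsilon> / 2 > 0" using that by simp
      with r obtain d where d: "d \<in> D" "\<forall>x. norm (famop G a x - famop G d x) \<le> \<epsilon> / 2" by metis
      have "red_norm G (fam_diff a d) \<le> ennreal (\<epsilon> / 2)"
        by (rule le[THEN iffD2, OF d(1) less_imp_le[OF \<open>\<epsilon> / 2 > 0\<close>] d(2)])
      also have "\<dots> < ennreal \<epsilon>" using that by (simp add: ennreal_less_iff)
      finally show ?thesis using d(1) by (rule bexI)
    qed
    then show "a \<in> red_closure G D" unfolding red_closure_def mem_Collect_eq using a by (intro conjI allI impI)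
  qed
qed

section \<open>Etale groupoids and their bisections\<close>

context groupoid
begin

abbreviation "arr \<equiv> arrows G"
abbreviation "r \<equiv> rng G"
abbreviation "s \<equiv> src G"
abbreviation "iv \<equiv> ginv G"
abbreviation "TG \<equiv> gtop G"
abbreviation gprod (infixl "\<odot>" 70) where "g \<odot> h \<equiv> gmul G g h"

lemma src_iv: "g \<in> arr \<Longrightarrow> s (iv g) = r g"
  by (simp add: src_def rng_def inv_inv)

lemma rng_iv: "g \<in> arr \<Longrightarrow> r (iv g) = s g"
  by (simp add: src_def rng_def inv_inv)

lemma composableI [intro]: "g \<in> arr \<Longrightarrow> h \<in> arr \<Longrightarrow> s g = r h \<Longrightarrow> (g, h) \<in> composable G"
  by (simp add: composable_def)

lemma composable_iv: "g \<in> arr \<Longrightarrow> (g, iv g) \<in> composable G" "g \<in> arr \<Longrightarrow> (iv g, g) \<in> composable G"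
  by (auto simp: src_iv rng_iv inv_closed)

lemma mul_in: "g \<in> arr \<Longrightarrow> h \<in> arr \<Longrightarrow> s g = r h \<Longrightarrow> g \<odot> h \<in> arr"
  "g \<in> arr \<Longrightarrow> h \<in> arr \<Longrightarrow> s g = r h \<Longrightarrow> r (g \<odot> h) = r g"
  "g \<in> arr \<Longrightarrow> h \<in> arr \<Longrightarrow> s g = r h \<Longrightarrow> s (g \<odot> h) = s h"
  using mul_closed rng_mul src_mul by blast+

lemma assoc: "g \<in> arr \<Longrightarrow> h \<in> arr \<Longrightarrow> k \<in> arr \<Longrightarrow> s g = r h \<Longrightarrow> s h = r k \<Longrightarrow> (g \<odot> h) \<odot> k = g \<odot> (h \<odot> k)"
  using mul_assoc by blast

lemma rng_src_in: "g \<in> arr \<Longrightarrow> r g \<in> arr" "g \<in> arr \<Longrightarrow> s g \<in> arr"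
  unfolding rng_def src_def using mul_closed composable_iv by blast+

lemma rng_rng: "g \<in> arr \<Longrightarrow> r (r g) = r g" "g \<in> arr \<Longrightarrow> s (r g) = r g"
  unfolding rng_def[of G g] using rng_mul[OF composable_iv(1)] src_mul[OF composable_iv(1)]
  by (auto simp: src_iv) (simp_all add: rng_def)

lemma rng_in_units: "g \<in> arr \<Longrightarrow> r g \<in> units G"
  by (simp add: units_def)

lemma src_in_units: "g \<in> arr \<Longrightarrow> s g \<in> units G"
  using rng_in_units[of "iv g"] by (simp add: inv_closed rng_iv)

lemma unitsD: "x \<in> units G \<Longrightarrow> x \<in> arr" "x \<in> units G \<Longrightarrow> r x = x" "x \<in> units G \<Longrightarrow> s x = x"
  by (auto simp: units_def rng_src_in rng_rng)

lemma units_iff: "x \<in> units G \<longleftrightarrow> x \<in> arr \<and> r x = x"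
  by (metis rng_in_units unitsD(1,2))

lemma iv_unit: "x \<in> units G \<Longrightarrow> iv x = x"
proof -
  assume x: "x \<in> units G"
  note xx = unitsD[OF x]
  have "iv x = r (iv x) \<odot> iv x" using rng_unit[of "iv x"] xx inv_closed by simp
  also have "\<dots> = x \<odot> iv x" using xx by (simp add: rng_iv)
  also have "\<dots> = x" using xx by (simp add: rng_def)
  finally show ?thesis .
qed

lemma cancel:
  "g \<in> arr \<Longrightarrow> h \<in> arr \<Longrightarrow> s g = r h \<Longrightarrow> iv g \<odot> (g \<odot> h) = h"
  "g \<in> arr \<Longrightarrow> k \<in> arr \<Longrightarrow> r g = r k \<Longrightarrow> g \<odot> (iv g \<odot> k) = k"
  "g \<in> arr \<Longrightarrow> h \<in> arr \<Longrightarrow> s g = r h \<Longrightarrow> (g \<odot> h) \<odot> iv h = g"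
  "k \<in> arr \<Longrightarrow> g \<in> arr \<Longrightarrow> s k = s g \<Longrightarrow> (k \<odot> iv g) \<odot> g = k"
proof -
  show "iv g \<odot> (g \<odot> h) = h" if "g \<in> arr" "h \<in> arr" "s g = r h"
  proof -
    have "iv g \<odot> (g \<odot> h) = (iv g \<odot> g) \<odot> h"
      using assoc[of "iv g" g h] that by (simp only: inv_closed src_iv)
    also have "\<dots> = h" unfolding src_def[symmetric] that(3) by (rule rng_unit[OF that(2)])
    finally show ?thesis .
  qed
  show "g \<odot> (iv g \<odot> k) = k" if "g \<in> arr" "k \<in> arr" "r g = r k"
  proof -
    have "g \<odot> (iv g \<odot> k) = (g \<odot> iv g) \<odot> k"
      using assoc[of g "iv g" k] that by (simp only: inv_closed src_iv rng_iv)
    also have "\<dots> = k" unfolding rng_def[symmetric] that(3) by (rule rng_unit[OF that(2)])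
    finally show ?thesis .
  qed
  show "(g \<odot> h) \<odot> iv h = g" if "g \<in> arr" "h \<in> arr" "s g = r h"
  proof -
    have "(g \<odot> h) \<odot> iv h = g \<odot> (h \<odot> iv h)"
      using assoc[of g h "iv h"] that by (simp only: inv_closed rng_iv)
    also have "\<dots> = g" unfolding rng_def[symmetric] that(3)[symmetric] by (rule src_unit[OF that(1)])
    finally show ?thesis .
  qed
  show "(k \<odot> iv g) \<odot> g = k" if "k \<in> arr" "g \<in> arr" "s k = s g"
  proof -
    have "(k \<odot> iv g) \<odot> g = k \<odot> (iv g \<odot> g)"
      using assoc[of k "iv g" g] that by (simp only: inv_closed rng_iv src_iv)
    also have "\<dots> = k" unfolding src_def[symmetric] that(3)[symmetric] by (rule src_unit[OF that(1)])
    finally show ?thesis .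
  qed
qed

lemma src_fiberD: "g \<in> src_fiber G x \<Longrightarrow> g \<in> arr" "g \<in> src_fiber G x \<Longrightarrow> s g = x"
  by (auto simp: src_fiber_def)

lemma src_fiberI: "g \<in> arr \<Longrightarrow> s g = x \<Longrightarrow> g \<in> src_fiber G x"
  by (auto simp: src_fiber_def)

lemma mul_eq_iff:
  assumes "h \<in> arr" "g \<in> arr" "s h = r g"
  shows "h \<odot> g = k \<longleftrightarrow> (k \<in> arr \<and> s k = s g \<and> h = k \<odot> iv g)"
  using assms cancel(3)[OF assms] cancel(4)[of k g] mul_in[OF assms] by auto

lemma div_in: "k \<in> arr \<Longrightarrow> g \<in> arr \<Longrightarrow> s k = s g \<Longrightarrow> k \<odot> iv g \<in> arr"
  "k \<in> arr \<Longrightarrow> g \<in> arr \<Longrightarrow> s k = s g \<Longrightarrow> r (k \<odot> iv g) = r k"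
  "k \<in> arr \<Longrightarrow> g \<in> arr \<Longrightarrow> s k = s g \<Longrightarrow> s (k \<odot> iv g) = r g"
  by (simp_all add: mul_in inv_closed rng_iv src_iv)

lemma ldiv_in: "k \<in> arr \<Longrightarrow> g \<in> arr \<Longrightarrow> r k = r g \<Longrightarrow> iv g \<odot> k \<in> arr"
  "k \<in> arr \<Longrightarrow> g \<in> arr \<Longrightarrow> r k = r g \<Longrightarrow> r (iv g \<odot> k) = s g"
  "k \<in> arr \<Longrightarrow> g \<in> arr \<Longrightarrow> r k = r g \<Longrightarrow> s (iv g \<odot> k) = s k"
  by (simp_all add: mul_in inv_closed rng_iv src_iv)

lemma div_eq_iff:
  assumes "k \<in> arr" "g \<in> arr" "u \<in> arr" "s k = s g" "r u = r k"
  shows "k \<odot> iv g = u \<longleftrightarrow> g = iv u \<odot> k"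
proof
  assume *: "k \<odot> iv g = u"
  then have "u \<odot> g = k" using assms cancel(4) by blast
  moreover have "s u = r g" using * assms div_in by auto
  ultimately show "g = iv u \<odot> k" using cancel(1)[of u g] assms by simp
next
  assume *: "g = iv u \<odot> k"
  then have "u \<odot> g = k" using cancel(2)[of u k] assms by simp
  moreover have "s u = r g" using * assms by (simp add: ldiv_in)
  ultimately show "k \<odot> iv g = u" using cancel(3)[of u g] assms by simp
qed

lemma bisectionD:
  assumes "bisection G W"
  shows "W \<subseteq> arr" "inj_on r W" "inj_on s W"
  using assms by (auto simp: bisection_def bij_betw_def)

lemma bisectionI: "W \<subseteq> arr \<Longrightarrow> inj_on r W \<Longrightarrow> inj_on s W \<Longrightarrow> bisection G W"
  by (auto simp: bisection_def bij_betw_def)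

lemma bisection_subset: "bisection G W \<Longrightarrow> V \<subseteq> W \<Longrightarrow> bisection G V"
  by (meson bisectionD bisectionI inj_on_subset subset_trans)

lemma bisection_units: "bisection G (units G)"
  by (intro bisectionI inj_onI) (auto simp: unitsD)

end

section \<open>Topology of an etale groupoid\<close>

context lc_etale_groupoid
begin

abbreviation sub where "sub \<equiv> subtopology TG"

lemma topspace_top [simp]: "topspace TG = arr"
  by (simp add: arrows_def)

lemma topspace_unit_top [simp]: "topspace (unit_top G) = units G"
  unfolding unit_top_def by (auto simp: unitsD)

lemma continuous_map_mul:
  assumes "continuous_map X TG a" "continuous_map X TG b" "\<And>x. x \<in> topspace X \<Longrightarrow> s (a x) = r (b x)"
  shows "continuous_map X TG (\<lambda>x. a x \<odot> b x)"
proof -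
  have "a x \<in> arr" "b x \<in> arr" if "x \<in> topspace X" for x
    using assms(1,2) that by (auto simp: continuous_map_def)
  then have "continuous_map X (subtopology (prod_topology TG TG) (composable G)) (\<lambda>x. (a x, b x))"
    using assms by (auto simp: continuous_map_in_subtopology continuous_map_paired)
  from continuous_map_compose[OF this continuous_mul] show ?thesis by (simp add: o_def)
qed

lemma continuous_map_iv: "continuous_map X TG a \<Longrightarrow> continuous_map X TG (\<lambda>x. iv (a x))"
  using continuous_map_compose[OF _ continuous_inv] by (simp add: o_def)

lemma continuous_map_rng: "continuous_map TG (unit_top G) r"
  unfolding unit_top_def
proof (rule continuous_map_into_subtopology)
  have "continuous_map TG TG (\<lambda>g. g \<odot> iv g)"
    by (intro continuous_map_mul continuous_inv) (auto simp: rng_iv)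
  then show "continuous_map TG TG r" by (simp add: rng_def[abs_def])
qed (auto simp: rng_in_units)

lemma continuous_map_src: "continuous_map TG (unit_top G) s"
proof -
  have "continuous_map TG (unit_top G) (r \<circ> iv)"
    by (rule continuous_map_compose[OF continuous_inv continuous_map_rng])
  then show ?thesis by (rule continuous_map_eq) (simp add: rng_iv)
qed

lemma openin_rng_image_unit: "openin TG U \<Longrightarrow> openin (unit_top G) (r ` U)"
proof (subst openin_subopen, clarify)
  fix g assume U: "openin TG U" and g: "g \<in> U"
  then have "g \<in> topspace TG" using openin_subset by blast
  then obtain V where V: "openin TG V" "g \<in> V" "openin (unit_top G) (r ` V)"
    "homeomorphic_map (sub V) (subtopology (unit_top G) (r ` V)) r"
    using etale unfolding local_homeomorphism_def by blast
  have "open_map (sub V) (subtopology (unit_top G) (r ` V)) r"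
    using V(4) by (rule homeomorphic_imp_open_map)
  moreover have "openin (sub V) (U \<inter> V)" using U V by (simp add: openin_open_subtopology openin_Int)
  ultimately have "openin (subtopology (unit_top G) (r ` V)) (r ` (U \<inter> V))" by (simp add: open_map_def)
  then have "openin (unit_top G) (r ` (U \<inter> V))" using V(3) by (simp add: openin_open_subtopology)
  then show "\<exists>W. openin (unit_top G) W \<and> r g \<in> W \<and> W \<subseteq> r ` U"
    using g V(2) by (intro exI[of _ "r ` (U \<inter> V)"]) auto
qed

lemma local_inj: "g \<in> arr \<Longrightarrow> \<exists>U. openin TG U \<and> g \<in> U \<and> inj_on r U"
proof -
  assume "g \<in> arr"
  then obtain V where V: "openin TG V" "g \<in> V"
    "homeomorphic_map (sub V) (subtopology (unit_top G) (r ` V)) r"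
    using etale unfolding local_homeomorphism_def by (metis topspace_top)
  have "V \<subseteq> arr" using openin_subset[OF V(1)] by simp
  then have "inj_on r V" using homeomorphic_imp_injective_map[OF V(3)] by (simp add: Int_absorb1)
  then show ?thesis using V by blast
qed

text \<open>If \<open>r\<close> is injective on a neighbourhood \<open>U\<close> of a unit and both
  \<open>g\<close> and \<open>r g\<close> lie in \<open>U\<close>, then \<open>r (r g) = r g\<close>
  forces \<open>g = r g\<close>. By continuity of \<open>r\<close> these \<open>g\<close> form an
  open set.\<close>

lemma openin_units: "openin TG (units G)"
proof (subst openin_subopen, clarify)
  fix x assume x: "x \<in> units G"
  obtain U where U: "openin TG U" "x \<in> U" "inj_on r U" using local_inj unitsD(1)[OF x] by blast
  have "continuous_map TG TG r" using continuous_map_rng by (simp add: unit_top_def continuous_map_in_subtopology)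
  then have "openin TG {g \<in> topspace TG. r g \<in> U}" using U(1) by (rule openin_continuous_map_preimage)
  then have "openin TG ({g \<in> arr. r g \<in> U} \<inter> U)" using U(1) by (simp add: openin_Int)
  moreover have "{g \<in> arr. r g \<in> U} \<inter> U \<subseteq> units G"
    using U(3) by (auto simp: units_iff rng_rng inj_on_def)
  ultimately show "\<exists>V. openin TG V \<and> x \<in> V \<and> V \<subseteq> units G"
    using U(2) x by (intro exI[of _ "{g \<in> arr. r g \<in> U} \<inter> U"]) (auto simp: unitsD)
qed

lemma openin_unit_top: "openin (unit_top G) U \<longleftrightarrow> openin TG U \<and> U \<subseteq> units G"
  unfolding unit_top_def by (rule openin_open_subtopology[OF openin_units])

lemma openin_rng_image: "openin TG U \<Longrightarrow> openin TG (r ` U)"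
  using openin_rng_image_unit openin_unit_top by blast

lemma iv_image: "U \<subseteq> arr \<Longrightarrow> iv ` U = {g \<in> arr. iv g \<in> U}"
  using inv_closed inv_inv by force

lemma openin_iv_image: "openin TG U \<Longrightarrow> openin TG (iv ` U)"
  using openin_continuous_map_preimage[OF continuous_inv, of U] openin_subset[of TG U] by (simp add: iv_image)

lemma openin_src_image: "openin TG U \<Longrightarrow> openin TG (s ` U)"
proof -
  assume U: "openin TG U"
  then have "s ` U = r ` (iv ` U)" using openin_subset[OF U] by (auto simp: image_image rng_iv subset_iff intro!: image_cong)
  then show ?thesis using openin_rng_image[OF openin_iv_image[OF U]] by simp
qed

lemma inj_on_src_iv: "V \<subseteq> arr \<Longrightarrow> inj_on r V \<Longrightarrow> inj_on s (iv ` V)"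
  by (rule inj_on_imageI) (simp add: subset_iff src_iv cong: inj_on_cong)

lemma inj_on_rng_iv: "V \<subseteq> arr \<Longrightarrow> inj_on s V \<Longrightarrow> inj_on r (iv ` V)"
  by (rule inj_on_imageI) (simp add: subset_iff rng_iv cong: inj_on_cong)

lemma bisection_iv: "bisection G W \<Longrightarrow> bisection G (iv ` W)"
proof -
  assume W: "bisection G W"
  note W' = bisectionD[OF W]
  show ?thesis
    using W'(1) by (intro bisectionI inj_on_src_iv inj_on_rng_iv W') (auto simp: inv_closed)
qed

text \<open>Injectivity of \<open>s\<close> near \<open>g\<close> is injectivity of \<open>r\<close>
  near the inverse of \<open>g\<close>, hence the second neighbourhood \<open>V'\<close>.\<close>

lemma bisection_nbhd:
  assumes "openin TG U" "g \<in> U"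
  obtains W where "openin TG W" "g \<in> W" "W \<subseteq> U" "bisection G W"
proof -
  have g: "g \<in> arr" using assms openin_subset by fastforce
  obtain V where V: "openin TG V" "g \<in> V" "inj_on r V" using local_inj[OF g] by blast
  obtain V' where V': "openin TG V'" "iv g \<in> V'" "inj_on r V'" using local_inj[OF inv_closed[OF g]] by blast
  have V'a: "V' \<subseteq> arr" using openin_subset[OF V'(1)] by simp
  let ?W = "U \<inter> V \<inter> iv ` V'"
  have "openin TG ?W" using assms V V' openin_iv_image by (intro openin_Int) auto
  moreover have "g \<in> ?W" using assms V V' g by (auto intro!: image_eqI[of g iv "iv g"] simp: inv_inv)
  moreover have "bisection G ?W"
  proof (rule bisectionI)
    show "?W \<subseteq> arr" using openin_subset[OF assms(1)] by auto
    show "inj_on r ?W" using V(3) by (auto intro: inj_on_subset)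
    have "inj_on s (iv ` V')" using V'a V'(3) by (rule inj_on_src_iv)
    then show "inj_on s ?W" by (auto intro: inj_on_subset)
  qed
  ultimately show ?thesis using that by blast
qed

text \<open>\<open>r\<close> maps \<open>W\<close> continuously and injectively into the Hausdorff
  unit space, whether or not \<open>G\<close> itself is Hausdorff.\<close>

lemma Hausdorff_bisection: "openin TG W \<Longrightarrow> bisection G W \<Longrightarrow> Hausdorff_space (sub W)"
  by (rule Hausdorff_space_injective_preimage[OF Hausdorff_units
        continuous_map_from_subtopology[OF continuous_map_rng]])
    (auto intro: inj_on_subset[OF bisectionD(2)])

definition rsec :: "'a set \<Rightarrow> 'a \<Rightarrow> 'a" where "rsec W = the_inv_into W r"

lemma rsec:
  assumes "bisection G W"
  shows "g \<in> W \<Longrightarrow> rsec W (r g) = g" "x \<in> r ` W \<Longrightarrow> rsec W x \<in> W" "x \<in> r ` W \<Longrightarrow> r (rsec W x) = x"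
  unfolding rsec_def using bisectionD(2)[OF assms]
  by (auto simp: the_inv_into_f_f f_the_inv_into_f intro: the_inv_into_into)

lemma continuous_rsec:
  assumes W: "openin TG W" "bisection G W"
  shows "continuous_map (subtopology (unit_top G) (r ` W)) TG (rsec W)"
proof -
  note W' = bisectionD[OF W(2)]
  have ts: "topspace (subtopology (unit_top G) (r ` W)) = r ` W" "topspace (sub W) = W"
    using W' rng_in_units by auto
  have oW: "openin (unit_top G) (r ` W)" by (rule openin_rng_image_unit[OF W(1)])
  have "homeomorphic_map (sub W) (subtopology (unit_top G) (r ` W)) r"
  proof (rule bijective_open_imp_homeomorphic_map)
    show "continuous_map (sub W) (subtopology (unit_top G) (r ` W)) r"
      by (intro continuous_map_into_subtopology continuous_map_from_subtopology continuous_map_rng) auto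
    show "open_map (sub W) (subtopology (unit_top G) (r ` W)) r"
      unfolding open_map_def openin_open_subtopology[OF W(1)] openin_open_subtopology[OF oW]
      using openin_rng_image_unit by blast
  qed (use W' ts in auto)
  then obtain p where p: "homeomorphic_maps (sub W) (subtopology (unit_top G) (r ` W)) r p"
    using homeomorphic_map_maps by blast
  have "continuous_map (subtopology (unit_top G) (r ` W)) TG p"
    using p by (auto simp: homeomorphic_maps_def continuous_map_in_subtopology)
  moreover have "p x = rsec W x" if "x \<in> topspace (subtopology (unit_top G) (r ` W))" for x
    using p that rsec(1)[OF W(2)] unfolding homeomorphic_maps_def ts by auto
  ultimately show ?thesis by (rule continuous_map_eq)
qed

end

section \<open>Spanning compactly supported functions by functions on bisections\<close>

lemma continuous_map_complex:
  fixes f h :: "'a \<Rightarrow> complex"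
  shows "continuous_map X euclidean f \<Longrightarrow> continuous_map X euclidean h \<Longrightarrow> continuous_map X euclidean (\<lambda>x. f x * h x)"
    and "continuous_map X euclidean f \<Longrightarrow> continuous_map X euclidean (\<lambda>x. cnj (f x))"
    and "continuous_map X euclideanreal u \<Longrightarrow> continuous_map X euclidean (\<lambda>x. complex_of_real (u x))"
  by (simp_all add: continuous_map_atin tendsto_mult tendsto_cnj tendsto_of_real)

text \<open>Pasting over \<open>U\<close> and the complement of \<open>C\<close>. In a non-Hausdorff
  space a compact support may fail to be closed, so the applications take place inside Hausdorff
  spaces.\<close>

lemma continuous_map_extend_zero:
  fixes f :: "'a \<Rightarrow> 'b::real_normed_vector"
  assumes U: "openin X U" and C: "closedin X C" "C \<subseteq> U"
    and f: "continuous_map (subtopology X U) euclidean f" and zero: "\<And>g. g \<notin> C \<Longrightarrow> f g = 0"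
  shows "continuous_map X euclidean f"
proof (rule pasting_lemma[where I = "UNIV :: bool set" and T = "\<lambda>b. if b then U else topspace X - C" and f = "\<lambda>b. if b then f else (\<lambda>_. 0)"])
  show "\<And>b. b \<in> UNIV \<Longrightarrow> openin X (if b then U else topspace X - C)" using U C by auto
  show "\<And>b. b \<in> UNIV \<Longrightarrow> continuous_map (subtopology X (if b then U else topspace X - C)) euclidean (if b then f else (\<lambda>_. 0))"
    using f by auto
  show "\<And>i j x. i \<in> UNIV \<Longrightarrow> j \<in> UNIV \<Longrightarrow> x \<in> topspace X \<inter> (if i then U else topspace X - C) \<inter> (if j then U else topspace X - C)
     \<Longrightarrow> (if i then f else (\<lambda>_. 0)) x = (if j then f else (\<lambda>_. 0)) x"
    using zero by (auto split: if_splits)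
  show "\<And>x. x \<in> topspace X \<Longrightarrow> \<exists>j. j \<in> UNIV \<and> x \<in> (if j then U else topspace X - C) \<and> f x = (if j then f else (\<lambda>_. 0)) x"
    using zero C(2) by (metis (full_types) DiffI UNIV_I subset_iff)
qed

text \<open>A linear span without coefficients: the generating sets \<open>Cb H\<close> used below
  are closed under scalar multiples. Induction then adds one generator at a time.\<close>

inductive_set fsums :: "('a \<Rightarrow> complex) set \<Rightarrow> ('a \<Rightarrow> complex) set" for D where
  zero: "(\<lambda>_. 0) \<in> fsums D"
| add: "f \<in> fsums D \<Longrightarrow> \<phi> \<in> D \<Longrightarrow> (\<lambda>g. f g + \<phi> g) \<in> fsums D"

lemma fsums_base: "\<phi> \<in> D \<Longrightarrow> \<phi> \<in> fsums D"
  using fsums.add[OF fsums.zero] by fastforce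

lemma fsums_add: "h \<in> fsums D \<Longrightarrow> f \<in> fsums D \<Longrightarrow> (\<lambda>g. f g + h g) \<in> fsums D"
proof (induction rule: fsums.induct)
  case (add h \<phi>)
  then show ?case using fsums.add[of "\<lambda>g. f g + h g" D \<phi>] by (simp add: add.assoc)
qed simp

lemma fsums_sum: "finite F \<Longrightarrow> (\<And>k. k \<in> F \<Longrightarrow> f k \<in> fsums D) \<Longrightarrow> (\<lambda>g. \<Sum>k\<in>F. f k g) \<in> fsums D"
proof (induction F rule: finite_induct)
  case (insert k F)
  then show ?case using fsums_add[of "\<lambda>g. \<Sum>k\<in>F. f k g" D "f k"] by simp
qed (simp add: fsums.zero)

lemma fsums_map:
  assumes "f \<in> fsums D" and "\<And>\<phi>. \<phi> \<in> D \<Longrightarrow> P \<phi> \<in> fsums D'"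
    and "P (\<lambda>_. 0) = (\<lambda>_. 0)" "\<And>f h. P (\<lambda>g. f g + h g) = (\<lambda>g. P f g + P h g)"
  shows "P f \<in> fsums D'"
  using assms(1)
proof (induction rule: fsums.induct)
  case (add f \<phi>)
  then show ?case using assms by (simp add: fsums_add)
qed (simp add: assms fsums.zero)

context lc_etale_groupoid
begin

text \<open>The functions in \<open>Cb H\<close> span \<open>C\<^sub>c(H)\<close>, and on them convolution reduces to a product of two values.\<close>

definition supported :: "'a set \<Rightarrow> 'a set \<Rightarrow> ('a \<Rightarrow> complex) \<Rightarrow> bool" where
  "supported W K f \<longleftrightarrow> openin TG W \<and> bisection G W \<and> K \<subseteq> W \<and> compactin TG K \<and>
     (\<forall>g. g \<notin> K \<longrightarrow> f g = 0) \<and> continuous_map (sub W) euclidean f"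

definition Cb :: "'a set \<Rightarrow> ('a \<Rightarrow> complex) set" where
  "Cb H = {f. \<exists>W K. W \<subseteq> H \<and> supported W K f}"

lemma supportedD:
  assumes "supported W K f"
  shows "openin TG W" "bisection G W" "K \<subseteq> W" "compactin TG K" "\<And>g. g \<notin> K \<Longrightarrow> f g = 0"
    "continuous_map (sub W) euclidean f" "\<forall>g. g \<notin> W \<longrightarrow> f g = 0"
  using assms unfolding supported_def by blast+

lemma CbE:
  assumes "f \<in> Cb H"
  obtains W K where "W \<subseteq> H" "supported W K f"
  using assms unfolding Cb_def by blast

lemma CbI:
  assumes "openin TG W" "W \<subseteq> H" "bisection G W" "K \<subseteq> W" "compactin TG K"
    "\<And>g. g \<notin> K \<Longrightarrow> f g = 0" "continuous_map (sub W) euclidean f"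
  shows "f \<in> Cb H"
  using assms unfolding Cb_def supported_def by blast

lemma Cb_mono: "H \<subseteq> H' \<Longrightarrow> Cb H \<subseteq> Cb H'"
  unfolding Cb_def by blast

lemma Cb_scale:
  assumes "f \<in> Cb H"
  shows "(\<lambda>g. c * f g) \<in> Cb H"
proof -
  obtain W K where "W \<subseteq> H" "supported W K f" using assms by (rule CbE)
  note f = this(1) supportedD[OF this(2)]
  show ?thesis by (rule CbI[of W H K]) (use f in \<open>auto intro!: continuous_map_complex\<close>)
qed

lemma Cb_bounded:
  assumes "f \<in> Cb H"
  obtains M where "0 \<le> M" "\<And>g. cmod (f g) \<le> M"
proof -
  obtain W K where "W \<subseteq> H" "supported W K f" using assms by (rule CbE)
  note f = supportedD[OF this(2)]
  have "compactin (sub W) K" using f(3,4) by (simp add: compactin_subtopology)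
  then have "compactin euclidean (f ` K)" using f(6) by (rule image_compactin)
  then have "bounded (f ` K)" by (simp add: compact_imp_bounded)
  then obtain M where M: "\<And>g. g \<in> K \<Longrightarrow> cmod (f g) \<le> M" by (auto simp: bounded_iff)
  have "cmod (f g) \<le> max M 0" for g using M[of g] f(5)[of g] by (cases "g \<in> K") auto
  then show ?thesis by (intro that[of "max M 0"]) auto
qed

section \<open>Bump functions and partitions of unity\<close>

definition bump_on :: "'a set \<Rightarrow> 'a \<Rightarrow> 'a set \<Rightarrow> ('a \<Rightarrow> real) \<Rightarrow> bool" where
  "bump_on U g C \<theta> \<longleftrightarrow> compactin TG C \<and> C \<subseteq> U \<and> (\<forall>h. h \<notin> C \<longrightarrow> \<theta> h = 0) \<and> \<theta> g = 1 \<and>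
     (\<forall>h. 0 \<le> \<theta> h \<and> \<theta> h \<le> 1) \<and> continuous_map (sub U) euclideanreal \<theta>"

lemma bump_onD:
  assumes "bump_on U g C \<theta>"
  shows "compactin TG C" "C \<subseteq> U" "\<And>h. h \<notin> C \<Longrightarrow> \<theta> h = 0" "\<theta> g = 1"
    "\<And>h. 0 \<le> \<theta> h \<and> \<theta> h \<le> 1" "continuous_map (sub U) euclideanreal \<theta>"
  using assms unfolding bump_on_def by blast+

text \<open>\<open>r\<close> identifies \<open>U\<close> with an open subset of the unit space,
  which is locally compact Hausdorff and hence completely regular; the bump and its compact support
  are pulled back from there. Continuity is claimed only on \<open>U\<close>, since the extension by
  zero may be discontinuous on a non-Hausdorff \<open>G\<close>.\<close>

lemma bump:
  assumes U: "openin TG U" "bisection G U" and g: "g \<in> U"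
  obtains C \<theta> where "bump_on U g C \<theta>"
proof -
  note U' = bisectionD[OF U(2)]
  have cr: "completely_regular_space (unit_top G)"
    using locally_compact_regular_imp_completely_regular_space locally_compact_units Hausdorff_units by blast
  have "neighbourhood_base_of (compactin (unit_top G)) (unit_top G)"
    using locally_compact_space_neighbourhood_base locally_compact_units Hausdorff_units by blast
  moreover have oU: "openin (unit_top G) (r ` U)" by (rule openin_rng_image_unit[OF U(1)])
  moreover have "r g \<in> r ` U" using g by simp
  ultimately obtain V C where V: "openin (unit_top G) V" "compactin (unit_top G) C" "r g \<in> V" "V \<subseteq> C" "C \<subseteq> r ` U"
    unfolding neighbourhood_base_of by metis
  have "closedin (unit_top G) (units G - V)" using V(1) by (metis closedin_diff closedin_topspace topspace_unit_top)
  moreover have "r g \<in> topspace (unit_top G) - (units G - V)" using V(3) openin_subset[OF V(1)] by auto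
  ultimately obtain \<psi> :: "'a \<Rightarrow> real" where \<psi>: "continuous_map (unit_top G) (top_of_set {0..1}) \<psi>" "\<psi> (r g) = 0"
    "\<psi> ` (units G - V) \<subseteq> {1}"
    using cr unfolding completely_regular_space_def by metis
  \<comment> \<open>\<open>\<psi>\<close> is 0 at \<open>r g\<close> and 1 off \<open>V\<close>, so
    the bump is its complement.\<close>
  define \<theta> where "\<theta> h = (if h \<in> U then 1 - \<psi> (r h) else 0)" for h
  have \<psi>01: "0 \<le> \<psi> x \<and> \<psi> x \<le> 1" if "x \<in> units G" for x
    using \<psi>(1) that by (auto simp: continuous_map_in_subtopology)
  let ?C = "rsec U ` C"
  have C': "compactin TG ?C"
  proof (rule image_compactin[OF _ continuous_rsec[OF U]])
    show "compactin (subtopology (unit_top G) (r ` U)) C" using V by (simp add: compactin_subtopology)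
  qed
  show ?thesis
  proof (rule that[of ?C \<theta>], unfold bump_on_def, intro conjI allI impI)
    show "compactin TG ?C" by (rule C')
    show "?C \<subseteq> U" using V(5) rsec(2)[OF U(2)] by blast
    show "\<theta> h = 0" if "h \<notin> ?C" for h
    proof (cases "h \<in> U")
      case True
      then have "r h \<notin> C" using that rsec(1)[OF U(2)] by force
      then have "r h \<in> units G - V" using V(4) True U'(1) rng_in_units by auto
      then have "\<psi> (r h) = 1" using \<psi>(3) by blast
      then show ?thesis by (simp add: \<theta>_def)
    qed (simp add: \<theta>_def)
    show "\<theta> g = 1" using g \<psi>(2) by (simp add: \<theta>_def)
    show "0 \<le> \<theta> h" "\<theta> h \<le> 1" for h
      using \<psi>01[of "r h"] U'(1) rng_in_units by (auto simp: \<theta>_def)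
    have "continuous_map (unit_top G) euclideanreal \<psi>" using \<psi>(1) by (simp add: continuous_map_in_subtopology)
    then have "continuous_map TG euclideanreal (\<psi> \<circ> r)" by (rule continuous_map_compose[OF continuous_map_rng])
    then have "continuous_map (sub U) euclideanreal (\<lambda>h. 1 - \<psi> (r h))"
      by (intro continuous_intros) (simp add: continuous_map_from_subtopology o_def)
    then show "continuous_map (sub U) euclideanreal \<theta>"
      by (rule continuous_map_eq) (simp add: \<theta>_def)
  qed
qed

lemma Cb_bump:
  assumes "openin TG U" "bisection G U" "g \<in> U" "U \<subseteq> H"
  obtains f where "f \<in> Cb H" "f g = 1" "\<And>h. h \<notin> U \<Longrightarrow> f h = 0" "\<And>h. cmod (f h) \<le> 1"
proof -
  obtain C \<theta> where "bump_on U g C \<theta>" using assms(1-3) by (rule bump)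
  note \<theta> = bump_onD[OF this]
  show ?thesis
  proof (rule that[of "\<lambda>h. of_real (\<theta> h)"])
    show "(\<lambda>h. complex_of_real (\<theta> h)) \<in> Cb H"
      by (rule CbI[of U _ C]) (use assms \<theta> in \<open>auto intro: continuous_map_complex\<close>)
  qed (use \<theta> in auto)
qed

text \<open>A partition of unity on the compact support \<open>K\<close>: bumps on open bisections
  inside \<open>W\<close> are normalised by their sum and multiplied into \<open>f\<close>. Since
  \<open>W\<close> is Hausdorff, the compact supports of the bumps are closed in it, and the bumps
  are continuous on all of \<open>W\<close>.\<close>

lemma Cc_gen_in_sums_Cb:
  assumes H: "openin TG H" and f: "f \<in> Cc_gen (sub H)"
  shows "f \<in> fsums (Cb H)"
proof -
  obtain W where W0: "openin (sub H) W" "Hausdorff_space (subtopology (sub H) W)"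
    and zero: "\<And>g. g \<notin> W \<Longrightarrow> f g = 0" and cont0: "continuous_map (subtopology (sub H) W) euclidean f"
    and K0: "compactin (subtopology (sub H) W) ((subtopology (sub H) W) closure_of {g \<in> W. f g \<noteq> 0})"
    using f unfolding Cc_gen_def by blast
  have W: "openin TG W" "W \<subseteq> H" using W0(1) by (auto simp: openin_open_subtopology[OF H])
  have eq: "subtopology (sub H) W = sub W"
    using W(2) by (simp add: subtopology_subtopology Int_absorb1)
  define X where "X = sub W"
  define K where "K = X closure_of {g \<in> W. f g \<noteq> 0}"
  have tX: "topspace X = W" using openin_subset[OF W(1)] by (auto simp: X_def)
  have hX: "Hausdorff_space X" and fX: "continuous_map X euclidean f" and KX: "compactin X K"
    using W0(2) cont0 K0 unfolding eq X_def[symmetric] K_def[symmetric] by auto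
  have oX: "openin X U \<longleftrightarrow> openin TG U \<and> U \<subseteq> W" for U unfolding X_def by (rule openin_open_subtopology[OF W(1)])
  have KW: "K \<subseteq> W" using compactin_subset_topspace[OF KX] tX by simp
  have fK: "f g = 0" if "g \<notin> K" for g
  proof (rule ccontr)
    assume "f g \<noteq> 0"
    then have "g \<in> {g \<in> W. f g \<noteq> 0}" using zero by blast
    moreover have "{g \<in> W. f g \<noteq> 0} \<subseteq> K" unfolding K_def by (rule closure_of_subset) (auto simp: tX)
    ultimately show False using that by blast
  qed
  have "\<exists>\<theta> U C. openin TG U \<and> bisection G U \<and> U \<subseteq> W \<and> bump_on U k C \<theta> \<and> continuous_map X euclideanreal \<theta>"
    if "k \<in> K" for k
  proof -
    have kW: "k \<in> W" using KW that by (rule subsetD)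
    obtain U where U: "openin TG U" "k \<in> U" "U \<subseteq> W" "bisection G U"
      using W(1) kW by (rule bisection_nbhd)
    obtain C \<theta> where b: "bump_on U k C \<theta>" using U(1,4,2) by (rule bump)
    note \<theta> = bump_onD[OF b]
    have "continuous_map X euclideanreal \<theta>"
    proof (rule continuous_map_extend_zero[OF _ _ \<theta>(2) _ \<theta>(3)])
      show "openin X U" using U by (simp add: oX)
      have "compactin X C" using \<theta>(1,2) U(3) by (auto simp: X_def compactin_subtopology)
      then show "closedin X C" by (rule compactin_imp_closedin[OF hX])
      show "continuous_map (subtopology X U) euclideanreal \<theta>"
        using \<theta>(6) U(3) by (simp add: X_def subtopology_subtopology Int_absorb1)
    qed
    then show ?thesis using U b by blast
  qed
  then have "\<exists>\<theta> U C. \<forall>k\<in>K. openin TG (U k) \<and> bisection G (U k) \<and> U k \<subseteq> W \<and> bump_on (U k) k (C k) (\<theta> k) \<and>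
      continuous_map X euclideanreal (\<theta> k)"
    by metis
  then obtain \<theta> U C where *: "\<forall>k\<in>K. openin TG (U k) \<and> bisection G (U k) \<and> U k \<subseteq> W \<and> bump_on (U k) k (C k) (\<theta> k) \<and>
      continuous_map X euclideanreal (\<theta> k)" by (elim exE)
  have pk: "openin TG (U k)" "bisection G (U k)" "U k \<subseteq> W" "compactin TG (C k)" "C k \<subseteq> U k" "\<And>h. h \<notin> C k \<Longrightarrow> \<theta> k h = 0" "\<theta> k k = 1"
    "\<And>h. 0 \<le> \<theta> k h" "continuous_map X euclideanreal (\<theta> k)" if "k \<in> K" for k
    using bspec[OF * that] bump_onD[of "U k" k "C k" "\<theta> k"] by blast+
  define O' where "O' k = {h \<in> W. \<theta> k h \<in> {1/2<..}}" for k
  have oO: "openin X (O' k)" if "k \<in> K" for k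
    using openin_continuous_map_preimage[OF pk(9)[OF that], of "{1/2<..}"] by (simp add: O'_def tX)
  have "K \<subseteq> \<Union> (O' ` K)" using pk(7) KW by (force simp: O'_def)
  moreover have "\<forall>B \<in> O' ` K. openin X B" using oO by blast
  ultimately obtain \<F> where "finite \<F>" "\<F> \<subseteq> O' ` K" "K \<subseteq> \<Union>\<F>"
    using KX unfolding compactin_def by metis
  then obtain F where F: "finite F" "F \<subseteq> K" "K \<subseteq> \<Union> (O' ` F)" by (metis finite_subset_image)
  define \<Sigma> where "\<Sigma> h = (\<Sum>k\<in>F. \<theta> k h)" for h
  have \<Sigma>half: "\<Sigma> h \<ge> 1/2" if "h \<in> K" for h
  proof -
    obtain k where k: "k \<in> F" "h \<in> O' k" using F(3) \<open>h \<in> K\<close> by blast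
    have "\<theta> k h \<le> \<Sigma> h" unfolding \<Sigma>_def using F pk(8) k by (intro member_le_sum) auto
    then show ?thesis using k(2) by (simp add: O'_def)
  qed
  \<comment> \<open>The sum is at least 1/2 on \<open>K\<close>, so the maximum changes nothing
    there. Elsewhere it prevents division by zero, and \<open>f\<close> vanishes.\<close>
  have \<Sigma>X: "continuous_map X euclideanreal (\<lambda>h. max (1/2) (\<Sigma> h))"
    unfolding \<Sigma>_def by (intro continuous_intros continuous_map_sum F) (use F pk(9) in auto)
  define \<phi> where "\<phi> k h = f h * of_real (\<theta> k h / max (1/2) (\<Sigma> h))" for k h
  have "\<phi> k \<in> Cb H" if "k \<in> F" for k
  proof (rule CbI)
    have k: "k \<in> K" using F that by blast
    show "openin TG (U k)" "U k \<subseteq> H" "bisection G (U k)" "C k \<subseteq> U k" "compactin TG (C k)" using pk[OF k] W by auto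
    show "\<phi> k g = 0" if "g \<notin> C k" for g using pk(6)[OF k that] by (simp add: \<phi>_def)
    have "continuous_map X euclidean (\<phi> k)"
      unfolding \<phi>_def by (intro continuous_map_complex fX continuous_map_real_divide pk(9)[OF k] \<Sigma>X) auto
    then have "continuous_map (subtopology X (U k)) euclidean (\<phi> k)" by (rule continuous_map_from_subtopology)
    then show "continuous_map (sub (U k)) euclidean (\<phi> k)"
      using pk(3)[OF k] by (simp add: X_def subtopology_subtopology Int_absorb1)
  qed
  then have "(\<lambda>h. \<Sum>k\<in>F. \<phi> k h) \<in> fsums (Cb H)" by (intro fsums_sum F fsums_base)
  moreover have "(\<Sum>k\<in>F. \<phi> k h) = f h" for h
  proof (cases "h \<in> K")
    case True
    have "(\<Sum>k\<in>F. \<phi> k h) = f h * of_real (\<Sigma> h / max (1/2) (\<Sigma> h))"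
      by (simp add: \<phi>_def \<Sigma>_def sum_distrib_left sum_divide_distrib)
    also have "\<Sigma> h / max (1/2) (\<Sigma> h) = 1" using \<Sigma>half[OF True] by (simp add: max_def)
    finally show ?thesis by simp
  qed (simp add: \<phi>_def fK)
  ultimately show ?thesis by simp
qed

lemma Cb_subset_Cc_gen:
  assumes H: "openin TG H"
  shows "Cb H \<subseteq> Cc_gen (sub H)"
proof
  fix f assume "f \<in> Cb H"
  then obtain W K where WH: "W \<subseteq> H" and "supported W K f" by (rule CbE)
  note f = supportedD[OF this(2)]
  have eq: "subtopology (sub H) W = sub W"
    using WH by (simp add: subtopology_subtopology Int_absorb1)
  have K: "compactin (sub W) K" using f(3,4) by (simp add: compactin_subtopology)
  then have clK: "closedin (sub W) K" by (rule compactin_imp_closedin[OF Hausdorff_bisection[OF f(1,2)]])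
  have "sub W closure_of {g \<in> W. f g \<noteq> 0} \<subseteq> K"
    by (rule closure_of_minimal[OF _ clK]) (use f(5) in blast)
  then have "compactin (sub W) (sub W closure_of {g \<in> W. f g \<noteq> 0})"
    by (rule closed_compactin[OF K]) simp
  then show "f \<in> Cc_gen (sub H)"
    unfolding Cc_gen_def
    by (intro CollectI exI[of _ W]) (use f(1,2,6,7) WH in \<open>auto simp: eq openin_open_subtopology[OF H] Hausdorff_bisection\<close>)
qed

lemma Cc_eq_sums_Cb:
  assumes H: "openin TG H"
  shows "Cc (sub H) = fsums (Cb H)"
proof (intro equalityI subsetI)
  fix f assume "f \<in> Cc (sub H)"
  then obtain F c where F: "finite F" "F \<subseteq> Cc_gen (sub H)" "f = (\<lambda>g. \<Sum>\<phi>\<in>F. c \<phi> * \<phi> g)"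
    unfolding Cc_def by blast
  have "(\<lambda>g. c \<phi> * \<phi> g) \<in> fsums (Cb H)" if "\<phi> \<in> F" for \<phi>
    by (rule fsums_map[where P = "\<lambda>f g. c \<phi> * f g", OF Cc_gen_in_sums_Cb[OF H]])
      (use F that in \<open>auto intro: fsums_base Cb_scale simp: distrib_left\<close>)
  then show "f \<in> fsums (Cb H)" unfolding F(3) by (intro fsums_sum F)
next
  fix f assume "f \<in> fsums (Cb H)"
  then show "f \<in> Cc (sub H)"
  proof (induction rule: fsums.induct)
    case zero
    show ?case unfolding Cc_def by (intro CollectI exI[of _ "{}"] exI[of _ "\<lambda>_. 0"]) auto
  next
    case (add f \<psi>)
    then obtain F c where F: "finite F" "F \<subseteq> Cc_gen (sub H)" "f = (\<lambda>g. \<Sum>\<phi>\<in>F. c \<phi> * \<phi> g)"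
      unfolding Cc_def by blast
    \<comment> \<open>\<open>\<psi>\<close> may already occur in \<open>F\<close>; its coefficient
      is then raised by 1.\<close>
    define c' where "c' \<phi> = (if \<phi> \<in> F then c \<phi> else 0) + (if \<phi> = \<psi> then 1 else 0)" for \<phi>
    have "(\<lambda>g. f g + \<psi> g) = (\<lambda>g. \<Sum>\<phi>\<in>insert \<psi> F. c' \<phi> * \<phi> g)"
    proof
      fix g
      have 1: "(\<Sum>\<phi>\<in>insert \<psi> F. (if \<phi> \<in> F then c \<phi> else 0) * \<phi> g) = (\<Sum>\<phi>\<in>F. c \<phi> * \<phi> g)"
        using F(1) by (intro sum.mono_neutral_cong_right) auto
      have "(\<Sum>\<phi>\<in>insert \<psi> F. (if \<phi> = \<psi> then 1 else 0) * \<phi> g) = (\<Sum>\<phi>\<in>{\<psi>}. \<phi> g)"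
        using F(1) by (intro sum.mono_neutral_cong_right) auto
      also have "\<dots> = \<psi> g" by simp
      finally show "f g + \<psi> g = (\<Sum>\<phi>\<in>insert \<psi> F. c' \<phi> * \<phi> g)"
        unfolding c'_def F(3) distrib_right sum.distrib 1 by simp
    qed
    moreover have "finite (insert \<psi> F)" "insert \<psi> F \<subseteq> Cc_gen (sub H)"
      using F Cb_subset_Cc_gen[OF H] add by auto
    ultimately show ?case unfolding Cc_def by blast
  qed
qed

end

section \<open>The regular representations on functions supported on bisections\<close>

context lc_etale_groupoid
begin

abbreviation "reg f \<equiv> famop G (rho G f)"
abbreviation "S x \<equiv> src_fiber G x"

lemma rho_delta_eq:
  assumes g: "g \<in> arr"
  shows "rho_delta G f g k = (if k \<in> S (s g) then f (k \<odot> iv g) else 0)"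
proof (cases "k \<in> S (s g)")
  case True
  then have k: "k \<in> arr" "s k = s g" by (auto dest: src_fiberD)
  note d = div_in[OF k(1) g k(2)]
  have "(\<Sum>\<^sub>\<infinity>h\<in>S (r g). f h * delta (h \<odot> g) k) = (\<Sum>\<^sub>\<infinity>h\<in>{k \<odot> iv g}. f h * delta (h \<odot> g) k)"
  proof (rule infsum_cong_neutral)
    fix h assume h: "h \<in> S (r g) - {k \<odot> iv g}"
    then have "h \<odot> g \<noteq> k" using mul_eq_iff[of h g k] g by (auto dest: src_fiberD)
    then show "f h * delta (h \<odot> g) k = 0" by (auto simp: delta_def)
  qed (use d in \<open>auto intro: src_fiberI\<close>)
  then show ?thesis using True cancel(4)[OF k(1) g k(2)] by (simp add: rho_delta_def delta_def)
next
  case False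
  have "f h * delta (h \<odot> g) k = 0" if "h \<in> S (r g)" for h
    using that False mul_in[of h g] g by (auto simp: delta_def dest: src_fiberD intro: src_fiberI)
  then show ?thesis using False by (simp add: rho_delta_def infsum_0)
qed

lemma rho_eq:
  assumes "x \<in> units G" "\<xi> \<in> ell2 (S x)"
  shows "rho G f x \<xi> k = (if k \<in> S x then \<Sum>\<^sub>\<infinity>g\<in>S x. \<xi> g * f (k \<odot> iv g) else 0)"
proof -
  have "rho G f x \<xi> k = (\<Sum>\<^sub>\<infinity>g\<in>S x. \<xi> g * (if k \<in> S x then f (k \<odot> iv g) else 0))"
    unfolding rho_def using assms
    by (auto intro!: infsum_cong simp: rho_delta_eq src_fiberD)
  then show ?thesis by simp
qed

lemma rho_outside: "x \<notin> units G \<Longrightarrow> rho G f x = (\<lambda>_ _. 0)" "\<xi> \<notin> ell2 (S x) \<Longrightarrow> rho G f x \<xi> = (\<lambda>_. 0)"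
  by (auto simp: rho_def)

text \<open>Only the arrows \<open>k \<odot> iv g\<close> with range \<open>r k\<close> enter the
  sum, and \<open>u\<close> is the only arrow of \<open>W\<close> with this range. A single term
  survives, the one with \<open>g = iv u \<odot> k\<close>.\<close>

lemma rho_at:
  assumes W: "bisection G W" "\<forall>g. g \<notin> W \<longrightarrow> f g = 0" and x: "x \<in> units G" "\<xi> \<in> ell2 (S x)"
    and u: "u \<in> W" "k \<in> S x" "r u = r k"
  shows "rho G f x \<xi> k = f u * \<xi> (iv u \<odot> k)"
proof -
  note W' = bisectionD[OF W(1)]
  have ua: "u \<in> arr" using W' u by blast
  have k: "k \<in> arr" "s k = x" using u by (auto dest: src_fiberD)
  have l: "iv u \<odot> k \<in> S x" using ldiv_in[of k u] ua k u(3) by (auto intro: src_fiberI)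
  have "(\<Sum>\<^sub>\<infinity>g\<in>S x. \<xi> g * f (k \<odot> iv g)) = (\<Sum>\<^sub>\<infinity>g\<in>{iv u \<odot> k}. \<xi> g * f (k \<odot> iv g))"
  proof (rule infsum_cong_neutral)
    fix g assume g: "g \<in> S x - {iv u \<odot> k}"
    then have ga: "g \<in> arr" "s g = x" by (auto dest: src_fiberD)
    have "k \<odot> iv g \<noteq> u" using div_eq_iff[of k g u] g ga k ua u(3) by auto
    then have "k \<odot> iv g \<notin> W"
      using inj_onD[OF W'(2), of "k \<odot> iv g" u] u div_in(2)[of k g] k ga by auto
    then show "\<xi> g * f (k \<odot> iv g) = 0" using W(2) by simp
  qed (use l in auto)
  also have "k \<odot> iv (iv u \<odot> k) = u"
    using div_eq_iff[of k "iv u \<odot> k" u] src_fiberD[OF l] k ua u(3) by simp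
  then have "(\<Sum>\<^sub>\<infinity>g\<in>{iv u \<odot> k}. \<xi> g * f (k \<odot> iv g)) = f u * \<xi> (iv u \<odot> k)" by simp
  finally show ?thesis using rho_eq[OF x] u(2) by simp
qed

lemma rho_not:
  assumes W: "bisection G W" "\<forall>g. g \<notin> W \<longrightarrow> f g = 0" and x: "x \<in> units G" "\<xi> \<in> ell2 (S x)"
    and k: "k \<in> S x \<Longrightarrow> r k \<notin> r ` W"
  shows "rho G f x \<xi> k = 0"
proof (cases "k \<in> S x")
  case True
  have "\<xi> g * f (k \<odot> iv g) = 0" if "g \<in> S x" for g
  proof -
    have "r (k \<odot> iv g) = r k" using that True by (intro div_in) (auto dest: src_fiberD)
    then have "k \<odot> iv g \<notin> W" using k[OF True] by (metis imageI)
    then show ?thesis using W(2) by simp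
  qed
  then show ?thesis using rho_eq[OF x, of f k] by (simp add: infsum_0)
qed (simp add: rho_eq[OF x])

text \<open>A partial bijection of each source fibre, inverse to left translation by the bisection \<open>W\<close>.\<close>

definition transl :: "'a set \<Rightarrow> 'a \<Rightarrow> 'a" where
  "transl W k = iv (rsec W (r k)) \<odot> k"

definition trdom :: "'a set \<Rightarrow> 'a \<Rightarrow> 'a set" where
  "trdom W x = {k \<in> S x. r k \<in> r ` W}"

lemma transl_in:
  assumes W: "bisection G W" and k: "k \<in> arr" "r k \<in> r ` W"
  shows "rsec W (r k) \<in> W" "rsec W (r k) \<in> arr" "r (rsec W (r k)) = r k"
    "transl W k \<in> arr" "s (transl W k) = s k" "r (transl W k) = s (rsec W (r k))"
    "rsec W (r k) \<odot> transl W k = k"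
proof -
  show 1: "rsec W (r k) \<in> W" "r (rsec W (r k)) = r k" using rsec[OF W] k by auto
  then show 2: "rsec W (r k) \<in> arr" using bisectionD[OF W] by blast
  show "transl W k \<in> arr" "s (transl W k) = s k" "r (transl W k) = s (rsec W (r k))"
    unfolding transl_def using 1 2 k by (simp_all add: ldiv_in)
  show "rsec W (r k) \<odot> transl W k = k"
    unfolding transl_def using 1 2 k by (simp add: cancel)
qed

lemma iv_iv_image: "W \<subseteq> arr \<Longrightarrow> iv ` iv ` W = W"
  using inv_inv by force

lemma transl_transl:
  assumes W: "bisection G W" and k: "k \<in> arr" "r k \<in> r ` W"
  shows "r (transl W k) \<in> r ` iv ` W" "rsec (iv ` W) (r (transl W k)) = iv (rsec W (r k))"
    "transl (iv ` W) (transl W k) = k"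
proof -
  note t = transl_in[OF W k]
  have 1: "r (transl W k) = r (iv (rsec W (r k)))" using t by (simp add: rng_iv)
  then show "r (transl W k) \<in> r ` iv ` W" using t by blast
  show 2: "rsec (iv ` W) (r (transl W k)) = iv (rsec W (r k))"
    unfolding 1 using t by (intro rsec bisection_iv W) auto
  show "transl (iv ` W) (transl W k) = k"
    unfolding transl_def[of "iv ` W"] 2 using t by (simp add: inv_inv)
qed

lemma bij_transl:
  assumes W: "bisection G W"
  shows "bij_betw (transl W) (trdom W x) (trdom (iv ` W) x)"
proof (rule bij_betw_byWitness[where f' = "transl (iv ` W)"])
  have ii: "iv ` iv ` W = W" by (rule iv_iv_image[OF bisectionD(1)[OF W]])
  note iW = bisection_iv[OF W]
  show "\<forall>k\<in>trdom W x. transl (iv ` W) (transl W k) = k"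
    using transl_transl(3)[OF W] by (auto simp: trdom_def src_fiber_def)
  show "\<forall>k\<in>trdom (iv ` W) x. transl W (transl (iv ` W) k) = k"
    using transl_transl(3)[OF iW] unfolding ii by (auto simp: trdom_def src_fiber_def)
  have sub: "transl V ` trdom V x \<subseteq> trdom (iv ` V) x" if V: "bisection G V" for V
  proof
    fix l assume "l \<in> transl V ` trdom V x"
    then obtain k where k: "k \<in> arr" "r k \<in> r ` V" "s k = x" and l: "l = transl V k"
      unfolding trdom_def src_fiber_def by blast
    show "l \<in> trdom (iv ` V) x"
      using transl_transl(1)[OF V k(1,2)] transl_in(4,5)[OF V k(1,2)] k(3)
      unfolding l trdom_def src_fiber_def by simp
  qed
  show "transl W ` trdom W x \<subseteq> trdom (iv ` W) x" by (rule sub[OF W])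
  show "transl (iv ` W) ` trdom (iv ` W) x \<subseteq> trdom W x" using sub[OF iW] unfolding ii .
qed

lemma rho_transl:
  assumes W: "bisection G W" "\<forall>g. g \<notin> W \<longrightarrow> f g = 0" and x: "x \<in> units G" "\<xi> \<in> ell2 (S x)"
  shows "rho G f x \<xi> k = (if k \<in> trdom W x then f (rsec W (r k)) * \<xi> (transl W k) else 0)"
proof (cases "k \<in> trdom W x")
  case True
  then have k: "k \<in> S x" "k \<in> arr" "r k \<in> r ` W" by (auto simp: trdom_def src_fiber_def)
  show ?thesis using rho_at[OF W x, where u = "rsec W (r k)" and k = k] transl_in[OF W(1) k(2,3)] k(1) True
    by (simp add: transl_def)
next
  case False
  then have "rho G f x \<xi> k = 0" by (intro rho_not[OF W x]) (simp add: trdom_def)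
  then show ?thesis using False by simp
qed

text \<open>On each fibre the operator is a partial permutation with weights bounded by
  \<open>M\<close>; reindexing along \<open>transl W\<close> gives the norm bound.\<close>

lemma rho_Cb_norm:
  assumes W: "bisection G W" "\<forall>g. g \<notin> W \<longrightarrow> f g = 0" and x: "x \<in> units G" "\<xi> \<in> ell2 (S x)"
    and M: "0 \<le> M" "\<And>g. cmod (f g) \<le> M"
  shows "rho G f x \<xi> \<in> ell2 (S x)" "ell2_norm (S x) (rho G f x \<xi>) \<le> M * ell2_norm (S x) \<xi>"
proof -
  let ?D = "trdom W x" and ?E = "trdom (iv ` W) x"
  let ?F = "\<lambda>k. (cmod (rho G f x \<xi> k))\<^sup>2"
  have \<xi>S: "(\<lambda>g. (cmod (\<xi> g))\<^sup>2) summable_on S x" using x(2) by (simp add: ell2_def)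
  have DS: "?D \<subseteq> S x" "?E \<subseteq> S x" by (auto simp: trdom_def)
  have \<xi>E: "(\<lambda>g. M\<^sup>2 * (cmod (\<xi> g))\<^sup>2) summable_on ?E"
    by (intro summable_on_cmult_right summable_on_subset_banach[OF \<xi>S] DS)
  have \<xi>D: "(\<lambda>k. M\<^sup>2 * (cmod (\<xi> (transl W k)))\<^sup>2) summable_on ?D"
    using \<xi>E by (rule summable_on_reindex_bij_betw[OF bij_transl[OF W(1)], THEN iffD2])
  have le: "?F k \<le> M\<^sup>2 * (cmod (\<xi> (transl W k)))\<^sup>2" if "k \<in> ?D" for k
    using that M(2) by (simp add: rho_transl[OF W x] norm_mult power_mult_distrib mult_right_mono power_mono)
  have FD: "?F summable_on ?D"
    by (rule summable_on_comparison_test[OF \<xi>D]) (use le in auto)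
  have zero: "?F k = 0" if "k \<notin> ?D" for k using that by (simp add: rho_transl[OF W x])
  have "?F summable_on S x \<longleftrightarrow> ?F summable_on ?D"
    by (rule summable_on_cong_neutral) (use zero DS in auto)
  then have FS: "?F summable_on S x" using FD by simp
  then show "rho G f x \<xi> \<in> ell2 (S x)"
    by (auto simp: ell2_def rho_eq[OF x])
  have "(\<Sum>\<^sub>\<infinity>k\<in>S x. ?F k) = (\<Sum>\<^sub>\<infinity>k\<in>?D. ?F k)"
    by (rule infsum_cong_neutral) (use zero DS in auto)
  also have "\<dots> \<le> (\<Sum>\<^sub>\<infinity>k\<in>?D. M\<^sup>2 * (cmod (\<xi> (transl W k)))\<^sup>2)"
    by (rule infsum_mono[OF FD \<xi>D le])
  also have "\<dots> = (\<Sum>\<^sub>\<infinity>g\<in>?E. M\<^sup>2 * (cmod (\<xi> g))\<^sup>2)"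
    by (rule infsum_reindex_bij_betw[OF bij_transl[OF W(1)]])
  also have "\<dots> \<le> (\<Sum>\<^sub>\<infinity>g\<in>S x. M\<^sup>2 * (cmod (\<xi> g))\<^sup>2)"
    by (rule infsum_mono_neutral[OF \<xi>E summable_on_cmult_right[OF \<xi>S]]) (use DS in auto)
  also have "\<dots> = M\<^sup>2 * (\<Sum>\<^sub>\<infinity>g\<in>S x. (cmod (\<xi> g))\<^sup>2)"
    by (rule infsum_cmult_right) (use \<xi>S in simp)
  finally have "sqrt (\<Sum>\<^sub>\<infinity>k\<in>S x. ?F k) \<le> sqrt (M\<^sup>2 * (\<Sum>\<^sub>\<infinity>g\<in>S x. (cmod (\<xi> g))\<^sup>2))" by simp
  then show "ell2_norm (S x) (rho G f x \<xi>) \<le> M * ell2_norm (S x) \<xi>"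
    using M(1) by (simp add: ell2_norm_def real_sqrt_mult)
qed

lemma rho_Cb_op:
  assumes f: "f \<in> Cb H" and M: "0 \<le> M" "\<And>g. cmod (f g) \<le> M"
  shows "rho G f \<in> op_families G" "norm (reg f x) \<le> M"
proof -
  obtain W K where "W \<subseteq> H" "supported W K f" using f by (rule CbE)
  note W = supportedD(2,7)[OF this(2)]
  note norm = rho_Cb_norm[OF W _ _ M]
  have bd: "rho G f x \<in> bounded_ops (S x)" for x
  proof (cases "x \<in> units G")
    case x: True
    show ?thesis
    proof (rule bounded_opsI[where C = M])
      fix \<xi> assume \<xi>: "\<xi> \<in> ell2 (S x)"
      show "rho G f x \<xi> \<in> ell2 (S x)" "ell2_norm (S x) (rho G f x \<xi>) \<le> M * ell2_norm (S x) \<xi>"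
        by (rule norm[OF x \<xi>])+
      show "rho G f x (\<lambda>g. \<xi> g + \<eta> g) = (\<lambda>g. rho G f x \<xi> g + rho G f x \<eta> g)" if \<eta>: "\<eta> \<in> ell2 (S x)" for \<eta>
        by (rule ext) (simp add: rho_transl[OF W x] \<xi> \<eta> ell2_add distrib_left)
      show "rho G f x (\<lambda>g. c * \<xi> g) = (\<lambda>g. c * rho G f x \<xi> g)" for c
        by (rule ext) (simp add: rho_transl[OF W x] \<xi> ell2_scale)
    qed (use M(1) rho_outside(2) in auto)
  next
    case False
    then show ?thesis by (simp add: rho_outside zero_bounded_ops)
  qed
  show n: "norm (reg f x) \<le> M" for x
  proof (cases "x \<in> units G")
    case True
    then show ?thesis using norm_bop_of_le_iff[OF bd M(1)] op_normI[OF norm(2) M(1)] by (simp add: famop_def)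
  next
    case False
    then show ?thesis using M by (simp add: famop_def rho_outside bop_of_zero)
  qed
  show "rho G f \<in> op_families G" by (rule op_familiesI[OF bd _ n]) (rule rho_outside)
qed

lemma Cb_finite_support:
  assumes f: "f \<in> Cb H" and k: "k \<in> arr"
  shows "finite {g \<in> S (s k). f (k \<odot> iv g) \<noteq> 0}"
proof -
  obtain W K where "W \<subseteq> H" "supported W K f" using f by (rule CbE)
  note W = supportedD(2,7)[OF this(2)]
  have "{g \<in> S (s k). f (k \<odot> iv g) \<noteq> 0} \<subseteq> {iv (rsec W (r k)) \<odot> k}"
  proof (clarify)
    fix g assume g: "g \<in> S (s k)" and "f (k \<odot> iv g) \<noteq> 0"
    then have w: "k \<odot> iv g \<in> W" using W(2) by blast
    have ga: "g \<in> arr" "s k = s g" using g by (auto dest: src_fiberD)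
    have "r (k \<odot> iv g) = r k" using k ga by (simp add: div_in)
    then have "rsec W (r k) = k \<odot> iv g" using rsec(1)[OF W(1) w] by simp
    then show "g = iv (rsec W (r k)) \<odot> k"
      using div_eq_iff[of k g "k \<odot> iv g"] k ga by (simp add: div_in)
  qed
  then show ?thesis by (rule finite_subset) simp
qed

lemma fsums_finite_support:
  assumes "f \<in> fsums (Cb H)" and k: "k \<in> arr"
  shows "finite {g \<in> S (s k). f (k \<odot> iv g) \<noteq> 0}"
  using assms(1)
proof (induction rule: fsums.induct)
  case (add f \<phi>)
  have "{g \<in> S (s k). f (k \<odot> iv g) + \<phi> (k \<odot> iv g) \<noteq> 0}
      \<subseteq> {g \<in> S (s k). f (k \<odot> iv g) \<noteq> 0} \<union> {g \<in> S (s k). \<phi> (k \<odot> iv g) \<noteq> 0}" by auto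
  then show ?case using add.IH Cb_finite_support[OF add.hyps(2) k] by (meson finite_UnI finite_subset)
qed simp

text \<open>Only finitely many terms are nonzero, whatever \<open>\<xi>\<close> is. This yields
  additivity of \<open>rho\<close> in the function, coordinate by coordinate and before any norm
  bound for sums is available.\<close>

lemma rho_summable:
  assumes "f \<in> fsums (Cb H)" and k: "k \<in> S x"
  shows "(\<lambda>g. \<xi> g * f (k \<odot> iv g)) summable_on S x"
proof (rule finite_nonzero_values_imp_summable_on)
  have "k \<in> arr" "s k = x" using k by (auto dest: src_fiberD)
  then have "finite {g \<in> S x. f (k \<odot> iv g) \<noteq> 0}" using fsums_finite_support[OF assms(1), of k] by simp
  then show "finite {g \<in> S x. \<xi> g * f (k \<odot> iv g) \<noteq> 0}" by (rule rev_finite_subset) auto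
qed

lemma rho_add:
  assumes "f \<in> fsums (Cb H)" "h \<in> fsums (Cb H')"
  shows "rho G (\<lambda>g. f g + h g) = fam_add (rho G f) (rho G h)"
proof (intro ext)
  fix x \<xi> k
  show "rho G (\<lambda>g. f g + h g) x \<xi> k = fam_add (rho G f) (rho G h) x \<xi> k"
  proof (cases "x \<in> units G \<and> \<xi> \<in> ell2 (S x) \<and> k \<in> S x")
    case True
    then show ?thesis
      by (simp add: fam_add_def rho_eq distrib_left infsum_add rho_summable[OF assms(1)] rho_summable[OF assms(2)])
  next
    case False
    then show ?thesis
      by (cases "x \<in> units G"; cases "\<xi> \<in> ell2 (S x)") (auto simp: fam_add_def rho_eq rho_outside)
  qed
qed

lemma rho_zero: "rho G (\<lambda>_. 0) = fam_zero"
  by (intro ext) (simp add: rho_def rho_delta_def fam_zero_def)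

lemma fam_add_in: "a \<in> op_families G \<Longrightarrow> b \<in> op_families G \<Longrightarrow> fam_add a b \<in> op_families G"
  using fam_linear_combination(1)[of a G b 1] by (simp add: fam_add_def)

lemma rho_op: "f \<in> fsums (Cb H) \<Longrightarrow> rho G f \<in> op_families G"
proof (induction rule: fsums.induct)
  case zero
  then show ?case by (simp add: rho_zero fam_zero_op)
next
  case (add f \<phi>)
  obtain M where "0 \<le> M" "\<And>g. cmod (\<phi> g) \<le> M" using Cb_bounded[OF add.hyps(2)] by blast
  then have "rho G \<phi> \<in> op_families G" by (rule rho_Cb_op[OF add.hyps(2)])
  then show ?case using add by (simp add: rho_add[OF _ fsums_base] fam_add_in)
qed

lemma famop_rho_add:
  assumes "f \<in> fsums (Cb H)" "h \<in> fsums (Cb H')"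
  shows "reg (\<lambda>g. f g + h g) x = reg f x + reg h x"
  by (simp add: rho_add[OF assms] fam_add_op rho_op[OF assms(1)] rho_op[OF assms(2)])

lemma famop_rho_zero: "reg (\<lambda>_. 0) x = 0"
  by (simp add: rho_zero fam_zero_op)

end

section \<open>Products and adjoints in the regular representations\<close>

lemma inner_cnj_mult: "inner (z * a) b = inner a (cnj z * b)" for z a b :: complex
  by (simp add: inner_complex_def algebra_simps)

context lc_etale_groupoid
begin

lemma openin_rng_preimage: "openin TG U \<Longrightarrow> openin TG {k \<in> arr. r k \<in> U}"
proof -
  have "continuous_map TG TG r" using continuous_map_rng by (simp add: unit_top_def continuous_map_in_subtopology)
  then show "openin TG U \<Longrightarrow> openin TG {k \<in> arr. r k \<in> U}" using openin_continuous_map_preimage by fastforce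
qed

lemma openin_src_preimage: "openin TG U \<Longrightarrow> openin TG {k \<in> arr. s k \<in> U}"
proof -
  have "continuous_map TG TG s" using continuous_map_src by (simp add: unit_top_def continuous_map_in_subtopology)
  then show "openin TG U \<Longrightarrow> openin TG {k \<in> arr. s k \<in> U}" using openin_continuous_map_preimage by fastforce
qed

lemma continuous_rsec_rng:
  assumes W: "openin TG W" "bisection G W" and D: "D \<subseteq> {k \<in> arr. r k \<in> r ` W}"
  shows "continuous_map (sub D) TG (\<lambda>k. rsec W (r k))"
    and "continuous_map (sub D) TG (transl W)"
proof -
  have "continuous_map (sub D) (subtopology (unit_top G) (r ` W)) r"
    by (intro continuous_map_into_subtopology continuous_map_from_subtopology continuous_map_rng) (use D in auto)
  from continuous_map_compose[OF this continuous_rsec[OF W]]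
  show 1: "continuous_map (sub D) TG (\<lambda>k. rsec W (r k))" by (simp add: o_def)
  have t: "s (iv (rsec W (r k))) = r k" if "k \<in> D" for k
    using transl_in[OF W(2), of k] that D by (auto simp: src_iv)
  show "continuous_map (sub D) TG (transl W)"
    unfolding transl_def[abs_def]
    by (intro continuous_map_mul continuous_map_iv 1 continuous_map_from_subtopology[OF continuous_map_id[unfolded id_def]])
      (use t in auto)
qed

text \<open>The convolution of functions on two bisections lives on the bisection of all products
  \<open>u \<odot> v\<close>. The factorisation of such a \<open>k\<close> is unique,
  \<open>u = rsec W1 (r k)\<close> and \<open>v = transl W1 k\<close>, so the convolution sum
  reduces to the single term that defines \<open>h\<close>.\<close>

lemma Cb_mult:
  assumes H: "open_subgroupoid G H" and f: "f \<in> Cb H" and \<phi>: "\<phi> \<in> Cb H"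
  shows "\<exists>h \<in> Cb H. rho G h = fam_mult (rho G f) (rho G \<phi>)"
proof -
  obtain W1 K1 where W1H: "W1 \<subseteq> H" and "supported W1 K1 f" using f by (rule CbE)
  note f = supportedD[OF this(2)]
  obtain W2 K2 where W2H: "W2 \<subseteq> H" and "supported W2 K2 \<phi>" using \<phi> by (rule CbE)
  note p = supportedD[OF this(2)]
  note f0 = f(7) and p0 = p(7)
  define D where "D = {k \<in> arr. r k \<in> r ` W1}"
  define W where "W = {k \<in> D. transl W1 k \<in> W2}"
  define h where "h k = (if k \<in> W then f (rsec W1 (r k)) * \<phi> (transl W1 k) else 0)" for k
  have arrD: "k \<in> arr" "r k \<in> r ` W1" if "k \<in> D" for k using that by (auto simp: D_def)
  note t = transl_in[OF f(2) arrD]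
  have oD: "openin TG D" unfolding D_def by (intro openin_rng_preimage openin_rng_image f(1))
  have WD: "W \<subseteq> D" by (auto simp: W_def)
  have Warr: "W \<subseteq> arr" using WD arrD by blast
  have oW: "openin TG W"
  proof -
    have "continuous_map (sub D) TG (transl W1)"
      by (rule continuous_rsec_rng[OF f(1,2)]) (simp add: D_def)
    then have "openin (sub D) {k \<in> topspace (sub D). transl W1 k \<in> W2}"
      using p(1) by (rule openin_continuous_map_preimage)
    also have "{k \<in> topspace (sub D). transl W1 k \<in> W2} = W" using arrD by (auto simp: W_def)
    finally show ?thesis using oD by (simp add: openin_open_subtopology)
  qed
  have uv: "\<exists>u\<in>W1. \<exists>v\<in>W2. s u = r v \<and> k = u \<odot> v \<and> u = rsec W1 (r k) \<and> v = transl W1 k" if "k \<in> W" for k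
    using that t[of k] by (intro bexI[of _ "rsec W1 (r k)"] bexI[of _ "transl W1 k"]) (auto simp: W_def)
  have W12: "W1 \<subseteq> arr" "W2 \<subseteq> arr" using bisectionD f(2) p(2) by blast+
  have prodW: "u \<odot> v \<in> W" "rsec W1 (r (u \<odot> v)) = u" "transl W1 (u \<odot> v) = v"
    if "u \<in> W1" "v \<in> W2" "s u = r v" for u v
  proof -
    have a: "u \<in> arr" "v \<in> arr" using that W12 by auto
    have rr: "r (u \<odot> v) = r u" using a that by (simp add: mul_in)
    show 1: "rsec W1 (r (u \<odot> v)) = u" unfolding rr by (rule rsec(1)[OF f(2) that(1)])
    show 2: "transl W1 (u \<odot> v) = v" unfolding transl_def 1 using a that by (simp add: cancel)
    show "u \<odot> v \<in> W" unfolding W_def D_def using a that 2 by (auto simp: rr mul_in)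
  qed
  have WH: "W \<subseteq> H"
  proof
    fix k assume "k \<in> W"
    then obtain u v where "u \<in> W1" "v \<in> W2" "s u = r v" "k = u \<odot> v" using uv by blast
    moreover have "\<forall>(g, h) \<in> composable G \<inter> H \<times> H. g \<odot> h \<in> H" using H by (simp add: open_subgroupoid_def)
    ultimately show "k \<in> H" using W1H W2H W12 composableI by blast
  qed
  have bW: "bisection G W"
  proof (rule bisectionI[OF Warr])
    have v_eq: "transl W1 k = transl W1 k' \<Longrightarrow> rsec W1 (r k) = rsec W1 (r k') \<Longrightarrow> k = k'" if "k \<in> W" "k' \<in> W" for k k'
      using uv[OF that(1)] uv[OF that(2)] by auto
    show "inj_on r W"
    proof (rule inj_onI)
      fix k k' assume k: "k \<in> W" "k' \<in> W" "r k = r k'"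
      have "k \<in> D" "k' \<in> D" using k WD by auto
      then have "r (transl W1 k) = r (transl W1 k')" using t(6)[of k] t(6)[of k'] k(3) by simp
      then have "transl W1 k = transl W1 k'"
        by (rule inj_onD[OF bisectionD(2)[OF p(2)]]) (use k in \<open>auto simp: W_def\<close>)
      then show "k = k'" using v_eq k by simp
    qed
    show "inj_on s W"
    proof (rule inj_onI)
      fix k k' assume k: "k \<in> W" "k' \<in> W" "s k = s k'"
      have kD: "k \<in> D" "k' \<in> D" using k WD by auto
      then have "s (transl W1 k) = s (transl W1 k')" using t(5)[of k] t(5)[of k'] k(3) by simp
      then have v: "transl W1 k = transl W1 k'"
        by (rule inj_onD[OF bisectionD(3)[OF p(2)]]) (use k in \<open>auto simp: W_def\<close>)
      then have "s (rsec W1 (r k)) = s (rsec W1 (r k'))" using t(6)[of k] t(6)[of k'] kD by simp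
      then have "rsec W1 (r k) = rsec W1 (r k')"
        by (rule inj_onD[OF bisectionD(3)[OF f(2)]]) (use t(1) WD k in auto)
      then show "k = k'" using v_eq v k by simp
    qed
  qed
  have hW: "\<forall>g. g \<notin> W \<longrightarrow> h g = 0" by (simp add: h_def)
  define K where "K = (\<lambda>(g, h). g \<odot> h) ` (composable G \<inter> K1 \<times> K2)"
  have "h \<in> Cb H"
  proof (rule CbI[OF oW WH bW])
    let ?P = "prod_topology TG TG"
    \<comment> \<open>The composable pairs form the equaliser of two maps into the Hausdorff unit
      space, hence a closed set. So the set of products of the two supports is compact even if
      \<open>G\<close> is not Hausdorff.\<close>
    have "closedin ?P {z \<in> topspace ?P. (s \<circ> fst) z = (r \<circ> snd) z}"
      by (rule closedin_continuous_maps_eq[OF Hausdorff_units])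
        (intro continuous_map_compose[OF continuous_map_fst continuous_map_src] continuous_map_compose[OF continuous_map_snd continuous_map_rng])+
    also have "{z \<in> topspace ?P. (s \<circ> fst) z = (r \<circ> snd) z} = composable G" by (auto simp: composable_def)
    finally have "compactin ?P (composable G \<inter> K1 \<times> K2)"
      by (rule closed_Int_compactin) (simp add: compactin_Times f(4) p(4))
    then have "compactin (subtopology ?P (composable G)) (composable G \<inter> K1 \<times> K2)" by (simp add: compactin_subtopology)
    then show "compactin TG K" unfolding K_def using continuous_mul by (rule image_compactin)
    show "K \<subseteq> W" unfolding K_def using f(3) p(3) by (auto simp: composable_def intro!: prodW(1))
    show "h k = 0" if "k \<notin> K" for k
    proof (rule ccontr)
      assume "h k \<noteq> 0"
      then have k: "k \<in> W" "f (rsec W1 (r k)) \<noteq> 0" "\<phi> (transl W1 k) \<noteq> 0" by (auto simp: h_def split: if_splits)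
      then have "rsec W1 (r k) \<in> K1" "transl W1 k \<in> K2" using f(5) p(5) by blast+
      moreover have kD: "k \<in> D" using k(1) WD by blast
      then have "(rsec W1 (r k), transl W1 k) \<in> composable G" "k = rsec W1 (r k) \<odot> transl W1 k"
        using t(2,4,6,7)[of k] by (auto intro: composableI)
      ultimately have "k \<in> K" unfolding K_def
        by (intro image_eqI[of _ _ "(rsec W1 (r k), transl W1 k)"]) (simp_all only: prod.case Int_iff mem_Times_iff fst_conv snd_conv)
      then show False using that by blast
    qed
    have c1: "continuous_map (sub W) (sub W1) (\<lambda>k. rsec W1 (r k))"
      by (intro continuous_map_into_subtopology continuous_rsec_rng[OF f(1,2)]) (use WD t(1) in \<open>auto simp: D_def\<close>)
    have c2: "continuous_map (sub W) (sub W2) (transl W1)"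
      by (intro continuous_map_into_subtopology continuous_rsec_rng[OF f(1,2)]) (use WD in \<open>auto simp: D_def W_def\<close>)
    have "continuous_map (sub W) euclidean (\<lambda>k. f (rsec W1 (r k)) * \<phi> (transl W1 k))"
      using continuous_map_compose[OF c1 f(6)] continuous_map_compose[OF c2 p(6)]
      by (intro continuous_map_complex) (simp_all add: o_def)
    then show "continuous_map (sub W) euclidean h"
      by (rule continuous_map_eq) (simp add: h_def)
  qed
  moreover have "rho G h = fam_mult (rho G f) (rho G \<phi>)"
  proof (intro ext)
    fix x \<xi> k
    show "rho G h x \<xi> k = fam_mult (rho G f) (rho G \<phi>) x \<xi> k"
    proof (cases "x \<in> units G \<and> \<xi> \<in> ell2 (S x)")
      case True
      then have x: "x \<in> units G" "\<xi> \<in> ell2 (S x)" by auto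
      obtain M where M: "0 \<le> M" "\<And>g. cmod (\<phi> g) \<le> M" using Cb_bounded[OF assms(3)] by blast
      have \<eta>: "rho G \<phi> x \<xi> \<in> ell2 (S x)" by (rule rho_Cb_norm(1)[OF p(2) p0 x M])
      show ?thesis
      proof (cases "k \<in> S x \<and> r k \<in> r ` W1 \<and> r (transl W1 k) \<in> r ` W2")
        case True
        then have k: "k \<in> S x" "k \<in> arr" "s k = x" "r k \<in> r ` W1" by (auto dest: src_fiberD)
        \<comment> \<open>Here \<open>k = u \<odot> v \<odot> l\<close> with \<open>u\<close> in
          \<open>W1\<close> and \<open>v\<close> in \<open>W2\<close>, and both sides equal
          \<open>f u * \<phi> v * \<xi> l\<close>. In the remaining case both sides vanish.\<close>
        define u where "u = rsec W1 (r k)"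
        define v0 where "v0 = transl W1 k"
        define v where "v = rsec W2 (r v0)"
        define l where "l = transl W2 v0"
        note tk = transl_in[OF f(2) k(2,4), folded u_def v0_def]
        have v0: "v0 \<in> arr" "r v0 \<in> r ` W2" "v0 \<in> S x" 
          using tk(4,5) k(3) True src_fiberI unfolding v0_def by simp_all
        note tv = transl_in[OF p(2) v0(1,2), folded v_def l_def]
        have suv: "s u = r v" unfolding tv(3) tk(6) ..
        note w = prodW[OF tk(1) tv(1) suv]
        note uvin = mul_in[OF tk(2) tv(2) suv]
        have "u \<odot> v \<odot> l = u \<odot> (v \<odot> l)" by (rule assoc[OF tk(2) tv(2,4) suv tv(6)[symmetric]])
        also have "\<dots> = k" unfolding tv(7) tk(7) ..
        finally have uvl: "u \<odot> v \<odot> l = k" .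
        have "s (u \<odot> v) = r l" unfolding uvin(3) tv(6) ..
        from cancel(1)[OF uvin(1) tv(4) this] have ivw: "iv (u \<odot> v) \<odot> k = l" unfolding uvl .
        have ruv: "r (u \<odot> v) = r k" unfolding uvin(2) tk(3) ..
        have "rho G h x \<xi> k = h (u \<odot> v) * \<xi> (iv (u \<odot> v) \<odot> k)"
          by (rule rho_at[OF bW hW x w(1) k(1) ruv])
        also have "\<dots> = f u * (\<phi> v * \<xi> l)" using w by (simp add: h_def ivw)
        also have "\<phi> v * \<xi> l = rho G \<phi> x \<xi> v0"
          unfolding rho_at[OF p(2) p0 x tv(1) v0(3) tv(3)] by (simp only: l_def transl_def v_def)
        also have "f u * rho G \<phi> x \<xi> v0 = rho G f x (rho G \<phi> x \<xi>) k"
          unfolding rho_at[OF f(2) f0 x(1) \<eta> tk(1) k(1) tk(3)] by (simp only: v0_def transl_def u_def)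
        finally show ?thesis by (simp add: fam_mult_def)
      next
        case False
        have "rho G h x \<xi> k = 0"
        proof (rule rho_not[OF bW hW x])
          assume kS: "k \<in> S x"
          show "r k \<notin> r ` W"
          proof
            assume "r k \<in> r ` W"
            then obtain w where w: "w \<in> W" "r k = r w" by blast
            have wD: "w \<in> D" using w WD by blast
            have ka: "k \<in> arr" using kS by (rule src_fiberD)
            have k1: "r k \<in> r ` W1" using arrD[OF wD] w(2) by simp
            have "r (transl W1 k) = r (transl W1 w)"
              using transl_in(6)[OF f(2) ka k1] t(6)[OF wD wD] w(2) by simp
            moreover have "transl W1 w \<in> W2" using w(1) by (simp add: W_def)
            ultimately show False using False kS k1 by auto
          qed
        qed
        moreover have "rho G f x (rho G \<phi> x \<xi>) k = 0"
        proof (cases "k \<in> trdom W1 x")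
          case True
          then have k: "k \<in> S x" "r k \<in> r ` W1" by (auto simp: trdom_def)
          then have "rho G \<phi> x \<xi> (transl W1 k) = 0" using False by (intro rho_not[OF p(2) p0 x]) blast
          then show ?thesis by (simp add: rho_transl[OF f(2) f0 x(1) \<eta>])
        qed (simp add: rho_transl[OF f(2) f0 x(1) \<eta>])
        ultimately show ?thesis by (simp add: fam_mult_def)
      qed
    next
      case False
      have "rho G f x (\<lambda>_. 0) = (\<lambda>_. 0)" if "x \<in> units G"
        by (rule ext) (simp add: rho_transl[OF f(2) f0 that ell2_zero])
      then show ?thesis using False by (cases "x \<in> units G") (auto simp: fam_mult_def rho_outside)
    qed
  qed
  ultimately show ?thesis by blast
qed

text \<open>Bilinear extension by two inductions. Characterising the product through the regular
  representations avoids a convolution formula for sums of functions.\<close>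

lemma fsums_mult:
  assumes H: "open_subgroupoid G H" and f: "f \<in> fsums (Cb H)" and h: "h \<in> fsums (Cb H)"
  shows "\<exists>k \<in> fsums (Cb H). \<forall>x. reg k x = reg f x * reg h x"
  using f
proof (induction rule: fsums.induct)
  case zero
  show ?case by (intro bexI[OF _ fsums.zero]) (simp add: famop_rho_zero)
next
  case (add f \<phi>)
  have one: "\<exists>k \<in> fsums (Cb H). \<forall>x. reg k x = reg \<phi> x * reg h x"
    using h
  proof (induction rule: fsums.induct)
    case zero
    show ?case by (intro bexI[OF _ fsums.zero]) (simp add: famop_rho_zero)
  next
    case (add h \<psi>)
    then obtain k where k: "k \<in> fsums (Cb H)" "\<And>x. reg k x = reg \<phi> x * reg h x" by blast
    obtain l where l: "l \<in> Cb H" "rho G l = fam_mult (rho G \<phi>) (rho G \<psi>)"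
      using Cb_mult[OF H \<open>\<phi> \<in> Cb H\<close> \<open>\<psi> \<in> Cb H\<close>] by blast
    show ?case
    proof (intro bexI[OF _ fsums.add[OF k(1) l(1)]] allI)
      fix x
      have "reg (\<lambda>g. k g + l g) x = reg k x + reg l x"
        by (rule famop_rho_add[OF k(1) fsums_base[OF l(1)]])
      also have "reg l x = reg \<phi> x * reg \<psi> x"
        unfolding l(2) by (intro fam_mult_op rho_op[OF fsums_base]) fact+
      finally show "reg (\<lambda>g. k g + l g) x = reg \<phi> x * reg (\<lambda>g. h g + \<psi> g) x"
        by (simp add: k famop_rho_add[OF add.hyps(1) fsums_base[OF add.hyps(2)]] distrib_left)
    qed
  qed
  then obtain l where l: "l \<in> fsums (Cb H)" "\<And>x. reg l x = reg \<phi> x * reg h x" by blast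
  obtain k where k: "k \<in> fsums (Cb H)" "\<And>x. reg k x = reg f x * reg h x" using add.IH by blast
  show ?case
    by (intro bexI[OF _ fsums_add[OF l(1) k(1)]] allI)
      (simp add: k l famop_rho_add[OF k(1) l(1)] famop_rho_add[OF add.hyps(1) fsums_base[OF add.hyps(2)]] distrib_right)
qed

lemma famop_scale:
  assumes "f \<in> fsums (Cb H)"
  shows "\<exists>k \<in> fsums (Cb H). \<forall>x. reg k x = t *\<^sub>R reg f x"
proof (intro bexI allI)
  let ?k = "\<lambda>g. of_real t * f g"
  show k: "?k \<in> fsums (Cb H)"
    by (rule fsums_map[OF assms, where P = "\<lambda>f g. of_real t * f g"]) (auto intro: fsums_base Cb_scale simp: distrib_left)
  fix x
  have "rho G ?k = fam_scale (of_real t) (rho G f)"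
  proof (intro ext)
    fix x \<xi> k
    show "rho G ?k x \<xi> k = fam_scale (of_real t) (rho G f) x \<xi> k"
    proof (cases "x \<in> units G \<and> \<xi> \<in> ell2 (S x)")
      case True
      have "(\<Sum>\<^sub>\<infinity>g\<in>S x. \<xi> g * (of_real t * f (k \<odot> iv g))) = (\<Sum>\<^sub>\<infinity>g\<in>S x. of_real t * (\<xi> g * f (k \<odot> iv g)))"
        by (rule infsum_cong) simp
      also have "\<dots> = of_real t * (\<Sum>\<^sub>\<infinity>g\<in>S x. \<xi> g * f (k \<odot> iv g))" by (rule infsum_cmult_right')
      finally show ?thesis using True by (simp add: rho_eq fam_scale_def)
    next
      case False
      then show ?thesis by (cases "x \<in> units G") (auto simp: fam_scale_def rho_outside)
    qed
  qed
  then show "famop G (rho G ?k) x = t *\<^sub>R reg f x" by (simp add: fam_scale_op rho_op[OF assms])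
qed

text \<open>The witness is the usual adjoint \<open>cnj (f (iv g))\<close>, supported on the inverse
  bisection. The identity is a change of variables along \<open>transl W\<close>, whose inverse is
  the translation belonging to the inverse bisection.\<close>

lemma Cb_star:
  assumes H: "open_subgroupoid G H" and f: "f \<in> Cb H"
  shows "\<exists>h \<in> Cb H. \<forall>x \<xi> \<eta>. inner (app (reg f x) \<xi>) \<eta> = inner \<xi> (app (reg h x) \<eta>)"
proof -
  obtain W K where WH: "W \<subseteq> H" and "supported W K f" using f by (rule CbE)
  note W = supportedD[OF this(2)]
  note f0 = W(7)
  have Wa: "W \<subseteq> arr" using bisectionD W(2) by blast
  define h where "h g = (if g \<in> iv ` W then cnj (f (iv g)) else 0)" for g
  have h0: "\<forall>g. g \<notin> iv ` W \<longrightarrow> h g = 0" by (simp add: h_def)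
  have hC: "h \<in> Cb H"
  proof (rule CbI[OF openin_iv_image[OF W(1)] _ bisection_iv[OF W(2)]])
    show "iv ` W \<subseteq> H" using WH H by (auto simp: open_subgroupoid_def)
    show "iv ` K \<subseteq> iv ` W" using W(3) by blast
    show "compactin TG (iv ` K)" using W(4) continuous_inv by (rule image_compactin)
    show "h g = 0" if "g \<notin> iv ` K" for g
    proof (cases "g \<in> iv ` W")
      case True
      then obtain w where w: "w \<in> W" "g = iv w" by blast
      then have "w \<notin> K" "iv g = w" using that Wa inv_inv by auto
      then show ?thesis using W(5) by (simp add: h_def)
    qed (simp add: h_def)
    have "continuous_map (sub (iv ` W)) (sub W) iv"
      by (intro continuous_map_into_subtopology continuous_map_from_subtopology continuous_inv)
        (use Wa inv_inv in auto)
    from continuous_map_compose[OF this W(6)]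
    have "continuous_map (sub (iv ` W)) euclidean (\<lambda>g. cnj (f (iv g)))"
      by (intro continuous_map_complex) (simp add: o_def)
    then show "continuous_map (sub (iv ` W)) euclidean h"
      by (rule continuous_map_eq) (simp add: h_def)
  qed
  note fop = op_families_bounded[OF rho_op[OF fsums_base[OF f]]]
  note hop = op_families_bounded[OF rho_op[OF fsums_base[OF hC]]]
  have "inner (app (reg f x) \<xi>) \<eta> = inner \<xi> (app (reg h x) \<eta>)" for x \<xi> \<eta>
  proof (cases "x \<in> units G")
    case x: True
    let ?A = "trdom W x" and ?B = "trdom (iv ` W) x"
    note rf = rho_transl[OF W(2) f0 x restr_in] and rh = rho_transl[OF bisection_iv[OF W(2)] h0 x restr_in]
    define F where "F l = inner (coord \<xi> l) (h (rsec (iv ` W) (r l)) * restr (S x) \<eta> (transl (iv ` W) l))" for l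
    have "inner (app (reg f x) \<xi>) \<eta> = (\<Sum>\<^sub>\<infinity>k. inner (rho G f x (restr (S x) \<xi>) k) (coord \<eta> k))"
      by (simp add: inner_l2_def famop_def coord_bop_of[OF fop])
    also have "\<dots> = (\<Sum>\<^sub>\<infinity>k\<in>?A. F (transl W k))"
    proof (rule infsum_cong_neutral)
      fix k assume k: "k \<in> UNIV \<inter> ?A"
      then have k': "k \<in> arr" "r k \<in> r ` W" "k \<in> S x" "s k = x" by (auto simp: trdom_def src_fiber_def)
      note t = transl_in[OF W(2) k'(1,2)] and tt = transl_transl[OF W(2) k'(1,2)]
      have "h (iv (rsec W (r k))) = cnj (f (rsec W (r k)))" using t by (simp add: h_def inv_inv)
      moreover have "restr (S x) \<xi> (transl W k) = coord \<xi> (transl W k)" "restr (S x) \<eta> k = coord \<eta> k"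
        using t k' by (simp_all add: restr_def src_fiber_def)
      ultimately show "inner (rho G f x (restr (S x) \<xi>) k) (coord \<eta> k) = F (transl W k)"
        using tt k by (simp add: rf F_def inner_cnj_mult)
    qed (auto simp: rf)
    also have "\<dots> = (\<Sum>\<^sub>\<infinity>l\<in>?B. F l)" by (rule infsum_reindex_bij_betw[OF bij_transl[OF W(2)]])
    also have "\<dots> = (\<Sum>\<^sub>\<infinity>k. inner (coord \<xi> k) (rho G h x (restr (S x) \<eta>) k))"
      by (rule infsum_cong_neutral) (auto simp: rh F_def)
    also have "\<dots> = inner \<xi> (app (reg h x) \<eta>)"
      by (simp add: inner_l2_def famop_def coord_bop_of[OF hop])
    finally show ?thesis .
  next
    case False
    then show ?thesis using famop_outside[OF rho_op[OF fsums_base[OF f]]] famop_outside[OF rho_op[OF fsums_base[OF hC]]] by simp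
  qed
  then show ?thesis using hC by blast
qed

lemma fsums_star:
  assumes H: "open_subgroupoid G H" and f: "f \<in> fsums (Cb H)"
  shows "\<exists>h \<in> fsums (Cb H). \<forall>x \<xi> \<eta>. inner (app (reg f x) \<xi>) \<eta> = inner \<xi> (app (reg h x) \<eta>)"
  using f
proof (induction rule: fsums.induct)
  case zero
  show ?case by (intro bexI[OF _ fsums.zero]) (simp add: famop_rho_zero)
next
  case (add f \<phi>)
  obtain h where h: "h \<in> fsums (Cb H)" "\<And>x \<xi> \<eta>. inner (app (reg f x) \<xi>) \<eta> = inner \<xi> (app (reg h x) \<eta>)"
    using add.IH by blast
  obtain k where k: "k \<in> Cb H" "\<And>x \<xi> \<eta>. inner (app (reg \<phi> x) \<xi>) \<eta> = inner \<xi> (app (reg k x) \<eta>)"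
    using Cb_star[OF H add.hyps(2)] by blast
  show ?case
    by (intro bexI[OF _ fsums.add[OF h(1) k(1)]] allI)
      (simp add: famop_rho_add[OF h(1) fsums_base[OF k(1)]] famop_rho_add[OF add.hyps(1) fsums_base[OF add.hyps(2)]]
        inner_add_left inner_add_right h(2) k(2))
qed

end

section \<open>Cutting down to the subgroupoid\<close>

lemma fsums_mono: "f \<in> fsums D \<Longrightarrow> D \<subseteq> D' \<Longrightarrow> f \<in> fsums D'"
  by (induction rule: fsums.induct) (auto intro: fsums.intros)

text \<open>Spectrally: \<open>0 \<le> T \<le> 1\<close> puts \<open>T - \<delta>\<close> into the
  interval from \<open>- \<delta>\<close> to \<open>1 - \<delta>\<close>, and one minus its square
  into the unit interval. The hypotheses express \<open>T^2 \<le> T \<le> 1\<close> by quadratic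
  forms, and no spectrum is used.\<close>

lemma contraction_one_minus_square:
  assumes sym: "\<And>\<xi> \<eta>. inner (app T \<xi>) \<eta> = inner \<xi> (app T \<eta>)"
    and T: "\<And>\<xi>. (norm (app T \<xi>))\<^sup>2 \<le> inner (app T \<xi>) \<xi>" "\<And>\<xi>. inner (app T \<xi>) \<xi> \<le> (norm \<xi>)\<^sup>2"
    and \<delta>: "0 \<le> \<delta>" "\<delta> \<le> 1 / 2"
  shows "norm (1 - (T - of_real \<delta>) * (T - of_real \<delta>)) \<le> 1"
proof (rule norm_bop_le)
  fix \<xi>
  define R where "R = T - of_real \<delta>"
  have R: "app R \<xi> = app T \<xi> - \<delta> *\<^sub>R \<xi>" for \<xi> by (simp add: R_def of_real_def)
  have Rsym: "inner (app R \<xi>) \<eta> = inner \<xi> (app R \<eta>)" for \<xi> \<eta>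
    by (simp add: R inner_diff_left inner_diff_right sym)
  have R1: "(norm (app R \<xi>))\<^sup>2 \<le> (norm \<xi>)\<^sup>2" for \<xi>
  proof -
    define t n where "t = inner (app T \<xi>) \<xi>" and "n = (norm \<xi>)\<^sup>2"
    have "(norm (app R \<xi>))\<^sup>2 = (norm (app T \<xi>))\<^sup>2 - 2 * \<delta> * t + \<delta> * \<delta> * n"
      unfolding R t_def n_def power2_norm_eq_inner
      by (simp add: inner_diff_left inner_diff_right inner_commute algebra_simps)
    also have "\<dots> \<le> t - 2 * \<delta> * t + \<delta> * \<delta> * n" using T(1)[of \<xi>] by (simp add: t_def)
    also have "\<dots> = (1 - 2 * \<delta>) * t + \<delta> * \<delta> * n" by (simp add: algebra_simps)
    \<comment> \<open>Here \<open>\<delta> \<le> 1 / 2\<close> enters: the coefficient of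
      \<open>t\<close> must be nonnegative.\<close>
    also have "\<dots> \<le> (1 - 2 * \<delta>) * n + \<delta> * \<delta> * n"
      using T(2)[of \<xi>] \<delta> by (intro add_right_mono mult_left_mono) (auto simp: t_def n_def)
    also have "\<dots> = (1 - \<delta> * (2 - \<delta>)) * n" by (simp add: algebra_simps)
    also have "\<dots> \<le> 1 * n" using \<delta> by (intro mult_right_mono) (auto simp: n_def)
    finally show ?thesis by (simp add: n_def)
  qed
  \<comment> \<open>The square is expanded with \<open>R\<close> self-adjoint. By \<open>R1\<close>
    the last term is at most \<open>(norm (app R \<xi>))^2\<close>, which the middle term
    absorbs.\<close>
  have "(norm (\<xi> - app R (app R \<xi>)))\<^sup>2 = (norm \<xi>)\<^sup>2 - 2 * (norm (app R \<xi>))\<^sup>2 + (norm (app R (app R \<xi>)))\<^sup>2"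
    unfolding power2_norm_eq_inner using Rsym[of \<xi> "app R \<xi>"]
    by (simp add: inner_diff_left inner_diff_right inner_commute algebra_simps)
  also have "\<dots> \<le> (norm \<xi>)\<^sup>2" using R1[of "app R \<xi>"] zero_le_power2[of "norm (app R \<xi>)"] by linarith
  finally have "norm (\<xi> - app R (app R \<xi>)) \<le> norm \<xi>" by (rule power2_le_imp_le) simp
  then show "norm (app (1 - (T - of_real \<delta>) * (T - of_real \<delta>)) \<xi>) \<le> 1 * norm \<xi>"
    unfolding R_def[symmetric] by simp
qed simp

context lc_etale_groupoid
begin

text \<open>For \<open>q\<close> supported on the units this is the convolution product
  \<open>q f q\<close>, as \<open>rho_cut\<close> confirms.\<close>

definition cut :: "('a \<Rightarrow> complex) \<Rightarrow> ('a \<Rightarrow> complex) \<Rightarrow> 'a \<Rightarrow> complex" where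
  "cut q f = (\<lambda>k. q (r k) * f k * q (s k))"

text \<open>The neighbourhood \<open>V\<close> serves every admissible \<open>q\<close> at once, so
  neighbourhoods found for finitely many functions can be intersected.\<close>

definition cuts_into :: "'a set \<Rightarrow> ('a \<Rightarrow> complex) \<Rightarrow> ('a \<Rightarrow> complex) set \<Rightarrow> bool" where
  "cuts_into V f D \<longleftrightarrow> (\<forall>q C. compactin TG C \<longrightarrow> C \<subseteq> V \<longrightarrow> (\<forall>g. g \<notin> C \<longrightarrow> q g = 0) \<longrightarrow>
     continuous_map (unit_top G) euclidean q \<longrightarrow> cut q f \<in> D)"

text \<open>The compact set \<open>K - H\<close> of a function supported in \<open>K\<close> has an image under \<open>(r, s)\<close> which misses
  \<open>(x, x)\<close>; a neighbourhood of \<open>x\<close> whose square misses this image does the job.\<close>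

lemma Cb_cut:
  assumes H: "openin TG H" and x: "x \<in> units G" "isotropy G x \<subseteq> H" and f: "f \<in> Cb arr"
  shows "\<exists>V. openin TG V \<and> x \<in> V \<and> V \<subseteq> units G \<and> cuts_into V f (Cb H)"
proof -
  obtain W K where Wa: "W \<subseteq> arr" and "supported W K f" using f by (rule CbE)
  note W = supportedD[OF this(2)]
  have Ka: "K \<subseteq> arr" using Wa W(3) by blast
  let ?P = "prod_topology (unit_top G) (unit_top G)"
  let ?L = "(\<lambda>k. (r k, s k)) ` (K - H)"
  have "closedin TG (arr - H)" using H by (metis closedin_diff closedin_topspace topspace_top)
  \<comment> \<open>Openness of \<open>H\<close> enters here: \<open>K - H\<close> is the
    intersection of \<open>K\<close> with a closed set, hence compact even where \<open>K\<close> is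
    not closed in \<open>G\<close>.\<close>
  then have "compactin TG ((arr - H) \<inter> K)" using W(4) by (rule closed_Int_compactin)
  also have "(arr - H) \<inter> K = K - H" using Ka by blast
  finally have "compactin ?P ?L"
    by (rule image_compactin) (intro continuous_map_pairedI continuous_map_rng continuous_map_src)
  then have "closedin ?P ?L"
    by (rule compactin_imp_closedin[rotated]) (simp add: Hausdorff_space_prod_topology Hausdorff_units)
  then have "openin ?P (topspace ?P - ?L)" by (rule openin_diff[OF openin_topspace])
  \<comment> \<open>An arrow of \<open>K - H\<close> sent to \<open>(x, x)\<close> would lie in the
    isotropy group at \<open>x\<close>, which is contained in \<open>H\<close>.\<close>
  moreover have "(x, x) \<in> topspace ?P - ?L"
    using x Ka by (auto simp: isotropy_def src_fiber_def rng_fiber_def)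
  ultimately have "\<exists>V1 V2. openin (unit_top G) V1 \<and> openin (unit_top G) V2 \<and> x \<in> V1 \<and> x \<in> V2
    \<and> V1 \<times> V2 \<subseteq> topspace ?P - ?L"
    unfolding openin_prod_topology_alt[of _ _ "topspace ?P - ?L"] by (elim allE impE)
  then obtain V1 V2 where V: "openin (unit_top G) V1" "openin (unit_top G) V2" "x \<in> V1" "x \<in> V2"
    "V1 \<times> V2 \<subseteq> topspace ?P - ?L" by (elim exE conjE)
  have KH: "k \<in> H" if "k \<in> K" "r k \<in> V1" "s k \<in> V2" for k
  proof (rule ccontr)
    assume "k \<notin> H"
    then have "(r k, s k) \<in> ?L" using that by blast
    then show False using V(5) that by blast
  qed
  have V12: "openin TG (V1 \<inter> V2)" "V1 \<inter> V2 \<subseteq> units G" using V(1,2) by (auto simp: openin_unit_top)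
  have "cut q f \<in> Cb H"
    if C: "compactin TG C" "C \<subseteq> V1 \<inter> V2" and q: "\<forall>g. g \<notin> C \<longrightarrow> q g = 0" "continuous_map (unit_top G) euclidean q" for q C
  proof (rule CbI)
    have Cu: "C \<subseteq> units G" using C(2) V12(2) by blast
    have "compactin (unit_top G) C" using C(1) Cu by (simp add: unit_top_def compactin_subtopology)
    then have clC: "closedin (unit_top G) C" by (rule compactin_imp_closedin[OF Hausdorff_units])
    let ?K = "{k \<in> arr. r k \<in> C} \<inter> ({k \<in> arr. s k \<in> C} \<inter> K)"
    show "openin TG (W \<inter> H)" "W \<inter> H \<subseteq> H" "bisection G (W \<inter> H)"
      using W(1,2) H by (auto intro: openin_Int bisection_subset)
    show "?K \<subseteq> W \<inter> H" using KH C(2) W(3) by blast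
    have "closedin TG {k \<in> arr. r k \<in> C}" "closedin TG {k \<in> arr. s k \<in> C}"
      using closedin_continuous_map_preimage[OF continuous_map_rng clC] closedin_continuous_map_preimage[OF continuous_map_src clC]
      by simp_all
    then show "compactin TG ?K" using W(4) by (intro closed_Int_compactin)
    show "cut q f g = 0" if "g \<notin> ?K" for g
    proof (cases "g \<in> K")
      case True
      then have "r g \<notin> C \<or> s g \<notin> C" using that Ka by blast
      then show ?thesis using q(1) by (auto simp: cut_def)
    qed (simp add: cut_def W(5))
    have "continuous_map TG euclidean (q \<circ> r)" "continuous_map TG euclidean (q \<circ> s)"
      using q(2) continuous_map_rng continuous_map_src by (blast intro: continuous_map_compose)+
    then have "continuous_map (sub (W \<inter> H)) euclidean (\<lambda>k. q (r k))"
      "continuous_map (sub (W \<inter> H)) euclidean (\<lambda>k. q (s k))"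
      by (simp_all add: continuous_map_from_subtopology o_def)
    moreover have "continuous_map (sub (W \<inter> H)) euclidean f"
      using W(6) by (rule continuous_map_from_subtopology_mono) blast
    ultimately show "continuous_map (sub (W \<inter> H)) euclidean (cut q f)"
      unfolding cut_def by (intro continuous_map_complex)
  qed
  then have "cuts_into (V1 \<inter> V2) f (Cb H)" by (simp add: cuts_into_def)
  then show ?thesis using V12 V(3,4) by blast
qed

lemma fsums_cut:
  assumes H: "openin TG H" and x: "x \<in> units G" "isotropy G x \<subseteq> H" and f: "f \<in> fsums (Cb arr)"
  shows "\<exists>V. openin TG V \<and> x \<in> V \<and> V \<subseteq> units G \<and> cuts_into V f (fsums (Cb H))"
  using f
proof (induction rule: fsums.induct)
  case zero
  show ?case by (intro exI[of _ "units G"]) (auto simp: cuts_into_def cut_def openin_units x intro: fsums.zero)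
next
  case (add f \<phi>)
  obtain V where V: "openin TG V" "x \<in> V" "V \<subseteq> units G" "cuts_into V f (fsums (Cb H))" using add.IH by (elim exE conjE)
  obtain V' where V': "openin TG V'" "x \<in> V'" "V' \<subseteq> units G" "cuts_into V' \<phi> (Cb H)" using Cb_cut[OF H x add.hyps(2)] by (elim exE conjE)
  have "cut q (\<lambda>g. f g + \<phi> g) = (\<lambda>g. cut q f g + cut q \<phi> g)" for q
    by (rule ext) (simp add: cut_def algebra_simps)
  then show ?case
    using V V' by (intro exI[of _ "V \<inter> V'"]) (auto simp: cuts_into_def intro: openin_Int fsums.add)
qed

lemma cut_exists:
  assumes H: "openin TG H" and x: "x \<in> units G" "isotropy G x \<subseteq> H" and f: "f \<in> fsums (Cb arr)"
  shows "\<exists>q. q \<in> Cb arr \<and> q x = 1 \<and> (\<forall>g. cmod (q g) \<le> 1) \<and> (\<forall>g. g \<notin> units G \<longrightarrow> q g = 0) \<and> cut q f \<in> fsums (Cb H)"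
proof -
  obtain V where V: "openin TG V" "x \<in> V" "V \<subseteq> units G" "cuts_into V f (fsums (Cb H))" using fsums_cut[OF assms] by (elim exE conjE)
  have bV: "bisection G V" by (rule bisection_subset[OF bisection_units V(3)])
  obtain C \<theta> where "bump_on V x C \<theta>" using V(1) bV V(2) by (rule bump)
  note \<theta> = bump_onD[OF this]
  define q where "q g = complex_of_real (\<theta> g)" for g
  have qV: "continuous_map (sub V) euclidean q" unfolding q_def using \<theta>(6) by (rule continuous_map_complex)
  have q0: "q g = 0" if "g \<notin> C" for g using \<theta>(3)[OF that] by (simp add: q_def)
  \<comment> \<open>The bump is so far continuous on \<open>V\<close> only. Its compact support is
    closed in the Hausdorff unit space, which gives the continuity on all units that
    \<open>cuts_into\<close> demands.\<close>
  have "compactin (unit_top G) C" using \<theta>(1,2) V(3) by (auto simp: unit_top_def compactin_subtopology)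
  then have clC: "closedin (unit_top G) C" by (rule compactin_imp_closedin[OF Hausdorff_units])
  have qu: "continuous_map (unit_top G) euclidean q"
  proof (rule continuous_map_extend_zero[OF _ clC \<theta>(2) _ q0])
    show "openin (unit_top G) V" using V by (simp add: openin_unit_top)
    show "continuous_map (subtopology (unit_top G) V) euclidean q"
      using qV V(3) by (simp add: unit_top_def subtopology_subtopology Int_absorb1)
  qed
  have "V \<subseteq> arr" using bisectionD[OF bV] by blast
  then have "q \<in> Cb arr" using V(1) bV \<theta>(1,2) q0 qV by (intro CbI[of V arr C])
  moreover have "cut q f \<in> fsums (Cb H)" using V(4) \<theta>(1,2) q0 qu unfolding cuts_into_def by blast
  moreover have "cmod (q g) \<le> 1" for g using \<theta>(5)[of g] by (simp add: q_def)
  moreover have "q g = 0" if "g \<notin> units G" for g using that \<theta>(2) V(3) q0 by blast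
  moreover have "q x = 1" using \<theta>(4) by (simp add: q_def)
  ultimately show ?thesis by blast
qed

lemma rho_unit_fun:
  assumes q: "\<forall>g. g \<notin> units G \<longrightarrow> q g = 0" and x: "x \<in> units G" "\<xi> \<in> ell2 (S x)"
  shows "rho G q x \<xi> k = q (r k) * \<xi> k"
proof (cases "k \<in> S x")
  case True
  then have k: "k \<in> arr" by (rule src_fiberD)
  have "rho G q x \<xi> k = q (r k) * \<xi> (iv (r k) \<odot> k)"
    by (rule rho_at[OF bisection_units q x rng_in_units[OF k] True]) (rule rng_rng[OF k])
  then show ?thesis using k by (simp add: iv_unit rng_in_units rng_unit)
next
  case False
  then show ?thesis using x by (simp add: rho_eq) (simp add: ell2_def)
qed

lemma rho_cut:
  assumes q: "q \<in> Cb arr" "\<forall>g. g \<notin> units G \<longrightarrow> q g = 0" and f: "f \<in> fsums (Cb arr)"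
  shows "rho G (cut q f) = fam_mult (rho G q) (fam_mult (rho G f) (rho G q))"
proof (intro ext)
  fix x \<xi> k
  note qop = op_families_bounded[OF rho_op[OF fsums_base[OF q(1)]]]
  note fop = op_families_bounded[OF rho_op[OF f]]
  show "rho G (cut q f) x \<xi> k = fam_mult (rho G q) (fam_mult (rho G f) (rho G q)) x \<xi> k"
  proof (cases "x \<in> units G \<and> \<xi> \<in> ell2 (S x)")
    case True
    then have x: "x \<in> units G" "\<xi> \<in> ell2 (S x)" by auto
    have \<eta>: "rho G q x \<xi> \<in> ell2 (S x)" by (rule bounded_ops_ell2[OF qop])
    have \<zeta>: "rho G f x (rho G q x \<xi>) \<in> ell2 (S x)" by (rule bounded_ops_ell2[OF fop])
    show ?thesis
    proof (cases "k \<in> S x")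
      case k: True
      have "(\<Sum>\<^sub>\<infinity>g\<in>S x. \<xi> g * cut q f (k \<odot> iv g)) = (\<Sum>\<^sub>\<infinity>g\<in>S x. q (r k) * (rho G q x \<xi> g * f (k \<odot> iv g)))"
      proof (rule infsum_cong)
        fix g assume g: "g \<in> S x"
        then have "r (k \<odot> iv g) = r k" "s (k \<odot> iv g) = r g" using k by (auto intro!: div_in dest: src_fiberD)
        then show "\<xi> g * cut q f (k \<odot> iv g) = q (r k) * (rho G q x \<xi> g * f (k \<odot> iv g))"
          by (simp add: cut_def rho_unit_fun[OF q(2) x])
      qed
      also have "\<dots> = q (r k) * (\<Sum>\<^sub>\<infinity>g\<in>S x. rho G q x \<xi> g * f (k \<odot> iv g))" by (rule infsum_cmult_right')
      finally show ?thesis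
        using k by (simp add: fam_mult_def rho_eq[OF x] rho_unit_fun[OF q(2) x(1) \<zeta>] rho_eq[OF x(1) \<eta>])
    next
      case False
      then show ?thesis
        by (simp add: fam_mult_def rho_eq[OF x] rho_unit_fun[OF q(2) x(1) \<zeta>] rho_eq[OF x(1) \<eta>])
    qed
  next
    case False
    have "A \<in> bounded_ops (S x) \<Longrightarrow> A (\<lambda>_. 0) = (\<lambda>_. 0)" for A
      using bounded_opsD(4)[of A "S x" "\<lambda>_. 0" 0] by simp
    note z = this[OF qop] this[OF fop]
    show ?thesis using False z by (cases "x \<in> units G") (auto simp: fam_mult_def rho_outside)
  qed
qed

section \<open>The reduced C*-algebra and its closed ideals\<close>

lemma Cc_eq: "Cc TG = fsums (Cb arr)"
  using Cc_eq_sums_Cb[of arr] openin_topspace[of TG] subtopology_topspace[of TG] by simp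

lemma rho_Cc_subset: "openin TG H \<Longrightarrow> rho G ` Cc (sub H) \<subseteq> op_families G"
  using rho_op Cc_eq_sums_Cb by blast

lemma Cstar_r_iff: "a \<in> Cstar_r G \<longleftrightarrow> a \<in> op_families G \<and>
    (\<forall>\<epsilon>>0. \<exists>f\<in>fsums (Cb arr). \<forall>x. norm (famop G a x - reg f x) \<le> \<epsilon>)"
proof -
  have D: "rho G ` Cc TG \<subseteq> op_families G" using rho_op unfolding Cc_eq by blast
  have "a \<in> Cstar_r G \<Longrightarrow> a \<in> op_families G" by (simp add: Cstar_r_def red_closure_def)
  then show ?thesis using red_closure_iff[OF D, of a] unfolding Cstar_r_def Cc_eq by (simp add: bex_simps) blast
qed

lemma rho_in_Cstar_r: "f \<in> fsums (Cb arr) \<Longrightarrow> rho G f \<in> Cstar_r G"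
  unfolding Cstar_r_iff by (intro conjI allI impI bexI[of _ f]) (simp_all add: rho_op)

lemma closed_idealD:
  assumes "closed_ideal G I"
  shows "a \<in> I \<Longrightarrow> a \<in> Cstar_r G" "a \<in> I \<Longrightarrow> a \<in> op_families G"
    "a \<in> I \<Longrightarrow> b \<in> I \<Longrightarrow> fam_add a b \<in> I" "a \<in> I \<Longrightarrow> fam_scale c a \<in> I"
    "a \<in> I \<Longrightarrow> b \<in> Cstar_r G \<Longrightarrow> fam_mult a b \<in> I" "a \<in> I \<Longrightarrow> b \<in> Cstar_r G \<Longrightarrow> fam_mult b a \<in> I"
    "a \<in> Cstar_r G \<Longrightarrow> a \<in> red_closure G I \<Longrightarrow> a \<in> I"
proof -
  have Cop: "Cstar_r G \<subseteq> op_families G" using Cstar_r_iff by blast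
  have "I \<subseteq> Cstar_r G" "\<forall>a \<in> I. \<forall>b \<in> I. fam_add a b \<in> I" "\<forall>c. \<forall>a \<in> I. fam_scale c a \<in> I"
     "\<forall>a \<in> I. \<forall>b \<in> Cstar_r G. fam_mult a b \<in> I \<and> fam_mult b a \<in> I" "Cstar_r G \<inter> red_closure G I \<subseteq> I"
    using assms unfolding closed_ideal_def by simp_all
  then show "a \<in> I \<Longrightarrow> a \<in> Cstar_r G" "a \<in> I \<Longrightarrow> a \<in> op_families G"
    "a \<in> I \<Longrightarrow> b \<in> I \<Longrightarrow> fam_add a b \<in> I" "a \<in> I \<Longrightarrow> fam_scale c a \<in> I"
    "a \<in> I \<Longrightarrow> b \<in> Cstar_r G \<Longrightarrow> fam_mult a b \<in> I" "a \<in> I \<Longrightarrow> b \<in> Cstar_r G \<Longrightarrow> fam_mult b a \<in> I"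
    "a \<in> Cstar_r G \<Longrightarrow> a \<in> red_closure G I \<Longrightarrow> a \<in> I"
    using Cop by (simp_all add: subset_iff)
qed

text \<open>Closedness of \<open>I\<close> is relative to \<open>Cstar_r G\<close>. A uniform limit
  of ideal elements must first be realised by an operator family and then be approximated by
  functions in \<open>fsums (Cb arr)\<close>, through the approximants.\<close>

lemma ideal_closed:
  assumes I: "closed_ideal G I"
    and F: "\<And>\<epsilon>. \<epsilon> > 0 \<Longrightarrow> \<exists>a\<in>I. \<forall>x. norm (F x - famop G a x) \<le> \<epsilon>"
  shows "\<exists>a\<in>I. \<forall>x. famop G a x = F x"
proof -
  note ID = closed_idealD[OF I]
  have sub: "I \<subseteq> op_families G" using ID(2) by blast
  have "\<exists>a\<in>op_families G. \<forall>x. famop G a x = F x"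
  proof (rule famop_closed)
    fix \<epsilon> :: real assume "\<epsilon> > 0"
    then obtain d where "d \<in> I" "\<forall>x. norm (F x - famop G d x) \<le> \<epsilon>" using F by metis
    then show "\<exists>a\<in>op_families G. \<forall>x. norm (F x - famop G a x) \<le> \<epsilon>" by (intro bexI[of _ d] ID(2))
  qed
  then obtain a where a: "a \<in> op_families G" "\<And>x. famop G a x = F x" by metis
  have "\<forall>\<epsilon>>0. \<exists>d\<in>I. \<forall>x. norm (famop G a x - famop G d x) \<le> \<epsilon>" unfolding a(2) using F by (intro allI impI)
  then have cl: "a \<in> red_closure G I" unfolding red_closure_iff[OF sub a(1)] .
  have "\<exists>f\<in>fsums (Cb arr). \<forall>x. norm (famop G a x - reg f x) \<le> \<epsilon>" if "\<epsilon> > 0" for \<epsilon>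
  proof -
    have e: "\<epsilon> / 2 > 0" using that by simp
    obtain d where d: "d \<in> I" "\<forall>x. norm (F x - famop G d x) \<le> \<epsilon> / 2" using F[OF e] by metis
    have "\<forall>\<epsilon>>0. \<exists>f\<in>fsums (Cb arr). \<forall>x. norm (famop G d x - reg f x) \<le> \<epsilon>"
      using ID(1)[OF d(1)] unfolding Cstar_r_iff by (rule conjunct2)
    with e obtain f where f: "f \<in> fsums (Cb arr)" "\<forall>x. norm (famop G d x - reg f x) \<le> \<epsilon> / 2" by metis
    have "norm (famop G a x - reg f x) \<le> \<epsilon>" for x
      using norm_triangle_ineq[of "F x - famop G d x" "famop G d x - reg f x"]
        d(2)[rule_format, of x] f(2)[rule_format, of x] by (simp add: a(2))
    then show ?thesis using f(1) by (intro bexI[of _ f] allI)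
  qed
  then have "a \<in> Cstar_r G" unfolding Cstar_r_iff using a(1) by (intro conjI allI impI)
  then have "a \<in> I" using cl by (rule ID(7))
  then show ?thesis using a(2) by (intro bexI[of _ a] allI)
qed

text \<open>For \<open>T = b' b / N^2\<close> one has \<open>0 \<le> T \<le> 1\<close>, and
  \<open>T\<close> is within \<open>\<epsilon> / N\<close> of \<open>I\<close>. Then
  \<open>ideal_perturbation\<close> with \<open>\<delta> = 2 \<epsilon> / N\<close> gives
  \<open>T \<le> \<delta>\<close>, and multiplying by \<open>N^2\<close> produces the constant
  \<open>2 \<epsilon> N\<close>.\<close>

lemma ideal_separated:
  assumes G0: "open_subgroupoid G H" and I: "closed_ideal G I" and triv: "Cstar_r_sub G H \<inter> I = {fam_zero}"
    and \<beta>: "b \<in> fsums (Cb H)" "b' \<in> fsums (Cb H)"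
      "\<And>x \<xi> \<eta>. inner (app (reg b x) \<xi>) \<eta> = inner \<xi> (app (reg b' x) \<eta>)"
      "\<And>x. norm (reg b x) \<le> N"
    and c: "c \<in> I" "\<And>x. norm (reg b x - famop G c x) \<le> \<epsilon>"
    and N: "0 < N" "0 < \<epsilon>" "4 * \<epsilon> \<le> N"
  shows "(norm (app (reg b x) \<xi>))\<^sup>2 \<le> 2 * \<epsilon> * N * (norm \<xi>)\<^sup>2"
proof -
  note ID = closed_idealD[OF I]
  have oH: "openin TG H" using G0 by (simp add: open_subgroupoid_def)
  have Ha: "H \<subseteq> arr" using openin_subset[OF oH] by simp
  define A where "A = {F. \<exists>f\<in>fsums (Cb H). F = reg f}"
  define J where "J = {F. \<exists>a\<in>I. F = famop G a}"
  have rC: "rho G f \<in> Cstar_r G" if "f \<in> fsums (Cb H)" for f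
    by (rule rho_in_Cstar_r[OF fsums_mono[OF that Cb_mono[OF Ha]]])
  let ?B = "reg b" and ?B' = "reg b'"
  define t where "t = 1 / N"
  have t: "0 < t" "t * N = 1" using N by (auto simp: t_def)
  define T where "T x = (t * t) *\<^sub>R (?B' x * ?B x)" for x
  define C where "C x = (t * t) *\<^sub>R (?B' x * famop G c x)" for x
  have adj: "inner (app (?B' x) \<xi>) \<eta> = inner \<xi> (app (?B x) \<eta>)" for x \<xi> \<eta>
    using \<beta>(3)[of x \<eta> \<xi>] by (simp add: inner_commute)
  have B'N: "norm (?B' x) \<le> N" for x
  proof (rule norm_bop_le)
    fix \<eta>
    have "(norm (app (?B' x) \<eta>))\<^sup>2 = inner \<eta> (app (?B x) (app (?B' x) \<eta>))"
      by (simp add: power2_norm_eq_inner adj)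
    also have "\<dots> \<le> norm \<eta> * norm (app (?B x) (app (?B' x) \<eta>))" by (rule norm_cauchy_schwarz)
    also have "\<dots> \<le> norm \<eta> * (N * norm (app (?B' x) \<eta>))"
      by (intro mult_left_mono order_trans[OF norm_app_le] mult_right_mono \<beta>(4) norm_ge_zero)
    finally have "norm (app (?B' x) \<eta>) * norm (app (?B' x) \<eta>) \<le> (N * norm \<eta>) * norm (app (?B' x) \<eta>)"
      by (simp add: power2_eq_square algebra_simps)
    then show "norm (app (?B' x) \<eta>) \<le> N * norm \<eta>"
      using N by (cases "norm (app (?B' x) \<eta>) = 0") (auto simp: mult_le_cancel_right)
  qed (use N in simp)
  have TA: "T \<in> A"
  proof -
    obtain k where k: "k \<in> fsums (Cb H)" "\<forall>x. reg k x = ?B' x * ?B x"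
      using fsums_mult[OF G0 \<beta>(2,1)] by metis
    obtain l where l: "l \<in> fsums (Cb H)" "\<forall>x. reg l x = (t * t) *\<^sub>R reg k x"
      using famop_scale[OF k(1)] by metis
    have "T = reg l" by (rule ext) (simp add: T_def k(2) l(2))
    then show ?thesis unfolding A_def using l(1) by blast
  qed
  have CJ: "C \<in> J"
  proof -
    have "fam_mult (rho G b') c \<in> I" by (rule ID(6)[OF c(1) rC[OF \<beta>(2)]])
    then have m: "fam_scale (of_real (t * t)) (fam_mult (rho G b') c) \<in> I" "fam_mult (rho G b') c \<in> op_families G"
      using ID(4) ID(2) by blast+
    have "C = famop G (fam_scale (of_real (t * t)) (fam_mult (rho G b') c))"
      by (rule ext) (simp only: C_def fam_scale_op[OF m(2)] fam_mult_op(2)[OF rho_op[OF \<beta>(2)] ID(2)[OF c(1)]])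
    then show ?thesis unfolding J_def using m(1) by blast
  qed
  have inT: "inner (app (T x) \<xi>) \<eta> = t * t * inner (app (?B x) \<xi>) (app (?B x) \<eta>)" for x \<xi> \<eta>
    by (simp add: T_def adj)
  \<comment> \<open>One factor \<open>t\<close> is spent on \<open>norm (?B' x) \<le> N\<close>.
    Squaring what remains gives \<open>T^2 \<le> T\<close> as quadratic forms, because
    \<open>inner (app (T x) \<xi>) \<xi>\<close> is \<open>t^2\<close> times the squared norm of
    \<open>app (?B x) \<xi>\<close>.\<close>
  have nT: "norm (app (T x) \<xi>) \<le> t * norm (app (?B x) \<xi>)" for x \<xi>
  proof -
    have "norm (app (T x) \<xi>) = t * t * norm (app (?B' x) (app (?B x) \<xi>))" using t by (simp add: T_def)
    also have "\<dots> \<le> t * t * (N * norm (app (?B x) \<xi>))"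
      using t by (intro mult_left_mono order_trans[OF norm_app_le] mult_right_mono B'N) auto
    also have "\<dots> = t * (t * N) * norm (app (?B x) \<xi>)" by (simp add: algebra_simps)
    finally show ?thesis by (simp add: t)
  qed
  \<comment> \<open>The factor 2 makes \<open>\<delta>\<close> strictly larger than the distance
    \<open>\<epsilon> / N\<close> from the ideal; \<open>4 * \<epsilon> \<le> N\<close> keeps it at
    most 1/2.\<close>
  define \<delta> where "\<delta> = 2 * \<epsilon> / N"
  have \<delta>: "0 < \<delta>" "\<epsilon> / N < \<delta>" "\<delta> \<le> 1 / 2" using N by (auto simp: \<delta>_def field_simps)
  have contr: "norm (1 - (T x - of_real \<delta>) * (T x - of_real \<delta>)) \<le> 1" for x
  proof (rule contraction_one_minus_square)
    show "inner (app (T x) \<xi>) \<eta> = inner \<xi> (app (T x) \<eta>)" for \<xi> \<eta>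
      using inT[of x \<xi> \<eta>] inT[of x \<eta> \<xi>] by (simp add: inner_commute)
    show "(norm (app (T x) \<xi>))\<^sup>2 \<le> inner (app (T x) \<xi>) \<xi>" for \<xi>
      using power_mono[OF nT[of x \<xi>], of 2] by (simp add: inT power_mult_distrib power2_eq_square[of t] power2_norm_eq_inner[symmetric])
    show "inner (app (T x) \<xi>) \<xi> \<le> (norm \<xi>)\<^sup>2" for \<xi>
    proof -
      have "t * norm (app (?B x) \<xi>) \<le> t * (N * norm \<xi>)"
        using t by (intro mult_left_mono order_trans[OF norm_app_le] mult_right_mono \<beta>(4)) auto
      also have "\<dots> = norm \<xi>" using t by (simp add: mult.assoc[symmetric])
      finally have "(t * norm (app (?B x) \<xi>))\<^sup>2 \<le> (norm \<xi>)\<^sup>2" using t by (intro power_mono) auto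
      then show ?thesis by (simp add: inT power_mult_distrib power2_eq_square[of t] power2_norm_eq_inner[symmetric])
    qed
  qed (use \<delta> in auto)
  have "\<exists>X. \<forall>x. norm (X x) \<le> 1 \<and> T x = of_real \<delta> - 1 + X x"
  proof (rule ideal_perturbation[where A = A and J = J and T = T and c = C and M = 1 and \<eta> = "\<epsilon> / N"])
    show "(\<lambda>x. a x + d x) \<in> A" if ad: "a \<in> A" "d \<in> A" for a d
    proof -
      obtain f h where f: "f \<in> fsums (Cb H)" "a = reg f" "h \<in> fsums (Cb H)" "d = reg h"
        using ad unfolding A_def by blast
      have "(\<lambda>x. a x + d x) = reg (\<lambda>g. f g + h g)"
        by (rule ext) (simp add: f famop_rho_add[OF f(1,3)])
      then show ?thesis unfolding A_def using fsums_add[OF f(3,1)] by blast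
    qed
    show "(\<lambda>x. q *\<^sub>R a x) \<in> A" if ad: "a \<in> A" for q a
    proof -
      obtain f where f: "f \<in> fsums (Cb H)" "a = reg f" using ad unfolding A_def by blast
      obtain l where l: "l \<in> fsums (Cb H)" "\<forall>x. reg l x = q *\<^sub>R reg f x"
        using famop_scale[OF f(1)] by metis
      have "(\<lambda>x. q *\<^sub>R a x) = reg l" by (rule ext) (simp add: f l)
      then show ?thesis unfolding A_def using l(1) by blast
    qed
    show "(\<lambda>x. a x * d x) \<in> A" if ad: "a \<in> A" "d \<in> A" for a d
    proof -
      obtain f h where f: "f \<in> fsums (Cb H)" "a = reg f" "h \<in> fsums (Cb H)" "d = reg h"
        using ad unfolding A_def by blast
      obtain l where l: "l \<in> fsums (Cb H)" "\<forall>x. reg l x = reg f x * reg h x"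
        using fsums_mult[OF G0 f(1,3)] by metis
      have "(\<lambda>x. a x * d x) = reg l" by (rule ext) (simp add: f l)
      then show ?thesis unfolding A_def using l(1) by blast
    qed
    show "(\<lambda>x. a x + d x) \<in> J" if ad: "a \<in> J" "d \<in> J" for a d
    proof -
      obtain f h where f: "f \<in> I" "a = famop G f" "h \<in> I" "d = famop G h" using ad unfolding J_def by blast
      have "(\<lambda>x. a x + d x) = famop G (fam_add f h)"
        by (rule ext) (simp add: f fam_add_op[OF ID(2)[OF f(1)] ID(2)[OF f(3)]])
      then show ?thesis unfolding J_def using ID(3)[OF f(1,3)] by blast
    qed
    show "(\<lambda>x. q *\<^sub>R a x) \<in> J" if ad: "a \<in> J" for q a
    proof -
      obtain f where f: "f \<in> I" "a = famop G f" using ad unfolding J_def by blast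
      have "(\<lambda>x. q *\<^sub>R a x) = famop G (fam_scale (of_real q) f)"
        by (rule ext) (simp only: f fam_scale_op[OF ID(2)[OF f(1)]])
      then show ?thesis unfolding J_def using ID(4)[OF f(1)] by blast
    qed
    have mult: "(\<lambda>x. famop G f x * famop G h x) \<in> J" if "f \<in> Cstar_r G" "h \<in> Cstar_r G" "f \<in> I \<or> h \<in> I" for f h
    proof -
      have "fam_mult f h \<in> I" using that ID(5,6) by blast
      moreover have "(\<lambda>x. famop G f x * famop G h x) = famop G (fam_mult f h)"
        using that(1,2) by (intro ext fam_mult_op(2)[symmetric]) (simp_all add: Cstar_r_iff)
      ultimately show ?thesis unfolding J_def by blast
    qed
    have AJ: "\<exists>f. f \<in> Cstar_r G \<and> F = famop G f" if "F \<in> A" for F using that rC unfolding A_def by blast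
    have JJ: "\<exists>f. f \<in> Cstar_r G \<and> f \<in> I \<and> F = famop G f" if "F \<in> J" for F using that ID(1) unfolding J_def by blast
    show "(\<lambda>x. a x * d x) \<in> J" if "a \<in> A" "d \<in> J" for a d
      using AJ[OF that(1)] JJ[OF that(2)] mult by blast
    show "(\<lambda>x. a x * d x) \<in> J" if "a \<in> J" "d \<in> A" for a d
      using AJ[OF that(2)] JJ[OF that(1)] mult by blast
    show "(\<lambda>x. a x * d x) \<in> J" if "a \<in> J" "d \<in> J" for a d
      using JJ[OF that(2)] JJ[OF that(1)] mult by blast
    show "\<exists>M. \<forall>x. norm (a x) \<le> M" if "a \<in> J" for a
    proof -
      obtain f where f: "f \<in> I" "a = famop G f" using \<open>a \<in> J\<close> unfolding J_def by blast
      obtain M where "0 \<le> M" "\<And>x. norm (famop G f x) \<le> M" using ID(2)[OF f(1)] by (rule op_families_norm_bound) blast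
      then show ?thesis unfolding f(2) by (intro exI[of _ M] allI)
    qed
    show Jcl: "F \<in> J" if F: "\<And>\<epsilon>. \<epsilon> > 0 \<Longrightarrow> \<exists>d\<in>J. \<forall>x. norm (F x - d x) \<le> \<epsilon>" for F
    proof -
      have "\<exists>a\<in>I. \<forall>x. famop G a x = F x"
      proof (rule ideal_closed[OF I])
        fix \<epsilon> :: real assume "\<epsilon> > 0"
        then obtain d where d: "d \<in> J" "\<forall>x. norm (F x - d x) \<le> \<epsilon>" using F by metis
        then obtain f where f: "f \<in> I" "d = famop G f" unfolding J_def by blast
        show "\<exists>a\<in>I. \<forall>x. norm (F x - famop G a x) \<le> \<epsilon>" using d(2) f(1) unfolding f(2) by (rule bexI)
      qed
      then obtain a where "a \<in> I" "\<forall>x. famop G a x = F x" by metis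
      then have "F = famop G a" by (intro ext) simp
      then show ?thesis unfolding J_def using \<open>a \<in> I\<close> by blast
    qed
    \<comment> \<open>The trivial intersection enters here: \<open>F\<close> comes from an element
      of \<open>I\<close> and is a uniform limit of images of functions in
      \<open>Cc (sub H)\<close>.\<close>
    show "F x = 0" if F: "F \<in> J" "\<And>\<epsilon>. \<epsilon> > 0 \<Longrightarrow> \<exists>d\<in>A. \<forall>x. norm (F x - d x) \<le> \<epsilon>" for F x
    proof -
      obtain a where a: "a \<in> I" "F = famop G a" using F(1) unfolding J_def by blast
      have "\<forall>\<epsilon>>0. \<exists>d\<in>rho G ` Cc (sub H). \<forall>x. norm (famop G a x - famop G d x) \<le> \<epsilon>"
      proof (intro allI impI)
        fix \<epsilon> :: real assume "\<epsilon> > 0"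
        then obtain d where d: "d \<in> A" "\<forall>x. norm (F x - d x) \<le> \<epsilon>" using F(2) by metis
        then obtain f where f: "f \<in> fsums (Cb H)" "d = reg f" unfolding A_def by blast
        have "rho G f \<in> rho G ` Cc (sub H)" using f(1) unfolding Cc_eq_sums_Cb[OF oH] by (rule imageI)
        with d(2) show "\<exists>d\<in>rho G ` Cc (sub H). \<forall>x. norm (famop G a x - famop G d x) \<le> \<epsilon>"
          unfolding f(2) a(2) by (rule bexI)
      qed
      then have "a \<in> red_closure G (rho G ` Cc (sub H))"
        unfolding red_closure_iff[OF rho_Cc_subset[OF oH] ID(2)[OF a(1)]] .
      then have "a \<in> Cstar_r_sub G H" using ID(1)[OF a(1)] by (simp add: Cstar_r_sub_def restrict_groupoid_def)
      then have "a = fam_zero" using triv a(1) by blast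
      then show "F x = 0" by (simp add: a(2) fam_zero_op)
    qed
    show "norm (T x) \<le> 1" for x
    proof -
      have "norm (T x) \<le> t * t * (N * N)"
        unfolding T_def using t by (simp add: mult_left_mono order_trans[OF norm_mult_ineq] mult_mono B'N \<beta>(4) N less_imp_le)
      also have "\<dots> = (t * N) * (t * N)" by (simp add: algebra_simps)
      finally show ?thesis by (simp add: t)
    qed
    show "norm (T x - C x) \<le> \<epsilon> / N" for x
    proof -
      have "T x - C x = (t * t) *\<^sub>R (?B' x * (?B x - famop G c x))"
        by (simp add: T_def C_def algebra_simps)
      then have "norm (T x - C x) = t * t * norm (?B' x * (?B x - famop G c x))" using t by simp
      also have "\<dots> \<le> t * t * (N * \<epsilon>)"
        using t N by (intro mult_left_mono order_trans[OF norm_mult_ineq] mult_mono B'N c(2)) auto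
      also have "\<dots> = (t * N) * (t * \<epsilon>)" by (simp add: algebra_simps)
      also have "\<dots> = \<epsilon> / N" unfolding t(2) by (simp add: t_def)
      finally show ?thesis .
    qed
  qed (use TA CJ \<delta> contr in auto)
  then obtain X where X: "\<And>x. norm (X x) \<le> 1" "\<And>x. T x = of_real \<delta> - 1 + X x" by metis
  \<comment> \<open>\<open>T = \<delta> - 1 + X\<close> with \<open>norm X \<le> 1\<close> yields
    \<open>T \<le> \<delta>\<close> as a quadratic form.\<close>
  have "inner (app (T x) \<xi>) \<xi> = (\<delta> - 1) * (norm \<xi>)\<^sup>2 + inner (app (X x) \<xi>) \<xi>"
    by (simp add: X(2) of_real_def inner_add_left inner_diff_left power2_norm_eq_inner algebra_simps)
  also have "inner (app (X x) \<xi>) \<xi> \<le> norm (app (X x) \<xi>) * norm \<xi>" by (rule norm_cauchy_schwarz)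
  also have "\<dots> \<le> (1 * norm \<xi>) * norm \<xi>"
    by (intro mult_right_mono order_trans[OF norm_app_le] X norm_ge_zero)
  finally have "t * t * (norm (app (?B x) \<xi>))\<^sup>2 \<le> \<delta> * (norm \<xi>)\<^sup>2"
    by (simp add: inT power2_norm_eq_inner[symmetric] algebra_simps power2_eq_square)
  then show ?thesis using N by (simp add: t_def \<delta>_def field_simps power2_eq_square)
qed

section \<open>Coefficients of ideal elements\<close>

lemma rho_diag:
  assumes f: "f \<in> fsums (Cb H)" and x: "x \<in> units G" and g: "g \<in> S x"
  shows "rho G f x (delta x) g = f g"
proof -
  note xx = unitsD[OF x]
  have xS: "x \<in> S x" using xx by (intro src_fiberI)
  have "(\<Sum>\<^sub>\<infinity>h\<in>S x. delta x h * f (g \<odot> iv h)) = (\<Sum>\<^sub>\<infinity>h\<in>{x}. delta x h * f (g \<odot> iv h))"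
    by (rule infsum_cong_neutral) (use xS in \<open>auto simp: delta_def\<close>)
  also have "\<dots> = f (g \<odot> iv x)" by (simp add: delta_def)
  also have "g \<odot> iv x = g" using src_unit[of g] g iv_unit[OF x] by (auto simp: src_fiber_def)
  finally show ?thesis using rho_eq[OF x delta_in_ell2[OF xS], of f g] g by simp
qed

lemma norm_delta: "norm (Abs_l2 (delta x)) = 1"
proof -
  have "(\<Sum>\<^sub>\<infinity>g\<in>{x}. (cmod (delta x g))\<^sup>2) = 1" by (simp add: delta_def)
  then show ?thesis using norm_Abs[OF delta_in_ell2[of x "{x}"]] by (simp add: ell2_norm_def)
qed

text \<open>Together with \<open>rho_diag\<close>, this extends the inclusion of
  \<open>Cc TG\<close> into functions to a contraction from the reduced norm to the supremum norm,
  sending \<open>a\<close> to \<open>g \<mapsto> a (s g) (delta (s g)) g\<close>.\<close>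

lemma apply_diff_le:
  assumes a: "a \<in> op_families G" "b \<in> op_families G" and x: "x \<in> units G"
    and n: "norm (famop G a x - famop G b x) \<le> \<epsilon>"
  shows "cmod (a x (delta x) g - b x (delta x) g) \<le> \<epsilon>"
proof -
  have xS: "delta x \<in> ell2 (S x)" using unitsD[OF x] by (intro delta_in_ell2 src_fiberI)
  have "a x (delta x) g - b x (delta x) g = coord (app (famop G a x - famop G b x) (Abs_l2 (delta x))) g"
    unfolding famop_def using op_families_bounded[OF a(1)] op_families_bounded[OF a(2)]
    by (simp add: coord_bop_of_Abs[OF _ xS])
  also have "cmod \<dots> \<le> norm (app (famop G a x - famop G b x) (Abs_l2 (delta x)))" by (rule norm_coord_le)
  also have "\<dots> \<le> norm (famop G a x - famop G b x) * norm (Abs_l2 (delta x))" by (rule norm_app_le)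
  also have "\<dots> \<le> \<epsilon>" using n by (simp add: norm_delta)
  finally show ?thesis .
qed

lemma vanish_at_unit:
  assumes G0: "open_subgroupoid G H" and I: "closed_ideal G I" and triv: "Cstar_r_sub G H \<inter> I = {fam_zero}"
    and x: "x \<in> units G" "isotropy G x \<subseteq> H" and a: "a \<in> I"
  shows "a x (delta x) x = 0"
proof (rule ccontr)
  assume nz: "a x (delta x) x \<noteq> 0"
  define z where "z = cmod (a x (delta x) x)"
  have z: "z > 0" using nz by (simp add: z_def)
  note ID = closed_idealD[OF I]
  have oH: "openin TG H" using G0 by (simp add: open_subgroupoid_def)
  note xx = unitsD[OF x(1)]
  have xS: "x \<in> S x" using xx by (intro src_fiberI)
  obtain B where B: "0 \<le> B" "\<And>y. norm (famop G a y) \<le> B" using ID(2)[OF a] by (rule op_families_norm_bound) blast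
  \<comment> \<open>The constants are arranged for a contradiction at the end.
    \<open>\<epsilon> \<le> z / 2\<close> gives \<open>cmod (f x) \<ge> z / 2\<close>, whereas
    \<open>ideal_separated\<close> bounds its square by \<open>2 * \<epsilon> * N\<close>, which is
    at most \<open>z^2 / 8\<close>. The bound 1/4 on \<open>\<epsilon>\<close> keeps the norm of
    \<open>reg f\<close> below \<open>N\<close> and ensures
    \<open>4 * \<epsilon> \<le> N\<close>.\<close>
  define N where "N = B + 1"
  define \<epsilon> where "\<epsilon> = min (1 / 4) (min (z / 2) (z\<^sup>2 / (16 * N)))"
  have N: "N \<ge> 1" using B by (simp add: N_def)
  have \<epsilon>: "0 < \<epsilon>" "\<epsilon> \<le> 1 / 4" "\<epsilon> \<le> z / 2" "\<epsilon> \<le> z\<^sup>2 / (16 * N)" using z N by (auto simp: \<epsilon>_def)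
  have "\<forall>\<epsilon>>0. \<exists>f\<in>fsums (Cb arr). \<forall>x. norm (famop G a x - reg f x) \<le> \<epsilon>"
    using ID(1)[OF a] unfolding Cstar_r_iff by (rule conjunct2)
  with \<epsilon>(1) obtain f where f: "f \<in> fsums (Cb arr)" "\<forall>x. norm (famop G a x - reg f x) \<le> \<epsilon>" by metis
  obtain q where q: "q \<in> Cb arr" "q x = 1" "\<forall>g. cmod (q g) \<le> 1" "\<forall>g. g \<notin> units G \<longrightarrow> q g = 0"
    and b: "cut q f \<in> fsums (Cb H)"
    using cut_exists[OF oH x f(1)] by (elim exE conjE)
  define c where "c = fam_mult (rho G q) (fam_mult a (rho G q))"
  have qC: "rho G q \<in> Cstar_r G" by (rule rho_in_Cstar_r[OF fsums_base[OF q(1)]])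
  have cI: "c \<in> I" unfolding c_def by (rule ID(6)[OF ID(5)[OF a qC] qC])
  note qop = rho_op[OF fsums_base[OF q(1)]] and fop = rho_op[OF f(1)] and aop = ID(2)[OF a]
  have qn: "norm (reg q y) \<le> 1" for y using q(3) by (intro rho_Cb_op(2)[OF q(1)]) auto
  have cy: "famop G c y = reg q y * (famop G a y * reg q y)" for y
    unfolding c_def fam_mult_op(2)[OF qop fam_mult_op(1)[OF aop qop]] fam_mult_op(2)[OF aop qop] ..
  have by': "reg (cut q f) y = reg q y * (reg f y * reg q y)" for y
    unfolding rho_cut[OF q(1,4) f(1)] fam_mult_op(2)[OF qop fam_mult_op(1)[OF fop qop]] fam_mult_op(2)[OF fop qop] ..
  have sandwich: "norm (Q * (F * Q)) \<le> K" if "norm Q \<le> 1" "norm F \<le> K" for Q F :: "'a bop" and K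
  proof -
    have K: "0 \<le> K" using that(2) norm_ge_zero order_trans by blast
    have "norm (Q * (F * Q)) \<le> norm Q * (norm F * norm Q)"
      by (meson mult_left_mono norm_ge_zero norm_mult_ineq order_trans)
    also have "\<dots> \<le> 1 * (K * 1)" using that K by (intro mult_mono) auto
    finally show ?thesis by simp
  qed
  have close: "norm (reg (cut q f) y - famop G c y) \<le> \<epsilon>" for y
  proof -
    have "reg (cut q f) y - famop G c y
        = reg q y * ((reg f y - famop G a y) * reg q y)"
      unfolding by' cy by (simp add: algebra_simps)
    then show ?thesis using sandwich[OF qn[of y], of "reg f y - famop G a y" \<epsilon>] f(2)
      by (simp add: norm_minus_commute)
  qed
  have bN: "norm (reg (cut q f) y) \<le> N" for y
    unfolding by'
  proof (rule sandwich[OF qn])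
    show "norm (reg f y) \<le> N"
      using norm_triangle_ineq4[of "famop G a y" "famop G a y - reg f y"] B(2)[of y] f(2)[rule_format, of y] \<epsilon>(2)
      by (simp add: N_def)
  qed
  obtain b' where b': "b' \<in> fsums (Cb H)"
    "\<forall>x \<xi> \<eta>. inner (app (reg (cut q f) x) \<xi>) \<eta> = inner \<xi> (app (reg b' x) \<eta>)"
    using fsums_star[OF G0 b] by metis
  let ?d = "Abs_l2 (delta x)"
  have "(norm (app (reg (cut q f) x) ?d))\<^sup>2 \<le> 2 * \<epsilon> * N * (norm ?d)\<^sup>2"
    by (rule ideal_separated[OF G0 I triv b b'(1) b'(2)[rule_format] bN cI close]) (use N \<epsilon> in auto)
  then have up: "(norm (app (reg (cut q f) x) ?d))\<^sup>2 \<le> 2 * \<epsilon> * N" by (simp add: norm_delta)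
  have dS: "delta x \<in> ell2 (S x)" by (rule delta_in_ell2[OF xS])
  have "coord (app (reg (cut q f) x) ?d) x = rho G (cut q f) x (delta x) x"
    unfolding famop_def using coord_bop_of_Abs[OF op_families_bounded[OF rho_op[OF b]] dS] by simp
  also have "\<dots> = cut q f x" by (rule rho_diag[OF b x(1) xS])
  also have "\<dots> = f x" using xx q(2) by (simp add: cut_def)
  finally have "cmod (f x) \<le> norm (app (reg (cut q f) x) ?d)" by (metis norm_coord_le)
  then have "(cmod (f x))\<^sup>2 \<le> 2 * \<epsilon> * N" using up by (meson norm_ge_zero order_trans power_mono)
  moreover have "z / 2 \<le> cmod (f x)"
  proof -
    have "cmod (a x (delta x) x - f x) \<le> \<epsilon>"
      using apply_diff_le[OF aop fop x(1), of \<epsilon> x] f(2) rho_diag[OF f(1) x(1) xS] by simp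
    then show ?thesis using \<epsilon>(3) norm_triangle_ineq2[of "a x (delta x) x" "f x"] by (simp add: z_def)
  qed
  then have "(z / 2)\<^sup>2 \<le> (cmod (f x))\<^sup>2" using z by (intro power_mono) auto
  ultimately have "z\<^sup>2 / 4 \<le> 2 * \<epsilon> * N" by (simp add: power_divide)
  also have "2 * \<epsilon> * N \<le> 2 * (z\<^sup>2 / (16 * N)) * N" using \<epsilon>(4) N by (intro mult_right_mono mult_left_mono) auto
  also have "\<dots> = z\<^sup>2 / 8" using N by simp
  finally show False using z by simp
qed

text \<open>Multiplying \<open>a\<close> by a function supported near \<open>h\<^sup>-\<^sup>1\<close> moves the coefficient at \<open>h\<close> to the unit.\<close>

lemma vanish_on_fibre:
  assumes G0: "open_subgroupoid G H" and I: "closed_ideal G I" and triv: "Cstar_r_sub G H \<inter> I = {fam_zero}"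
    and x: "x \<in> units G" "isotropy G x \<subseteq> H" and a: "a \<in> I"
  shows "a x (delta x) h = 0"
proof -
  note ID = closed_idealD[OF I]
  have dS: "delta x \<in> ell2 (S x)" using unitsD[OF x(1)] by (intro delta_in_ell2 src_fiberI)
  have aS: "a x (delta x) \<in> ell2 (S x)" by (rule bounded_ops_ell2[OF op_families_bounded[OF ID(2)[OF a]]])
  show ?thesis
  proof (cases "h \<in> S x")
    case True
    then have h: "h \<in> arr" "s h = x" by (auto dest: src_fiberD)
    have ih: "iv h \<in> arr" "r (iv h) = x" using h by (auto simp: inv_closed rng_iv)
    obtain W where W: "openin TG W" "iv h \<in> W" "W \<subseteq> arr" "bisection G W"
      using openin_topspace[of TG, unfolded topspace_top] ih(1) by (rule bisection_nbhd)
    obtain f where f: "f \<in> Cb arr" "f (iv h) = 1" "\<And>g. g \<notin> W \<Longrightarrow> f g = 0" "\<And>g. cmod (f g) \<le> 1"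
      using W(1,4,2,3) by (rule Cb_bump) blast
    have f0: "\<forall>g. g \<notin> W \<longrightarrow> f g = 0" using f(3) by blast
    have "fam_mult (rho G f) a \<in> I" by (rule ID(6)[OF a rho_in_Cstar_r[OF fsums_base[OF f(1)]]])
    then have "fam_mult (rho G f) a x (delta x) x = 0" by (rule vanish_at_unit[OF G0 I triv x])
    moreover have "rho G f x (a x (delta x)) x = f (iv h) * a x (delta x) (iv (iv h) \<odot> x)"
      by (rule rho_at[OF W(4) f0 x(1) aS W(2)]) (use unitsD[OF x(1)] ih in \<open>auto intro: src_fiberI\<close>)
    moreover have "iv (iv h) \<odot> x = h" using src_unit[OF h(1)] h by (simp add: inv_inv)
    ultimately show ?thesis using f(2) by (simp add: fam_mult_def)
  next
    case False
    then show ?thesis using aS by (simp add: ell2_def)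
  qed
qed

end

section \<open>Points of continuity\<close>

context lc_etale_groupoid
begin

text \<open>The last clause carries the Hausdorff case along: there the exceptional sets are empty,
  and the final set is empty rather than merely meager.\<close>

definition thin :: "'a set \<Rightarrow> bool" where
  "thin N \<longleftrightarrow> closedin TG N \<and> TG interior_of N = {} \<and> (Hausdorff_space TG \<longrightarrow> N = {})"

definition cont_at :: "('a \<Rightarrow> complex) \<Rightarrow> 'a \<Rightarrow> bool" where
  "cont_at f g \<longleftrightarrow> (\<forall>\<epsilon>>0. \<exists>U. openin TG U \<and> g \<in> U \<and> (\<forall>h\<in>U. cmod (f h - f g) < \<epsilon>))"

lemma cont_at_open:
  assumes W: "openin TG W" "g \<in> W" and f: "continuous_map (sub W) euclidean f"
  shows "cont_at f g"
  unfolding cont_at_def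
proof (intro allI impI)
  fix \<epsilon> :: real assume "\<epsilon> > 0"
  have WT: "topspace (sub W) = W" using openin_subset[OF W(1)] by auto
  have "openin (sub W) {h \<in> topspace (sub W). f h \<in> ball (f g) \<epsilon>}"
    using f by (rule openin_continuous_map_preimage) simp
  then have "openin TG {h \<in> W. f h \<in> ball (f g) \<epsilon>}" unfolding WT openin_open_subtopology[OF W(1)] by (rule conjunct1)
  then show "\<exists>U. openin TG U \<and> g \<in> U \<and> (\<forall>h\<in>U. cmod (f h - f g) < \<epsilon>)"
    using W(2) \<open>\<epsilon> > 0\<close>
    by (intro exI[of _ "{h \<in> W. f h \<in> ball (f g) \<epsilon>}"]) (auto simp: dist_norm norm_minus_commute)
qed

text \<open>\<open>f\<close> is continuous on the open set \<open>W\<close> and zero outside it, so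
  it can jump only on the boundary of \<open>W\<close>, which is closed with empty interior because
  \<open>W\<close> is open. If \<open>G\<close> is Hausdorff, the compact support is closed and no
  jump occurs.\<close>

lemma Cb_cont_at:
  assumes f: "f \<in> Cb arr"
  shows "\<exists>N. thin N \<and> (\<forall>g\<in>arr - N. cont_at f g)"
proof -
  obtain W K where Wa: "W \<subseteq> arr" and "supported W K f" using f by (rule CbE)
  note W = supportedD[OF this(2)]
  show ?thesis
  proof (cases "Hausdorff_space TG")
    case True
    have "closedin TG K" using True W(4) by (rule compactin_imp_closedin)
    then have "continuous_map TG euclidean f" by (rule continuous_map_extend_zero[OF W(1) _ W(3,6,5)])
    then have "continuous_map (sub arr) euclidean f" by (rule continuous_map_from_subtopology)
    then have "cont_at f g" if "g \<in> arr" for g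
      using cont_at_open[of arr g f] openin_topspace[of TG] that by simp
    then show ?thesis by (intro exI[of _ "{}"]) (auto simp: thin_def)
  next
    case False
    let ?N = "TG closure_of W - W"
    have "closedin TG ?N" using W(1) by (intro closedin_diff closedin_closure_of)
    moreover have "TG interior_of ?N = {}"
    proof (rule ccontr)
      assume "TG interior_of ?N \<noteq> {}"
      then obtain g where g: "g \<in> TG interior_of ?N" by blast
      then have "g \<in> TG closure_of W" using interior_of_subset[of TG ?N] by blast
      moreover have "openin TG (TG interior_of ?N)" by simp
      ultimately obtain w where "w \<in> W" "w \<in> TG interior_of ?N" using g unfolding in_closure_of by blast
      then show False using interior_of_subset[of TG ?N] by blast
    qed
    moreover have "cont_at f g" if g: "g \<in> arr - ?N" for g
    proof (cases "g \<in> W")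
      case True
      then show ?thesis using W(1,6) cont_at_open by blast
    next
      case gW: False
      let ?U = "arr - TG closure_of W"
      have "openin TG ?U" using openin_diff[OF openin_topspace closedin_closure_of, of TG W] by simp
      moreover have "g \<in> ?U" using g gW by blast
      moreover have "f h = 0" if "h \<in> ?U \<union> {g}" for h
      proof -
        have "W \<subseteq> TG closure_of W" using Wa by (simp add: closure_of_subset)
        then have "h \<notin> K" using that W(3) gW by blast
        then show ?thesis by (rule W(5))
      qed
      ultimately show ?thesis unfolding cont_at_def by (intro allI impI exI[of _ ?U]) auto
    qed
    ultimately show ?thesis using False unfolding thin_def by blast
  qed
qed

lemma cont_at_add:
  assumes "cont_at f g" "cont_at h g"
  shows "cont_at (\<lambda>k. f k + h k) g"
  unfolding cont_at_def
proof (intro allI impI)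
  fix \<epsilon> :: real assume "\<epsilon> > 0"
  then have e: "\<epsilon> / 2 > 0" by simp
  obtain U where U: "openin TG U" "g \<in> U" "\<And>k. k \<in> U \<Longrightarrow> cmod (f k - f g) < \<epsilon> / 2"
    using assms(1) e unfolding cont_at_def by metis
  obtain V where V: "openin TG V" "g \<in> V" "\<And>k. k \<in> V \<Longrightarrow> cmod (h k - h g) < \<epsilon> / 2"
    using assms(2) e unfolding cont_at_def by metis
  have "cmod (f k + h k - (f g + h g)) < \<epsilon>" if "k \<in> U \<inter> V" for k
    using norm_triangle_ineq[of "f k - f g" "h k - h g"] U(3)[of k] V(3)[of k] that by (simp add: algebra_simps)
  then show "\<exists>U. openin TG U \<and> g \<in> U \<and> (\<forall>k\<in>U. cmod (f k + h k - (f g + h g)) < \<epsilon>)"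
    using U V by (intro exI[of _ "U \<inter> V"]) auto
qed

lemma fsums_cont_at:
  assumes f: "f \<in> fsums (Cb arr)"
  shows "\<exists>N. thin N \<and> (\<forall>g\<in>arr - N. cont_at f g)"
  using f
proof (induction rule: fsums.induct)
  case zero
  have "cont_at (\<lambda>_. 0) g" if "g \<in> arr" for g
    unfolding cont_at_def using openin_topspace[of TG] that by (intro allI impI exI[of _ arr]) simp
  then show ?case by (intro exI[of _ "{}"]) (auto simp: thin_def)
next
  case (add f \<phi>)
  obtain N where N: "thin N" "\<forall>g\<in>arr - N. cont_at f g" using add.IH by (elim exE conjE)
  obtain N' where N': "thin N'" "\<forall>g\<in>arr - N'. cont_at \<phi> g"
    using Cb_cont_at[OF add.hyps(2)] by (elim exE conjE)
  show ?case
    using N N' by (intro exI[of _ "N \<union> N'"]) (auto simp: thin_def interior_of_union_eq_empty cont_at_add)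
qed

text \<open>The image is closed only relative to \<open>s\<close> applied to \<open>W\<close>, so
  its closure in the unit space has to be examined. If that closure contained a nonempty open
  \<open>V\<close>, the arrows of \<open>W\<close> over \<open>V\<close> would form a nonempty open
  set \<open>Q\<close> not contained in \<open>N\<close>. The image of \<open>Q - N\<close> is open
  and lies in the closure, but injectivity of \<open>s\<close> on \<open>W\<close> keeps it disjoint
  from the image of \<open>N \<inter> W\<close>.\<close>

lemma nowhere_dense_src_image:
  assumes "thin N" and W: "openin TG W" "bisection G W"
  shows "unit_top G interior_of (unit_top G closure_of (s ` (N \<inter> W))) = {}"
proof (rule ccontr)
  have N: "closedin TG N" "TG interior_of N = {}" using \<open>thin N\<close> by (simp_all add: thin_def)
  let ?C = "unit_top G closure_of (s ` (N \<inter> W))"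
  assume "unit_top G interior_of ?C \<noteq> {}"
  then obtain y where y: "y \<in> unit_top G interior_of ?C" by blast
  define V where "V = unit_top G interior_of ?C"
  have V: "openin (unit_top G) V" "V \<subseteq> ?C" "y \<in> V"
    using y interior_of_subset[of "unit_top G" ?C] by (auto simp: V_def)
  have "y \<in> ?C" using V(2,3) by blast
  then obtain z where "z \<in> s ` (N \<inter> W)" "z \<in> V" using V(1,3) unfolding in_closure_of by metis
  then obtain n where n: "n \<in> N \<inter> W" "s n \<in> V" by blast
  have oV: "openin TG V" using V(1) by (simp add: openin_unit_top)
  have Wa: "W \<subseteq> arr" using bisectionD[OF W(2)] by blast
  define Q where "Q = W \<inter> {k \<in> arr. s k \<in> V}"
  have oQ: "openin TG Q" unfolding Q_def using W(1) openin_src_preimage[OF oV] by (rule openin_Int)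
  have "n \<in> Q" using n Wa by (auto simp: Q_def)
  then have "\<not> Q \<subseteq> N" using interior_of_maximal[OF _ oQ, of N] N(2) by blast
  then obtain w where w: "w \<in> Q - N" by blast
  have "openin TG (s ` (Q - N))" using oQ N(1) by (intro openin_src_image openin_diff)
  moreover have "s ` (Q - N) \<subseteq> units G" using src_in_units by (auto simp: Q_def)
  ultimately have "openin (unit_top G) (s ` (Q - N))" by (simp add: openin_unit_top)
  moreover have "s w \<in> ?C" "s w \<in> s ` (Q - N)" using w V(2) by (auto simp: Q_def)
  ultimately obtain z where z: "z \<in> s ` (N \<inter> W)" "z \<in> s ` (Q - N)" unfolding in_closure_of by metis
  then obtain n' w' where "n' \<in> N \<inter> W" "w' \<in> Q - N" "s n' = s w'" by (metis imageE)
  then show False using bisectionD(3)[OF W(2)] by (auto simp: Q_def inj_on_def)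
qed

text \<open>Since \<open>s\<close> is an open map, density of \<open>X\<close> among the units
  passes to density of the arrows with source in \<open>X\<close>. The approximating functions,
  where continuous, carry the vanishing from those arrows to \<open>g\<close>.\<close>

lemma ideal_vanishes_off_discontinuities:
  assumes G0: "open_subgroupoid G H" and I: "closed_ideal G I" and triv: "Cstar_r_sub G H \<inter> I = {fam_zero}"
    and dense: "unit_top G closure_of X = units G" and X: "\<forall>x \<in> X. isotropy G x \<subseteq> H" and a: "a \<in> I"
  shows "\<exists>N :: nat \<Rightarrow> 'a set. (\<forall>m. thin (N m)) \<and>
    (\<forall>g\<in>arr. (\<forall>m. g \<notin> N m) \<longrightarrow> a (s g) (delta (s g)) g = 0)"
proof -
  note ID = closed_idealD[OF I]
  have ap: "\<forall>\<epsilon>>0. \<exists>f\<in>fsums (Cb arr). \<forall>x. norm (famop G a x - reg f x) \<le> \<epsilon>"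
    using ID(1)[OF a] unfolding Cstar_r_iff by (rule conjunct2)
  have "\<exists>f N. f \<in> fsums (Cb arr) \<and> (\<forall>x. norm (famop G a x - reg f x) \<le> inverse (real (Suc m))) \<and>
      thin N \<and> (\<forall>g\<in>arr - N. cont_at f g)" for m
  proof -
    have "inverse (real (Suc m)) > 0" by simp
    with ap obtain f where f: "f \<in> fsums (Cb arr)" "\<forall>x. norm (famop G a x - reg f x) \<le> inverse (real (Suc m))" by metis
    obtain N where "thin N" "\<forall>g\<in>arr - N. cont_at f g"
      using fsums_cont_at[OF f(1)] by (elim exE conjE)
    with f show ?thesis by (intro exI[of _ f] exI[of _ N] conjI)
  qed
  then obtain f N where fN: "\<And>m. f m \<in> fsums (Cb arr)"
    "\<And>m x. norm (famop G a x - reg (f m) x) \<le> inverse (real (Suc m))"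
    "\<And>m. thin (N m)" "\<And>m g. g \<in> arr - N m \<Longrightarrow> cont_at (f m) g" by metis
  have close: "cmod (a (s g) (delta (s g)) g - f m g) \<le> inverse (real (Suc m))" if g: "g \<in> arr" for g m
    using apply_diff_le[OF ID(2)[OF a] rho_op[OF fN(1)] src_in_units[OF g] fN(2), of g]
      rho_diag[OF fN(1) src_in_units[OF g] src_fiberI[OF g refl]] by simp
  have "a (s g) (delta (s g)) g = 0" if g: "g \<in> arr" and gN: "\<forall>m. g \<notin> N m" for g
  proof (rule ccontr)
    assume nz: "a (s g) (delta (s g)) g \<noteq> 0"
    define z where "z = cmod (a (s g) (delta (s g)) g)"
    have z: "z / 3 > 0" using nz by (simp add: z_def)
    \<comment> \<open>Three errors below \<open>z / 3\<close> contradict the choice of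
      \<open>z\<close>: from the coefficient at \<open>g\<close> to \<open>f m g\<close>, from there
      to \<open>f m h\<close> at a nearby \<open>h\<close> with source in \<open>X\<close>, and from
      there to the coefficient 0 at \<open>h\<close>.\<close>
    obtain m where m: "inverse (real (Suc m)) < z / 3" using reals_Archimedean[OF z] by blast
    have "cont_at (f m) g" using fN(4)[of g m] g gN by blast
    then obtain U where U: "openin TG U" "g \<in> U" "\<forall>h\<in>U. cmod (f m h - f m g) < z / 3"
      using z unfolding cont_at_def by metis
    have Ua: "U \<subseteq> arr" using openin_subset[OF U(1)] by simp
    then have "s ` U \<subseteq> units G" using src_in_units by blast
    then have oU: "openin (unit_top G) (s ` U)" using openin_src_image[OF U(1)] by (simp add: openin_unit_top)
    have "s g \<in> unit_top G closure_of X" unfolding dense by (rule src_in_units[OF g])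
    moreover have "s g \<in> s ` U" using U(2) by blast
    ultimately obtain y where "y \<in> X" "y \<in> s ` U" using oU unfolding in_closure_of by metis
    then obtain h where h: "h \<in> U" "s h \<in> X" by blast
    have ha: "h \<in> arr" using h Ua by blast
    have "a (s h) (delta (s h)) h = 0"
      by (rule vanish_on_fibre[OF G0 I triv src_in_units[OF ha] bspec[OF X h(2)] a])
    then have "cmod (f m h) \<le> inverse (real (Suc m))" using close[OF ha, of m] by simp
    moreover have "cmod (f m h - f m g) < z / 3" using U(3) h(1) by blast
    moreover have "cmod (a (s g) (delta (s g)) g - f m g) \<le> inverse (real (Suc m))" by (rule close[OF g])
    ultimately show False
      using m norm_triangle_ineq2[of "a (s g) (delta (s g)) g" "f m g"] norm_triangle_ineq2[of "f m g" "f m h"]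
      unfolding z_def by (simp add: norm_minus_commute)
  qed
  then show ?thesis using fN(3) by (intro exI[of _ N] conjI ballI allI impI)
qed

theorem ideal_subset_J_sing:
  assumes cover: "Hausdorff_space TG \<or> (\<exists>\<W>. countable \<W> \<and> (\<forall>W \<in> \<W>. openin TG W \<and> bisection G W) \<and> \<Union>\<W> = arr)"
    and G0: "open_subgroupoid G H" and I: "closed_ideal G I" and triv: "Cstar_r_sub G H \<inter> I = {fam_zero}"
    and dense: "unit_top G closure_of X = units G" and X: "\<forall>x \<in> X. isotropy G x \<subseteq> H"
  shows "I \<subseteq> J_sing G"
proof
  fix a assume a: "a \<in> I"
  note ID = closed_idealD[OF I]
  define B where "B = {x \<in> units G. a x (delta x) \<noteq> (\<lambda>_. 0)}"
  obtain N :: "nat \<Rightarrow> 'a set" where N: "\<forall>m. thin (N m)"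
    "\<forall>g\<in>arr. (\<forall>m. g \<notin> N m) \<longrightarrow> a (s g) (delta (s g)) g = 0"
    using ideal_vanishes_off_discontinuities[OF G0 I triv dense X a] by (elim exE conjE)
  have B: "\<exists>g m. g \<in> arr \<and> s g = x \<and> g \<in> N m" if "x \<in> B" for x
  proof -
    have "a x (delta x) \<noteq> (\<lambda>_. 0)" using that by (simp add: B_def)
    then obtain g where g: "a x (delta x) g \<noteq> 0" by blast
    have "a x (delta x) \<in> ell2 (S x)" by (rule bounded_ops_ell2[OF op_families_bounded[OF ID(2)[OF a]]])
    then have "g \<in> S x" using g by (auto simp: ell2_def)
    then have ga: "g \<in> arr" "s g = x" by (auto dest: src_fiberD)
    then obtain m where "g \<in> N m" using N(2) g by metis
    then show ?thesis using ga by blast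
  qed
  have "meager_in (unit_top G) B"
  proof (cases "Hausdorff_space TG")
    case True
    then have "N m = {}" for m using N(1) by (simp add: thin_def)
    then have "B = {}" using B by blast
    then show ?thesis unfolding meager_in_def by (intro exI[of _ "{}"]) simp
  next
    case False
    then obtain \<W> where W: "countable \<W>" "\<forall>W \<in> \<W>. openin TG W \<and> bisection G W" "\<Union>\<W> = arr" using cover by metis
    \<comment> \<open>The pieces are indexed by a level \<open>m\<close> and a bisection of the
      countable cover. They are intersected with \<open>B\<close> because \<open>meager_in\<close>
      asks for equality with a union, not for an inclusion.\<close>
    define P where "P p = B \<inter> s ` (N (fst p) \<inter> snd p)" for p
    have "nowhere_dense_in (unit_top G) (P (m, W))" if "W \<in> \<W>" for m W
    proof -
      have "unit_top G interior_of (unit_top G closure_of (P (m, W)))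
          \<subseteq> unit_top G interior_of (unit_top G closure_of (s ` (N m \<inter> W)))"
        by (intro interior_of_mono closure_of_mono) (simp add: P_def)
      also have "\<dots> = {}" using N(1) W(2) that by (intro nowhere_dense_src_image) simp_all
      finally show ?thesis by (auto simp: nowhere_dense_in_def P_def B_def)
    qed
    then have "\<forall>M \<in> P ` (UNIV \<times> \<W>). nowhere_dense_in (unit_top G) M" by auto
    moreover have "countable (P ` (UNIV \<times> \<W>))" using W(1) by (intro countable_image countable_SIGMA) auto
    moreover have "B = \<Union> (P ` (UNIV \<times> \<W>))"
    proof
      show "B \<subseteq> \<Union> (P ` (UNIV \<times> \<W>))"
      proof
        fix x assume x: "x \<in> B"
        then obtain g m where g: "g \<in> arr" "s g = x" "g \<in> N m" using B by metis
        then obtain W where "W \<in> \<W>" "g \<in> W" using W(3) by blast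
        then show "x \<in> \<Union> (P ` (UNIV \<times> \<W>))" using g x by (intro UN_I[of "(m, W)"]) (auto simp: P_def)
      qed
    qed (auto simp: P_def)
    ultimately show ?thesis unfolding meager_in_def by (intro exI[of _ "P ` (UNIV \<times> \<W>)"] conjI)
  qed
  then show "a \<in> J_sing G" using ID(1)[OF a] by (simp add: J_sing_def B_def)
qed

end

theorem theorem4p8:
  fixes G :: "'a top_groupoid" and H :: "'a set" and I :: "'a op_family set"
  assumes "lc_etale_groupoid G"
    and "Hausdorff_space (gtop G) \<or>
      (\<exists>\<W>. countable \<W> \<and> (\<forall>W \<in> \<W>. openin (gtop G) W \<and> bisection G W) \<and> \<Union>\<W> = arrows G)"
    and "open_subgroupoid G H"
    and "unit_top G closure_of
          {x \<in> units (restrict_groupoid G H). isotropy (restrict_groupoid G H) x = isotropy G x}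
        = units G"
    and "closed_ideal G I"
    and "Cstar_r_sub G H \<inter> I = {fam_zero}"
  shows "I \<subseteq> J_sing G"
proof (rule lc_etale_groupoid.ideal_subset_J_sing[OF assms(1-3,5,6,4)], intro ballI)
  fix x assume "x \<in> {x \<in> units (restrict_groupoid G H). isotropy (restrict_groupoid G H) x = isotropy G x}"
  then have "isotropy G x = isotropy (restrict_groupoid G H) x" by simp
  also have "\<dots> \<subseteq> H"
    by (auto simp: isotropy_def src_fiber_def arrows_def restrict_groupoid_def)
  finally show "isotropy G x \<subseteq> H" .
qed

end
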